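(* Let $\mathfrak D\subset\mathbb{R}^d$ be a regular domain, $\mathfrak D^{\mathrm{ext}}=\mathbb{R}^d\setminus\mathfrak D$, $\lambda:\mathfrak D^{\mathrm{ext}}\to\mathbb{R}_+$ bounded and measurable, $\mu$ a finite measure on $\mathfrak D$, and let $\{\eta_t,\ t\ge0\}$ be the boundary driven Markov gas in $\mathfrak D$ with reservoir intensity $\lambda$, started from a finite point configuration $\eta$ on $\mathfrak D$. Let $n\in\mathbb{N}$. (a) For all $t\ge0$ and all bounded, measurable and permutation invariant $f:\mathfrak D^n\to\mathbb{R}$, $$\mathbb{E}^\lambda_\eta\left[\int_{\mathfrak D^n}f(\boldsymbol z)\,\eta_t^{(n)}(\mathrm{d}\boldsymbol z)\right]=\sum_{k=0}^n\binom nk\int_{\mathfrak D^n}f(\boldsymbol z)\,\lambda_t^{\otimes k}(\mathrm{d}\boldsymbol z_{[k]})\otimes(S_t^{\otimes(n-k)})^*\eta^{(n-k)}(\mathrm{d}\boldsymbol z_{[n]\setminus[k]}).$$ (b) Assume further that, for $t>0$, the transition probability of the absorbed process $\{X_t\}$ satisfies $p_t(x,\mathrm{d}y)=\mathfrak p_t(x,y)\,m(\mathrm{d}y)$ on $\mathfrak D$, for a symmetric function $\mathfrak p_t(x,y)$ and a finite measure $m$ on $\mathfrak D$. Then, choosing $\mu=m$, for all $t>0$ the measure $\mathbb{E}^\lambda_\eta[\eta_t^{(n)}]$ has the density $$\frac{\mathrm{d}\mathbb{E}^\lambda_\eta[\eta_t^{(n)}]}{\mathrm{d}m^{\otimes n}}(\boldsymbol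 z)=\sum_{I\subset[n]}\mathbb{E}^{\mathrm{abs}}_{\boldsymbol z_I}\left[e^{\int_{\mathfrak D^{\mathrm{ext}}}\log(\lambda)\,\mathrm{d}\xi_t}\mathbf 1_{\{\xi_t(\mathfrak D^{\mathrm{ext}})=|I|\}}\right]\int_{\mathfrak D^{n-|I|}}\mathfrak p_t^{(n-|I|)}(\boldsymbol z_{[n]\setminus I},\boldsymbol y)\,\eta^{(n-|I|)}(\mathrm{d}\boldsymbol y).$$
   Context: **Domain and absorbed process.** A regular domain $\mathfrak D\subset\mathbb{R}^d$ is an open, simply connected, bounded set with Lipschitz boundary. $\{Y_t\}$ is a strong Markov process on $\mathbb{R}^d$ (possibly with jumps). $\{X_t\}$ is the Markov process on $\mathbb{R}^d$ evolving as $Y$ in $\mathfrak D$ and absorbed upon hitting $\mathfrak D^{\mathrm{ext}}=\mathbb{R}^d\setminus\mathfrak D$. Its semigroup is $S_t$, its transition probability $p_t$, and its law from $x$ is $\mathbb{P}^{\mathrm{abs}}_x$. With $\tau_{\mathfrak D^{\mathrm{ext}}}$ the hitting time of $\mathfrak D^{\mathrm{ext}}$, it is assumed that $\mathbb{P}^{\mathrm{abs}}_x(\tau_{\mathfrak D^{\mathrm{ext}}}<\infty)=1$ for $x\in\mathfrak D$. **Absorbed particle system.** For $\boldsymbol x=(x_1,\dots,x_k)\in\mathfrak D^k$, $\mathbb{E}^{\mathrm{abs}}_{\boldsymbol x}$ is the expectation for $\xi_t=\sum_{i=1}^k\delta_{X_t(i)}$ on $\mathbb{R}^d$, with $X(i)$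 independent copies of $X$, $X_0(i)=x_i$. **Boundary driven Markov gas.** Started from $\eta=\sum_{i=1}^{\mathbf N}\delta_{x_i}$, $x_i\in\mathfrak D$, it is $\eta_t=\xi_t|_{\mathfrak D}+\Theta_t$, viewed as a point configuration on $\mathfrak D$. Here $\xi_t$ is the absorbed particle system with $\xi_0=\eta$, $\xi_t|_{\mathfrak D}$ is its restriction to $\mathfrak D$, and $\Theta_t$, independent of $\xi_t$, is a Poisson point process on $\mathfrak D$ with intensity measure $$\lambda_t(\mathrm{d}x)=\left(\int_{\mathfrak D^{\mathrm{ext}}}\lambda(y)\,\mathbb{P}^{\mathrm{abs}}_x(\tau_{\mathfrak D^{\mathrm{ext}}}\le t,\ X_{\tau_{\mathfrak D^{\mathrm{ext}}}}\in\mathrm{d}y)\right)\mu(\mathrm{d}x),$$ which is supposed to be finite. $\mathbb{E}^\lambda_\eta$ denotes expectation for this process. **Factorial measures.** For a finite configuration $\eta=\sum_{i=1}^{\mathbf N}\delta_{x_i}$, $\eta^{(n)}=\sum^{\neq}_{1\le i_1,\dots,i_n\le\mathbf N}\delta_{(x_{i_1},\dots,x_{i_n})}$ (sum over mutually distinct indices); $\eta_t^{(n)}$ is that of $\eta_t$. **Notation.** $S_t^{\otimes n}$ is the semigroup of $n$ independent copies of $X$. $(S_t^{\otimes n})^*$ acts on measures by $\int f\,\mathrm{d}(S_t^{\otimes n})^*\nu=\int S_t^{\otimes n}f\,\mathrm{d}\nu$. $\mathfrak p_t^{(n)}(\boldsymbol x,\boldsymbol y)=\prod_{i=1}^n\mathfrak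 p_t(x_i,y_i)$. $[n]=\{1,\dots,n\}$; for $I=\{i_1<\dots<i_k\}$, $\boldsymbol z_I=(z_{i_1},\dots,z_{i_k})$. Terms with no variables have the corresponding factor equal to $1$. $e^{\int_{\mathfrak D^{\mathrm{ext}}}\log(\lambda)\mathrm{d}\xi_t}$ means the product of $\lambda$ over the points of $\xi_t$ in $\mathfrak D^{\mathrm{ext}}$ (so it is $0$ if $\lambda$ vanishes at such a point). *)

theory Defs
  imports "HOL-Probability.Probability"
begin

section \<open>Regular domains\<close>

text \<open>Near each boundary point, and after choosing a direction \<^term>\<open>e\<close>, the set is the part
  lying below the graph of a Lipschitz function on the hyperplane orthogonal to \<^term>\<open>e\<close>.\<close>

definition lipschitz_boundary :: "'a::euclidean_space set \<Rightarrow> bool" where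
  "lipschitz_boundary D \<longleftrightarrow>
     (\<forall>p\<in>frontier D. \<exists>U e (\<phi> :: 'a \<Rightarrow> real) L.
        open U \<and> p \<in> U \<and> norm e = 1 \<and> lipschitz_on L {v. v \<bullet> e = 0} \<phi> \<and>
        (\<forall>x\<in>U. x \<in> D \<longleftrightarrow> x \<bullet> e < \<phi> (x - (x \<bullet> e) *\<^sub>R e)))"

definition regular_domain :: "'a::euclidean_space set \<Rightarrow> bool" where
  "regular_domain D \<longleftrightarrow> open D \<and> simply_connected D \<and> bounded D \<and> lipschitz_boundary D"

section \<open>The process and its absorbed version\<close>

text \<open>Time is a real number, used only for nonnegative values. Filtrations are indexed by
  \<^typ>\<open>ennreal\<close>, so that stopping times in the sense of the library may take the value
  \<^term>\<open>\<infinity>\<close>. Measurability in the starting point is required only of the transition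
  probabilities, not of the whole path law, so that the underlying sigma-algebra may be a
  completed one.\<close>

locale strong_markov_process = filtration "space M" F
  for M :: "'w measure" and F :: "ennreal \<Rightarrow> 'w measure" +
  fixes P :: "'a::euclidean_space \<Rightarrow> 'w measure"
    and Y :: "real \<Rightarrow> 'w \<Rightarrow> 'a"
  assumes sets_F_subset: "\<And>s. sets (F s) \<subseteq> sets M"
    and prob_space_P: "\<And>x. prob_space (P x)"
    and sets_P: "\<And>x. sets (P x) = sets M"
    and adapted: "\<And>t. 0 \<le> t \<Longrightarrow> Y t \<in> F (ennreal t) \<rightarrow>\<^sub>M borel"
    and start: "\<And>x. AE \<omega> in P x. Y 0 \<omega> = x"
    and right_continuous:
      "\<And>\<omega> t. \<omega> \<in> space M \<Longrightarrow> 0 \<le> t \<Longrightarrow> continuous (at_right t) (\<lambda>s. Y s \<omega>)"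
    and transition_kernel:
      "\<And>t. 0 \<le> t \<Longrightarrow> (\<lambda>x. distr (P x) borel (Y t)) \<in> borel \<rightarrow>\<^sub>M prob_algebra borel"
    and strong_markov:
      "\<And>x T t A B. stopping_time F T \<Longrightarrow> A \<in> sets (pre_sigma T) \<Longrightarrow> 0 \<le> t \<Longrightarrow> B \<in> sets borel \<Longrightarrow>
         emeasure (P x) {\<omega>\<in>A. T \<omega> < \<infinity> \<and> Y (enn2real (T \<omega>) + t) \<omega> \<in> B} =
         (\<integral>\<^sup>+\<omega>\<in>{\<omega>\<in>A. T \<omega> < \<infinity>}.
            emeasure (distr (P (Y (enn2real (T \<omega>)) \<omega>)) borel (Y t)) B \<partial>P x)"

definition hit_time :: "(real \<Rightarrow> 'w \<Rightarrow> 'a) \<Rightarrow> 'a set \<Rightarrow> 'w \<Rightarrow> ennreal" where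
  "hit_time Z A \<omega> = (INF t\<in>{t. 0 \<le> t \<and> Z t \<omega> \<in> A}. ennreal t)"

definition absorbed :: "(real \<Rightarrow> 'w \<Rightarrow> 'a) \<Rightarrow> 'a set \<Rightarrow> real \<Rightarrow> 'w \<Rightarrow> 'a" where
  "absorbed Y D t \<omega> = Y (enn2real (min (ennreal t) (hit_time Y (- D) \<omega>))) \<omega>"

locale absorbed_process = strong_markov_process M F P Y
  for M :: "'w measure" and F :: "ennreal \<Rightarrow> 'w measure"
    and P :: "'a::euclidean_space \<Rightarrow> 'w measure" and Y :: "real \<Rightarrow> 'w \<Rightarrow> 'a" +
  fixes D :: "'a set" and X :: "real \<Rightarrow> 'w \<Rightarrow> 'a"
  assumes regular: "regular_domain D"
    and X_eq: "X = absorbed Y D"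
    and hit_time_stopping: "stopping_time F (hit_time Y (- D))"
    and absorbed_kernel:
      "\<And>t. 0 \<le> t \<Longrightarrow> (\<lambda>x. distr (P x) borel (X t)) \<in> borel \<rightarrow>\<^sub>M prob_algebra borel"
    and hit_time_finite: "\<And>x. x \<in> D \<Longrightarrow> AE \<omega> in P x. hit_time X (- D) \<omega> < \<infinity>"

definition transition :: "('a::euclidean_space \<Rightarrow> 'w measure) \<Rightarrow> (real \<Rightarrow> 'w \<Rightarrow> 'a) \<Rightarrow>
    real \<Rightarrow> 'a \<Rightarrow> 'a measure" where
  "transition P X t x = distr (P x) borel (X t)"

section \<open>Measures on tuples\<close>

text \<open>Points of the n-fold product of a space are extensional functions on \<^term>\<open>{1..n}\<close>,
  the carrier of \<^term>\<open>PiM {1..n} (\<lambda>_. S)\<close>.\<close>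

abbreviation domain_borel :: "'a::euclidean_space set \<Rightarrow> 'a measure" where
  "domain_borel D \<equiv> restrict_space borel D"

text \<open>The measure on \<^term>\<open>K\<close> sending \<^term>\<open>A\<close> to the integral of
  \<^term>\<open>emeasure (\<kappa> x) A\<close> against \<^term>\<open>\<nu>\<close>. Unlike the library's monadic bind, it allows
  total masses above one.\<close>

definition mixture :: "'b measure \<Rightarrow> 'c measure \<Rightarrow> ('c \<Rightarrow> 'b measure) \<Rightarrow> 'b measure" where
  "mixture K \<nu> \<kappa> = measure_of (space K) (sets K) (\<lambda>A. \<integral>\<^sup>+x. emeasure (\<kappa> x) A \<partial>\<nu>)"

text \<open>The semigroup of \<^term>\<open>n\<close> independent copies of \<^term>\<open>X\<close>, acting on a measure
  \<^term>\<open>\<nu>\<close> on n-tuples. This is the duality relation for indicator functions, to which the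
  semigroup assigns the transition probabilities.\<close>

definition semigroup_dual :: "('a::euclidean_space \<Rightarrow> 'w measure) \<Rightarrow> (real \<Rightarrow> 'w \<Rightarrow> 'a) \<Rightarrow>
    real \<Rightarrow> nat \<Rightarrow> (nat \<Rightarrow> 'a) measure \<Rightarrow> (nat \<Rightarrow> 'a) measure" where
  "semigroup_dual P X t n \<nu> =
     mixture (PiM {1..n} (\<lambda>_. borel)) \<nu> (\<lambda>x. PiM {1..n} (\<lambda>i. transition P X t (x i)))"

text \<open>The product of a measure in the first \<^term>\<open>k\<close> of \<^term>\<open>n\<close> coordinates and a measure
  in the remaining ones, the latter being indexed by \<^term>\<open>{1..n-k}\<close>.\<close>

definition join_measure :: "'a measure \<Rightarrow> nat \<Rightarrow> nat \<Rightarrow> (nat \<Rightarrow> 'a) measure \<Rightarrow>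
    (nat \<Rightarrow> 'a) measure \<Rightarrow> (nat \<Rightarrow> 'a) measure" where
  "join_measure S n k \<alpha> \<beta> =
     distr (\<alpha> \<Otimes>\<^sub>M \<beta>) (PiM {1..n} (\<lambda>_. S))
       (\<lambda>(u, v). \<lambda>i\<in>{1..n}. if i \<le> k then u i else v (i - k))"

definition subtuple :: "(nat \<Rightarrow> 'a) \<Rightarrow> nat set \<Rightarrow> nat \<Rightarrow> 'a" where
  "subtuple z I = (\<lambda>j\<in>{1..card I}. z (sorted_list_of_set I ! (j - 1)))"

section \<open>Point configurations\<close>

text \<open>Finite point configurations (finite sums of Dirac measures) are multisets.\<close>

definition config :: "nat \<Rightarrow> (nat \<Rightarrow> 'a) \<Rightarrow> 'a multiset" where
  "config k x = image_mset x (mset_set {1..k})"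

definition npoints :: "'a set \<Rightarrow> 'a multiset \<Rightarrow> nat" where
  "npoints B \<eta> = size {#x \<in># \<eta>. x \<in> B#}"

definition config_space :: "'a measure \<Rightarrow> 'a multiset measure" where
  "config_space S = sigma {\<eta>. set_mset \<eta> \<subseteq> space S}
     {{\<eta>. set_mset \<eta> \<subseteq> space S \<and> npoints B \<eta> = j} | B j. B \<in> sets S}"

text \<open>The sum of the Dirac measures at the n-tuples of points of the configuration with mutually
  distinct indices. It does not depend on the enumeration \<^term>\<open>xs\<close>. For \<^term>\<open>n = 0\<close> it is
  the Dirac measure at the empty tuple.\<close>

definition factorial_measure :: "'a measure \<Rightarrow> nat \<Rightarrow> 'a multiset \<Rightarrow> (nat \<Rightarrow> 'a) measure" where
  "factorial_measure S n \<eta> =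
     (let xs = (SOME xs. mset xs = \<eta>) in
      distr (count_space {i \<in> {1..n} \<rightarrow>\<^sub>E {..<size \<eta>}. inj_on i {1..n}})
        (PiM {1..n} (\<lambda>_. S)) (\<lambda>i. \<lambda>j\<in>{1..n}. xs ! i j))"

text \<open>The Poisson weights are written out because the library's \<^term>\<open>poisson_pmf\<close> requires
  a positive rate.\<close>

definition poisson_point_process ::
    "'v measure \<Rightarrow> 'a measure \<Rightarrow> 'a measure \<Rightarrow> ('v \<Rightarrow> 'a multiset) \<Rightarrow> bool" where
  "poisson_point_process N S \<nu> \<Theta> \<longleftrightarrow>
     \<Theta> \<in> N \<rightarrow>\<^sub>M config_space S \<and>
     (\<forall>B\<in>sets S. \<forall>j. measure N {\<omega>\<in>space N. npoints B (\<Theta> \<omega>) = j} =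
        measure \<nu> B ^ j / fact j * exp (- measure \<nu> B)) \<and>
     (\<forall>(I::nat set) B. finite I \<longrightarrow> B ` I \<subseteq> sets S \<longrightarrow> disjoint_family_on B I \<longrightarrow>
        prob_space.indep_vars N (\<lambda>_. count_space UNIV) (\<lambda>i \<omega>. npoints (B i) (\<Theta> \<omega>)) I)"

section \<open>The boundary driven Markov gas\<close>

definition copies :: "('a \<Rightarrow> 'w measure) \<Rightarrow> nat \<Rightarrow> (nat \<Rightarrow> 'a) \<Rightarrow> (nat \<Rightarrow> 'w) measure" where
  "copies P k x = PiM {1..k} (\<lambda>i. P (x i))"

definition particles :: "(real \<Rightarrow> 'w \<Rightarrow> 'a) \<Rightarrow> nat \<Rightarrow> real \<Rightarrow> (nat \<Rightarrow> 'w) \<Rightarrow> 'a multiset" where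
  "particles X k t \<omega> = config k (\<lambda>i. X t (\<omega> i))"

definition reservoir_measure :: "('a::euclidean_space \<Rightarrow> 'w measure) \<Rightarrow> (real \<Rightarrow> 'w \<Rightarrow> 'a) \<Rightarrow>
    'a set \<Rightarrow> ('a \<Rightarrow> real) \<Rightarrow> 'a measure \<Rightarrow> real \<Rightarrow> 'a measure" where
  "reservoir_measure P X D lam \<mu> t = density \<mu> (\<lambda>x.
     \<integral>\<^sup>+y\<in>- D. ennreal (lam y)
       \<partial>distr (restrict_space (P x) {\<omega>\<in>space (P x). hit_time X (- D) \<omega> \<le> ennreal t}) borel
          (\<lambda>\<omega>. X (enn2real (hit_time X (- D) \<omega>)) \<omega>))"

definition gas_config ::
    "'a set \<Rightarrow> (real \<Rightarrow> 'v \<Rightarrow> 'a multiset) \<Rightarrow> (real \<Rightarrow> 'v \<Rightarrow> 'a multiset) \<Rightarrow> real \<Rightarrow> 'v \<Rightarrow> 'a multiset" where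
  "gas_config D \<xi> \<Theta> t \<omega> = {#x \<in># \<xi> t \<omega>. x \<in> D#} + \<Theta> t \<omega>"

text \<open>On the probability space \<^term>\<open>N\<close>, \<^term>\<open>\<xi>\<close> has the path law of the absorbed particle
  system started from \<^term>\<open>config k x\<close>, and \<^term>\<open>\<Theta> t\<close> is the independent Poisson input, so
  that \<^term>\<open>gas_config D \<xi> \<Theta>\<close> is the gas started from \<^term>\<open>config k x\<close>. Nothing is assumed
  about the joint law of \<^term>\<open>\<Theta>\<close> at different times.\<close>

definition boundary_driven_gas :: "('a::euclidean_space \<Rightarrow> 'w measure) \<Rightarrow> (real \<Rightarrow> 'w \<Rightarrow> 'a) \<Rightarrow>
    'a set \<Rightarrow> ('a \<Rightarrow> real) \<Rightarrow> 'a measure \<Rightarrow> nat \<Rightarrow> (nat \<Rightarrow> 'a) \<Rightarrow>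
    'v measure \<Rightarrow> (real \<Rightarrow> 'v \<Rightarrow> 'a multiset) \<Rightarrow> (real \<Rightarrow> 'v \<Rightarrow> 'a multiset) \<Rightarrow> bool" where
  "boundary_driven_gas P X D lam \<mu> k x N \<xi> \<Theta> \<longleftrightarrow>
     (let paths = PiM {0..} (\<lambda>_. config_space borel) in
      prob_space N \<and>
      (\<lambda>\<omega>. \<lambda>t\<in>{0..}. \<xi> t \<omega>) \<in> N \<rightarrow>\<^sub>M paths \<and>
      distr N paths (\<lambda>\<omega>. \<lambda>t\<in>{0..}. \<xi> t \<omega>) =
        distr (copies P k x) paths (\<lambda>\<omega>. \<lambda>t\<in>{0..}. particles X k t \<omega>) \<and>
      (\<forall>t\<ge>0.
         poisson_point_process N (domain_borel D) (reservoir_measure P X D lam \<mu> t) (\<Theta> t) \<and>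
         prob_space.indep_var N (config_space borel) (\<xi> t) (config_space (domain_borel D)) (\<Theta> t)))"

definition absorption_weight :: "('a::euclidean_space \<Rightarrow> 'w measure) \<Rightarrow> (real \<Rightarrow> 'w \<Rightarrow> 'a) \<Rightarrow>
    'a set \<Rightarrow> ('a \<Rightarrow> real) \<Rightarrow> real \<Rightarrow> nat \<Rightarrow> (nat \<Rightarrow> 'a) \<Rightarrow> real" where
  "absorption_weight P X D lam t k z =
     (\<integral>\<omega>. prod_mset (image_mset lam {#y \<in># particles X k t \<omega>. y \<in> - D#}) *
           (if npoints (- D) (particles X k t \<omega>) = k then 1 else 0) \<partial>copies P k z)"

end

theory Submission
  imports Defs
begin

text \<open>Two features of the definitions shape the proof. First, \<open>factorial_measure\<close>
  uses an enumeration picked by \<open>SOME\<close>, which gives no hold on measurability. Sums over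
  injections do not depend on the enumeration, and on boxes they become polynomials in point counts,
  whose measurability is built into \<open>config_space\<close>. Second, only transition
  probabilities, not path laws, are measurable in the starting point. The hitting time is therefore
  eliminated in favour of the position at the fixed time \<open>t\<close>: since \<open>D\<close> is
  open and paths are right continuous, a path is outside \<open>D\<close> at its hitting time, so
  absorption by time \<open>t\<close> means exactly that \<open>X t\<close> is outside
  \<open>D\<close>. Slots form arbitrary finite index sets because inductions over a configuration
  delete slots. Masses of factorial measures are unbounded over configurations, so mixtures are
  developed for kernels of merely finite mass, and finiteness of the expected measure is itself read
  off from the box formula with every side equal to \<open>D\<close>. Binomial coefficients appear
  only for symmetric integrands: a general one sees which slots the reservoir fills.\<close>

text \<open>A finite measure on \<open>D\<^sup>n\<close> is determined by its values on boxes. On a box, the factorial measure of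
  \<open>\<eta>\<^sub>t = \<xi>\<^sub>t|\<^sub>D + \<Theta>\<^sub>t\<close> is a sum over the set \<open>K \<subseteq> [n]\<close> of slots filled from \<open>\<Theta>\<^sub>t\<close>; by independence
  its expectation is the sum over \<open>K\<close> of a product of two expectations. The one for \<open>\<Theta>\<^sub>t\<close> is a product of
  intensities: cut the sides of the box into the atoms they generate, on which the counts are independent Poisson
  variables, and use that the falling factorial of order \<open>m\<close> of a Poisson variable of rate \<open>l\<close> has mean \<open>l\<^sup>m\<close>.
  The one for \<open>\<xi>\<^sub>t\<close> is a sum, over injections of slots into particles, of products of transition
  probabilities. Both parts are read off from this box formula. For the density in (b), the intensity
  of \<open>\<Theta>\<^sub>t\<close> at \<open>x\<close> is the mean of \<open>\<lambda>(X\<^sub>t) 1{X\<^sub>t \<notin> D}\<close> under the law started at \<open>x\<close>, because \<open>X\<close> is constant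
  after absorption.\<close>

section \<open>Sums over tuples of distinct points\<close>

definition injections :: "'i set \<Rightarrow> 'u set \<Rightarrow> ('i \<Rightarrow> 'u) set" where
  "injections I U = {i \<in> I \<rightarrow>\<^sub>E U. inj_on i I}"

text \<open>Points are reached through labels in \<open>U\<close>, so that coinciding points still
  count as distinct particles. The semiring is left open: measures need \<open>ennreal\<close>,
  integrals need \<open>real\<close>.\<close>

definition tuple_sum ::
    "'u set \<Rightarrow> ('u \<Rightarrow> 'a) \<Rightarrow> 'i set \<Rightarrow> ('i \<Rightarrow> 'a \<Rightarrow> 'b::comm_semiring_1) \<Rightarrow> 'b" where
  "tuple_sum U a I g = (\<Sum>i\<in>injections I U. \<Prod>j\<in>I. g j (a (i j)))"

text \<open>The integral of a product function against the factorial measure, with any finite index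
  set of slots in place of \<open>{1..n}\<close>.\<close>

definition factorial_sum :: "'a multiset \<Rightarrow> 'i set \<Rightarrow> ('i \<Rightarrow> 'a \<Rightarrow> 'b::comm_semiring_1) \<Rightarrow> 'b" where
  "factorial_sum \<eta> I g = tuple_sum {..<size \<eta>} ((!) (SOME xs. mset xs = \<eta>)) I g"

lemma finite_injections: "finite I \<Longrightarrow> finite U \<Longrightarrow> finite (injections I U)"
  unfolding injections_def by (rule finite_subset[of _ "I \<rightarrow>\<^sub>E U"]) (auto intro: finite_PiE)

lemma injections_empty_domain: "injections {} U = {\<lambda>_. undefined}"
  by (auto simp: injections_def)

lemma injections_empty_range: "I \<noteq> {} \<Longrightarrow> injections I {} = {}"
  by (auto simp: injections_def PiE_def)

text \<open>An injection takes the new value \<open>u\<close> at no slot or at a single slot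
  \<open>j\<close>; in the latter case the other slots form an injection into
  \<open>U\<close>.\<close>

lemma injections_insert:
  assumes "u \<notin> U"
  shows "injections I (insert u U) =
    injections I U \<union> (\<Union>j\<in>I. (\<lambda>i. i(j := u)) ` injections (I - {j}) U)"
proof (intro equalityI subsetI)
  fix i assume i: "i \<in> injections I (insert u U)"
  show "i \<in> injections I U \<union> (\<Union>j\<in>I. (\<lambda>i. i(j := u)) ` injections (I - {j}) U)"
  proof (cases "\<exists>j\<in>I. i j = u")
    case True
    then obtain j where j: "j \<in> I" "i j = u" by auto
    \<comment> \<open>Extensionality on \<open>I - {j}\<close> forces the value at the deleted slot
      to be \<open>undefined\<close>.\<close>
    have "i(j := undefined) \<in> injections (I - {j}) U"
      using i j unfolding injections_def
      by (auto simp: PiE_iff extensional_def inj_on_def)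
    moreover have "i = (i(j := undefined))(j := u)" using j by auto
    ultimately show ?thesis using j by blast
  next
    case False
    then show ?thesis using i unfolding injections_def by (auto simp: PiE_iff)
  qed
next
  fix i assume "i \<in> injections I U \<union> (\<Union>j\<in>I. (\<lambda>i. i(j := u)) ` injections (I - {j}) U)"
  then consider "i \<in> injections I U"
    | j k where "j \<in> I" "k \<in> injections (I - {j}) U" "i = k(j := u)" by blast
  then show "i \<in> injections I (insert u U)"
  proof cases
    case 2
    have "k l \<in> U" if "l \<in> I" "l \<noteq> j" for l
      using 2 that by (auto simp: injections_def PiE_iff)
    then show ?thesis
      using 2 assms unfolding injections_def inj_on_def
      by (auto simp: PiE_iff extensional_def)
  qed (auto simp: injections_def PiE_iff)
qed

lemma tuple_sum_insert:
  assumes "finite I" "finite U" "u \<notin> U"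
  shows "tuple_sum (insert u U) a I g =
    tuple_sum U a I g + (\<Sum>j\<in>I. g j (a u) * tuple_sum U a (I - {j}) g)"
proof -
  let ?E = "\<lambda>j. (\<lambda>i. i(j := u)) ` injections (I - {j}) U"
  have fin: "finite (?E j)" if "j \<in> I" for j
    using assms by (intro finite_imageI finite_injections) auto
  have disj: "injections I U \<inter> (\<Union>j\<in>I. ?E j) = {}"
    using assms unfolding injections_def by (auto simp: PiE_iff)
  \<comment> \<open>The slot that takes the value \<open>u\<close> is determined by the injection:
    at \<open>j'\<close> the function \<open>i\<close> still has a value in \<open>U\<close>, which
    excludes \<open>u\<close>.\<close>
  have disj2: "?E j \<inter> ?E j' = {}" if "j \<in> I" "j' \<in> I" "j \<noteq> j'" for j j'
  proof -
    have False if i: "i \<in> injections (I - {j}) U" "k \<in> injections (I - {j'}) U"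
        and e: "i(j := u) = k(j' := u)" for i k
    proof -
      have "i j' = (k(j' := u)) j'" using e \<open>j \<noteq> j'\<close> by (metis fun_upd_other)
      then have "i j' = u" by simp
      moreover have "i j' \<in> U" using i that \<open>j \<noteq> j'\<close> \<open>j' \<in> I\<close> by (auto simp: injections_def PiE_iff)
      ultimately show False using assms by simp
    qed
    then show ?thesis by blast
  qed
  \<comment> \<open>The update at \<open>j\<close> loses nothing, since both functions are
    \<open>undefined\<close> there.\<close>
  have inj: "inj_on (\<lambda>i. i(j := u)) (injections (I - {j}) U)" for j
  proof (rule inj_onI)
    fix i k assume ik: "i \<in> injections (I - {j}) U" "k \<in> injections (I - {j}) U"
      and e: "i(j := u) = k(j := u)"
    have "i j = k j" using ik by (auto simp: injections_def PiE_iff extensional_def)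
    then show "i = k" using e by (metis fun_upd_triv fun_upd_upd)
  qed
  have "(\<Sum>i\<in>?E j. \<Prod>l\<in>I. g l (a (i l))) = g j (a u) * tuple_sum U a (I - {j}) g"
    if j: "j \<in> I" for j
  proof -
    have "(\<Sum>i\<in>?E j. \<Prod>l\<in>I. g l (a (i l))) =
        (\<Sum>i\<in>injections (I - {j}) U. \<Prod>l\<in>I. g l (a ((i(j := u)) l)))"
      by (subst sum.reindex[OF inj]) (rule sum.cong, auto)
    also have "\<dots> = (\<Sum>i\<in>injections (I - {j}) U. g j (a u) * (\<Prod>l\<in>I - {j}. g l (a (i l))))"
      by (intro sum.cong refl) (simp add: prod.remove[OF assms(1) j])
    finally show ?thesis by (simp add: tuple_sum_def sum_distrib_left)
  qed
  moreover have "(\<Sum>i\<in>(\<Union>j\<in>I. ?E j). \<Prod>l\<in>I. g l (a (i l))) =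
      (\<Sum>j\<in>I. \<Sum>i\<in>?E j. \<Prod>l\<in>I. g l (a (i l)))"
    by (rule sum.UNION_disjoint) (use assms fin disj2 in auto)
  ultimately show ?thesis
    unfolding tuple_sum_def injections_insert[OF assms(3)]
    by (subst sum.union_disjoint) (use assms fin disj in \<open>auto simp: finite_injections tuple_sum_def\<close>)
qed

text \<open>Composition with the relabelling is a bijection of injections; this makes the choice of
  enumeration harmless.\<close>

lemma tuple_sum_bij_points:
  assumes "bij_betw h U V" "\<And>u. u \<in> U \<Longrightarrow> a u = b (h u)"
  shows "tuple_sum U a I g = tuple_sum V b I g"
  unfolding tuple_sum_def
proof (rule sum.reindex_bij_witness
    [where j = "\<lambda>i. \<lambda>j\<in>I. h (i j)" and i = "\<lambda>i. \<lambda>j\<in>I. the_inv_into U h (i j)"])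
  have inj: "inj_on h U" and im: "h ` U = V" using assms(1) by (auto simp: bij_betw_def)
  fix i assume i: "i \<in> injections I U"
  then have U: "i j \<in> U" if "j \<in> I" for j using that by (auto simp: injections_def PiE_iff)
  show "(\<lambda>j\<in>I. the_inv_into U h ((\<lambda>j\<in>I. h (i j)) j)) = i"
  proof
    fix j show "(\<lambda>j\<in>I. the_inv_into U h ((\<lambda>j\<in>I. h (i j)) j)) j = i j"
      using i U[of j] the_inv_into_f_f[OF inj, of "i j"]
      by (auto simp: injections_def PiE_iff extensional_def)
  qed
  have "inj_on (h \<circ> i) I"
    using i inj by (intro comp_inj_on) (auto simp: injections_def PiE_iff intro: inj_on_subset)
  then have "inj_on (\<lambda>j\<in>I. h (i j)) I" by (auto simp: inj_on_def)
  then show "(\<lambda>j\<in>I. h (i j)) \<in> injections I V"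
    using U im unfolding injections_def by auto
  show "(\<Prod>j\<in>I. g j (b ((\<lambda>j\<in>I. h (i j)) j))) = (\<Prod>j\<in>I. g j (a (i j)))"
    using assms(2) U by (intro prod.cong) auto
next
  have inj: "inj_on h U" and im: "h ` U = V" using assms(1) by (auto simp: bij_betw_def)
  fix i assume i: "i \<in> injections I V"
  then have V: "i j \<in> V" if "j \<in> I" for j using that by (auto simp: injections_def PiE_iff)
  show "(\<lambda>j\<in>I. h ((\<lambda>j\<in>I. the_inv_into U h (i j)) j)) = i"
  proof
    fix j show "(\<lambda>j\<in>I. h ((\<lambda>j\<in>I. the_inv_into U h (i j)) j)) j = i j"
      using i V[of j] im f_the_inv_into_f[OF inj, of "i j"]
      by (auto simp: injections_def PiE_iff extensional_def)
  qed
  have "inj_on (the_inv_into U h) V" using assms(1) bij_betw_the_inv_into bij_betw_def by blast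
  then have "inj_on (the_inv_into U h \<circ> i) I"
    using i by (intro comp_inj_on) (auto simp: injections_def PiE_iff intro: inj_on_subset)
  then have "inj_on (\<lambda>j\<in>I. the_inv_into U h (i j)) I" by (auto simp: inj_on_def)
  moreover have "the_inv_into U h (i j) \<in> U" if "j \<in> I" for j
    using V[OF that] im the_inv_into_into[OF inj, of "i j" U] by auto
  ultimately show "(\<lambda>j\<in>I. the_inv_into U h (i j)) \<in> injections I U"
    unfolding injections_def by auto
qed

text \<open>Used to pass between a set of slots such as \<open>{1..n} - K\<close> and an initial
  segment \<open>{1..n - card K}\<close>.\<close>

lemma tuple_sum_bij_indices:
  assumes "bij_betw h I' I"
  shows "tuple_sum U a I g = tuple_sum U a I' (\<lambda>j. g (h j))"
  unfolding tuple_sum_def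
proof (rule sum.reindex_bij_witness
    [where j = "\<lambda>i. \<lambda>j\<in>I'. i (h j)" and i = "\<lambda>i. \<lambda>j\<in>I. i (the_inv_into I' h j)"])
  have inj: "inj_on h I'" and im: "h ` I' = I" using assms by (auto simp: bij_betw_def)
  have hI: "h j \<in> I" if "j \<in> I'" for j using im that by auto
  have inv: "the_inv_into I' h j \<in> I'" "h (the_inv_into I' h j) = j" if "j \<in> I" for j
    using that inj im by (auto intro: the_inv_into_into f_the_inv_into_f)
  {
    fix i assume i: "i \<in> injections I U"
    show "(\<lambda>j\<in>I. (\<lambda>j\<in>I'. i (h j)) (the_inv_into I' h j)) = i"
      using i inv by (auto simp: injections_def PiE_iff extensional_def fun_eq_iff)
    show "(\<lambda>j\<in>I'. i (h j)) \<in> injections I' U"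
      using i hI inj unfolding injections_def inj_on_def by (auto simp: PiE_iff)
    show "(\<Prod>j\<in>I'. g (h j) (a ((\<lambda>j\<in>I'. i (h j)) j))) = (\<Prod>j\<in>I. g j (a (i j)))"
      by (subst prod.reindex_bij_betw[OF assms, symmetric]) (rule prod.cong, auto)
  }
  fix i assume i: "i \<in> injections I' U"
  show "(\<lambda>j\<in>I'. (\<lambda>j\<in>I. i (the_inv_into I' h j)) (h j)) = i"
    using i hI inj by (auto simp: injections_def PiE_iff extensional_def fun_eq_iff the_inv_into_f_f)
  have "inj_on (the_inv_into I' h) I" using assms bij_betw_the_inv_into bij_betw_def by blast
  then show "(\<lambda>j\<in>I. i (the_inv_into I' h j)) \<in> injections I U"
    using i inv unfolding injections_def inj_on_def by (auto simp: PiE_iff)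
qed

section \<open>Independence of the enumeration of a configuration\<close>

lemma mset_some_list: "mset (SOME xs. mset xs = \<eta>) = \<eta>"
  by (rule someI_ex) (rule ex_mset)

text \<open>Two lists with the same multiset differ by a permutation of positions; composed with a
  distinct enumeration of \<open>U\<close>, it gives \<open>h\<close>.\<close>

lemma image_mset_eq_bij:
  assumes "finite U" "mset xs = image_mset a (mset_set U)"
  obtains h where "bij_betw h {..<length xs} U" "\<And>i. i < length xs \<Longrightarrow> xs ! i = a (h i)"
proof -
  obtain us where us: "set us = U" "distinct us"
    using finite_distinct_list[OF assms(1)] by auto
  then have "mset us = mset_set U" using mset_set_set by metis
  then have "mset xs = mset (map a us)" using assms by simp
  then obtain p where p: "p permutes {..<length (map a us)}" "permute_list p (map a us) = xs"
    by (metis mset_eq_permutation)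
  have len: "length xs = length us" using p(2) by auto
  have "bij_betw ((!) us \<circ> p) {..<length us} U"
    using p us by (intro bij_betw_trans[OF permutes_imp_bij bij_betw_nth]) auto
  moreover have "xs ! i = a (((!) us \<circ> p) i)" if "i < length xs" for i
    using p len that permutes_in_image[OF p(1), of i] by (auto simp: permute_list_nth)
  ultimately show thesis using that[of "(!) us \<circ> p"] len by auto
qed

text \<open>Any finite labelling of the points computes the factorial sum, so later arguments can
  choose a convenient one instead of the \<open>SOME\<close> list.\<close>

lemma factorial_sum_image_mset:
  assumes "finite U"
  shows "factorial_sum (image_mset a (mset_set U)) I g = tuple_sum U a I g"
proof -
  let ?\<eta> = "image_mset a (mset_set U)" and ?xs = "SOME xs. mset xs = image_mset a (mset_set U)"
  have m: "mset ?xs = ?\<eta>" by (rule mset_some_list)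
  obtain h where h: "bij_betw h {..<length ?xs} U" "\<And>i. i < length ?xs \<Longrightarrow> ?xs ! i = a (h i)"
    using image_mset_eq_bij[OF assms m] by blast
  have "length ?xs = size ?\<eta>" using m by (metis size_mset)
  then show ?thesis
    unfolding factorial_sum_def using h
    by (intro tuple_sum_bij_points[where h = h]) auto
qed

lemma factorial_sum_config: "factorial_sum (config k a) I g = tuple_sum {1..k} a I g"
  unfolding config_def by (rule factorial_sum_image_mset) simp

lemma factorial_sum_bij_indices:
  "bij_betw h I' I \<Longrightarrow> factorial_sum \<eta> I g = factorial_sum \<eta> I' (\<lambda>j. g (h j))"
  unfolding factorial_sum_def by (rule tuple_sum_bij_indices)

lemma factorial_sum_cong:
  assumes "\<And>j a. j \<in> I \<Longrightarrow> a \<in># \<eta> \<Longrightarrow> g j a = g' j a"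
  shows "factorial_sum \<eta> I g = factorial_sum \<eta> I g'"
  unfolding factorial_sum_def tuple_sum_def
proof (intro sum.cong prod.cong refl)
  let ?xs = "SOME xs. mset xs = \<eta>"
  fix i j assume "i \<in> injections I {..<size \<eta>}" "j \<in> I"
  moreover have m: "mset ?xs = \<eta>" by (rule mset_some_list)
  moreover have "size \<eta> = length ?xs" using m by (metis size_mset)
  ultimately have "?xs ! i j \<in># \<eta>"
    by (metis (no_types, lifting) PiE_mem injections_def lessThan_iff mem_Collect_eq nth_mem_mset)
  then show "g j (?xs ! i j) = g' j (?xs ! i j)" using assms \<open>j \<in> I\<close> by simp
qed

lemma factorial_sum_empty: "finite I \<Longrightarrow> factorial_sum {#} I g = (if I = {} then 1 else 0)"
  by (simp add: factorial_sum_def tuple_sum_def injections_empty_domain injections_empty_range)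

lemma factorial_sum_no_index [simp]: "factorial_sum \<eta> {} g = 1"
  by (simp add: factorial_sum_def tuple_sum_def injections_empty_domain)

text \<open>The added point occupies no slot or exactly one. This recursion drives the inductions
  over configurations.\<close>

lemma factorial_sum_add_mset:
  assumes "finite I"
  shows "factorial_sum (add_mset a \<eta>) I g =
    factorial_sum \<eta> I g + (\<Sum>j\<in>I. g j a * factorial_sum \<eta> (I - {j}) g)"
proof -
  obtain xs where xs: "mset xs = \<eta>" using ex_mset by blast
  \<comment> \<open>One labelling for both configurations: the position \<open>length xs\<close>,
    just past the end of the list, is reserved for the added point.\<close>
  let ?b = "\<lambda>i. if i = length xs then a else xs ! i"
  have map: "map ?b [0..<length xs] = xs" by (rule nth_equalityI) auto
  have eta: "\<eta> = image_mset ?b (mset_set {..<length xs})"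
    using xs map by (metis atLeast_upt mset_map mset_set_upto_eq_mset_upto)
  then have "add_mset a \<eta> = image_mset ?b (mset_set (insert (length xs) {..<length xs}))"
    by simp
  then show ?thesis
    using assms by (simp only: eta factorial_sum_image_mset finite_insert finite_lessThan)
      (simp add: tuple_sum_insert factorial_sum_image_mset[OF finite_lessThan] eta)
qed

text \<open>The set \<open>K\<close> collects the slots of a tuple filled from the second configuration.\<close>

lemma factorial_sum_plus:
  assumes "finite I"
  shows "factorial_sum (\<eta> + \<zeta>) I g =
    (\<Sum>K\<in>Pow I. factorial_sum \<zeta> K g * factorial_sum \<eta> (I - K) g)"
  using assms
proof (induction \<zeta> arbitrary: I)
  case empty
  \<comment> \<open>An empty configuration can fill no slot, so only \<open>K = {}\<close>
    survives.\<close>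
  have "(\<Sum>K\<in>Pow I. factorial_sum {#} K g * factorial_sum \<eta> (I - K) g) =
      (\<Sum>K\<in>{{}}. factorial_sum {#} K g * factorial_sum \<eta> (I - K) g)"
  proof (rule sum.mono_neutral_right)
    show "\<forall>K\<in>Pow I - {{}}. factorial_sum {#} K g * factorial_sum \<eta> (I - K) g = 0"
      using empty by (auto simp: factorial_sum_empty[OF finite_subset] split: if_splits)
  qed (use empty in auto)
  then show ?case by simp
next
  case (add a \<zeta>)
  let ?G = "\<lambda>K. factorial_sum \<eta> (I - K) g"
  have fin: "finite K" if "K \<in> Pow I" for K using that add.prems finite_subset by auto
  have "factorial_sum (\<eta> + add_mset a \<zeta>) I g =
      (\<Sum>K\<in>Pow I. factorial_sum \<zeta> K g * ?G K) +
      (\<Sum>j\<in>I. \<Sum>K\<in>Pow (I - {j}). g j a * factorial_sum \<zeta> K g * factorial_sum \<eta> (I - {j} - K) g)"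
    using add by (simp add: factorial_sum_add_mset sum_distrib_left mult.assoc)
  also have "(\<Sum>j\<in>I. \<Sum>K\<in>Pow (I - {j}). g j a * factorial_sum \<zeta> K g * factorial_sum \<eta> (I - {j} - K) g) =
      (\<Sum>K\<in>Pow I. \<Sum>j\<in>K. g j a * factorial_sum \<zeta> (K - {j}) g * ?G K)"
  proof -
    let ?f = "\<lambda>j K. g j a * factorial_sum \<zeta> K g * factorial_sum \<eta> (I - {j} - K) g"
    let ?h = "\<lambda>K j. g j a * factorial_sum \<zeta> (K - {j}) g * ?G K"
    have "(\<Sum>j\<in>I. \<Sum>K\<in>Pow (I - {j}). ?f j K) = (\<Sum>(j, K)\<in>(SIGMA j:I. Pow (I - {j})). ?f j K)"
      using add.prems by (intro sum.Sigma) auto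
    \<comment> \<open>A slot \<open>j\<close> together with a set \<open>K\<close> avoiding it is
      the same as the set \<open>insert j K\<close> with \<open>j\<close> marked.\<close>
    also have "\<dots> = (\<Sum>(K, j)\<in>(SIGMA K:Pow I. K). ?h K j)"
    proof (rule sum.reindex_bij_witness
        [where i = "\<lambda>(K, j). (j, K - {j})" and j = "\<lambda>(j, K). (insert j K, j)"], goal_cases)
      case (5 p)
      then obtain j K where p: "p = (j, K)" "j \<in> I" "K \<subseteq> I - {j}" by auto
      then have "insert j K - {j} = K" "I - insert j K = I - {j} - K" by auto
      then show ?case by (simp add: p(1))
    qed auto
    also have "\<dots> = (\<Sum>K\<in>Pow I. \<Sum>j\<in>K. ?h K j)"
      using add.prems fin by (intro sum.Sigma[symmetric]) auto
    finally show ?thesis .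
  qed
  also have "(\<Sum>K\<in>Pow I. factorial_sum \<zeta> K g * ?G K) + \<dots> =
      (\<Sum>K\<in>Pow I. factorial_sum (add_mset a \<zeta>) K g * ?G K)"
    unfolding sum.distrib[symmetric]
    by (intro sum.cong refl)
      (simp add: factorial_sum_add_mset fin distrib_right sum_distrib_right)
  finally show ?case .
qed

text \<open>Every tuple that uses a point outside \<open>D\<close> has a zero factor. For boxes
  inside \<open>D\<close> this replaces the restricted particle configuration by the full one, whose
  law is known.\<close>

lemma factorial_sum_filter:
  assumes "finite I" "\<And>j a. j \<in> I \<Longrightarrow> a \<notin> D \<Longrightarrow> g j a = 0"
  shows "factorial_sum {#a \<in># \<eta>. a \<in> D#} I g = factorial_sum \<eta> I g"
  using assms
proof (induction \<eta> arbitrary: I)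
  case (add a \<eta>)
  have IH: "factorial_sum {#a \<in># \<eta>. a \<in> D#} I g = factorial_sum \<eta> I g"
    "\<And>j. factorial_sum {#a \<in># \<eta>. a \<in> D#} (I - {j}) g = factorial_sum \<eta> (I - {j}) g"
    using add.prems by (auto intro!: add.IH)
  show ?case
    using add.prems by (cases "a \<in> D") (simp_all add: factorial_sum_add_mset IH)
qed simp

text \<open>Multilinear expansion: \<open>r\<close> picks one summand for each slot.\<close>

lemma factorial_sum_sum:
  assumes "finite I" "\<And>j. j \<in> I \<Longrightarrow> finite (A j)"
  shows "factorial_sum \<eta> I (\<lambda>j a. \<Sum>\<alpha>\<in>A j. h \<alpha> a) =
    (\<Sum>r\<in>PiE I A. factorial_sum \<eta> I (\<lambda>j. h (r j)))"
  unfolding factorial_sum_def tuple_sum_def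
  by (simp add: prod_sum_PiE assms sum.swap[of _ "PiE I A"])

text \<open>Pascal's rule for falling factorials, the numerical form of
  \<open>factorial_sum_add_mset\<close>. At \<open>m = 0\<close> the truncated \<open>m - 1\<close>
  is harmless because of the factor \<open>m\<close>.\<close>

lemma falling_factorial_Suc:
  "(Suc n choose m) * fact m = (n choose m) * fact m + m * ((n choose (m - 1)) * fact (m - 1))"
  by (cases m) (auto simp: algebra_simps)

lemma npoints_add_mset: "npoints B (add_mset a \<eta>) = (if a \<in> B then Suc (npoints B \<eta>) else npoints B \<eta>)"
  by (simp add: npoints_def)

lemma npoints_empty [simp]: "npoints B {#} = 0"
  by (simp add: npoints_def)

text \<open>The factors \<open>(n choose m) * fact m\<close> are falling factorials.\<close>

lemma factorial_sum_disjoint: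
  fixes C :: "'k \<Rightarrow> 'a set"
  assumes "finite I" "finite A" "r ` I \<subseteq> A" "disjoint_family_on C A"
  shows "factorial_sum \<eta> I (\<lambda>j. indicator (C (r j)) :: 'a \<Rightarrow> 'b::comm_semiring_1) =
    (\<Prod>\<alpha>\<in>A. of_nat ((npoints (C \<alpha>) \<eta> choose card {j\<in>I. r j = \<alpha>}) * fact (card {j\<in>I. r j = \<alpha>})))"
  using assms(1,3)
proof (induction \<eta> arbitrary: I)
  case empty
  show ?case
  proof (cases "I = {}")
    case False
    then obtain j where j: "j \<in> I" by auto
    \<comment> \<open>The cell assigned to an existing slot is asked for at least one point, but
      there is none: a falling factorial of \<open>0\<close> of positive order is
      \<open>0\<close>.\<close>
    then have "card {i\<in>I. r i = r j} \<noteq> 0" using empty by auto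
    then have "(0 choose card {i\<in>I. r i = r j}) = 0" by (simp add: binomial_eq_0)
    moreover have "r j \<in> A" using j empty by auto
    ultimately have "\<exists>\<alpha>\<in>A. of_nat ((npoints (C \<alpha>) {#} choose card {j\<in>I. r j = \<alpha>}) * fact (card {j\<in>I. r j = \<alpha>})) = (0::'b)"
      by (intro bexI[of _ "r j"]) (simp_all only: npoints_empty mult_zero_left of_nat_0)
    then show ?thesis
      using False empty assms(2) by (simp add: factorial_sum_empty prod_zero del: of_nat_mult)
  qed simp
next
  case (add a \<eta>)
  let ?m = "\<lambda>I \<alpha>. card {j\<in>I. r j = \<alpha>}"
  let ?p = "\<lambda>n m. of_nat ((n choose m) * fact m) :: 'b"
  let ?I = "\<lambda>j. (indicator (C (r j)) :: 'a \<Rightarrow> 'b)"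
  have IH: "factorial_sum \<eta> I ?I = (\<Prod>\<alpha>\<in>A. ?p (npoints (C \<alpha>) \<eta>) (?m I \<alpha>))"
    "\<And>j. factorial_sum \<eta> (I - {j}) ?I = (\<Prod>\<alpha>\<in>A. ?p (npoints (C \<alpha>) \<eta>) (?m (I - {j}) \<alpha>))"
    by (rule add.IH; use add.prems in auto)+
  show ?case
  proof (cases "\<exists>\<beta>\<in>A. a \<in> C \<beta>")
    case False
    then have "(\<Sum>j\<in>I. ?I j a * factorial_sum \<eta> (I - {j}) ?I) = 0"
      using add.prems by (intro sum.neutral) auto
    then show ?thesis
      using add.prems False by (simp add: factorial_sum_add_mset IH npoints_add_mset cong: prod.cong)
  next
    case True
    then obtain \<beta> where \<beta>: "\<beta> \<in> A" "a \<in> C \<beta>" by auto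
    have only: "a \<in> C \<alpha> \<longleftrightarrow> \<alpha> = \<beta>" if "\<alpha> \<in> A" for \<alpha>
      using \<beta> that assms(4) unfolding disjoint_family_on_def by blast
    let ?R = "\<Prod>\<alpha>\<in>A - {\<beta>}. ?p (npoints (C \<alpha>) \<eta>) (?m I \<alpha>)"
    let ?n = "npoints (C \<beta>) \<eta>"
    \<comment> \<open>Deleting a slot assigned to the cell \<open>C \<beta>\<close> lowers only the
      multiplicity of \<open>\<beta>\<close>, so all such slots give the same contribution.\<close>
    have slot: "factorial_sum \<eta> (I - {j}) ?I = ?p ?n (?m I \<beta> - 1) * ?R"
      if "j \<in> {j\<in>I. r j = \<beta>}" for j
    proof -
      have "{i \<in> I - {j}. r i = \<beta>} = {i\<in>I. r i = \<beta>} - {j}" by auto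
      then have "?m (I - {j}) \<beta> = ?m I \<beta> - 1" using that add.prems by simp
      moreover have "{i \<in> I - {j}. r i = \<alpha>} = {i\<in>I. r i = \<alpha>}" if "\<alpha> \<noteq> \<beta>" for \<alpha>
        using that \<open>j \<in> _\<close> by auto
      ultimately show ?thesis
        unfolding IH by (simp add: prod.remove[OF assms(2) \<beta>(1)])
    qed
    \<comment> \<open>By disjointness \<open>a\<close> lies in no cell but \<open>C \<beta>\<close>,
      so it can fill only slots assigned to \<open>\<beta>\<close>.\<close>
    have "(\<Sum>j\<in>I. ?I j a * factorial_sum \<eta> (I - {j}) ?I) =
        (\<Sum>j\<in>{j\<in>I. r j = \<beta>}. ?I j a * factorial_sum \<eta> (I - {j}) ?I)"
      using add.prems only by (intro sum.mono_neutral_right) (auto simp: indicator_def)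
    also have "\<dots> = (\<Sum>j\<in>{j\<in>I. r j = \<beta>}. ?p ?n (?m I \<beta> - 1) * ?R)"
      using \<beta> by (intro sum.cong refl) (use slot in auto)
    also have "\<dots> = of_nat (?m I \<beta>) * ?p ?n (?m I \<beta> - 1) * ?R"
      by (simp add: mult.assoc)
    finally have "factorial_sum (add_mset a \<eta>) I ?I =
        (?p ?n (?m I \<beta>) + of_nat (?m I \<beta>) * ?p ?n (?m I \<beta> - 1)) * ?R"
      using add.prems
      by (simp add: factorial_sum_add_mset IH(1) prod.remove[OF assms(2) \<beta>(1)] distrib_right)
    also have "?p ?n (?m I \<beta>) + of_nat (?m I \<beta>) * ?p ?n (?m I \<beta> - 1) = ?p (Suc ?n) (?m I \<beta>)"
      unfolding falling_factorial_Suc by simp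
    also have "?R = (\<Prod>\<alpha>\<in>A - {\<beta>}. ?p (npoints (C \<alpha>) (add_mset a \<eta>)) (?m I \<alpha>))"
      by (intro prod.cong refl) (auto simp: npoints_add_mset only)
    finally show ?thesis
      using \<beta> by (simp add: prod.remove[OF assms(2) \<beta>(1)] npoints_add_mset)
  qed
qed

text \<open>A cell of the partition of \<open>\<Omega>\<close> generated by the sets
  \<open>B j\<close>; \<open>\<alpha>\<close> records which of them contain the point. Sides of a
  box may overlap, cells never do.\<close>

definition atom :: "'a set \<Rightarrow> 'i set \<Rightarrow> ('i \<Rightarrow> 'a set) \<Rightarrow> 'i set \<Rightarrow> 'a set" where
  "atom \<Omega> I B \<alpha> = {x\<in>\<Omega>. \<forall>j\<in>I. x \<in> B j \<longleftrightarrow> j \<in> \<alpha>}"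

lemma disjoint_family_atom: "disjoint_family_on (atom \<Omega> I B) (Pow I)"
  unfolding disjoint_family_on_def atom_def by blast

text \<open>The point \<open>x\<close> lies in the cell of \<open>{i\<in>I. x \<in> B i}\<close> and
  in no other, and this index contains \<open>j\<close> exactly when \<open>x\<close> is in
  \<open>B j\<close>.\<close>

lemma indicator_eq_sum_atoms:
  assumes "finite I" "j \<in> I" "x \<in> \<Omega>"
  shows "(indicator (B j) x :: 'b::comm_semiring_1) = (\<Sum>\<alpha>\<in>{\<alpha>\<in>Pow I. j \<in> \<alpha>}. indicator (atom \<Omega> I B \<alpha>) x)"
proof -
  have mem: "x \<in> atom \<Omega> I B \<alpha> \<longleftrightarrow> \<alpha> = {i\<in>I. x \<in> B i}" if "\<alpha> \<in> Pow I" for \<alpha>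
    using that assms(3) unfolding atom_def by auto
  have "(\<Sum>\<alpha>\<in>{\<alpha>\<in>Pow I. j \<in> \<alpha>}. indicator (atom \<Omega> I B \<alpha>) x) =
      (\<Sum>\<alpha>\<in>{\<alpha>\<in>Pow I. j \<in> \<alpha>}. if \<alpha> = {i\<in>I. x \<in> B i} then 1 else 0 :: 'b)"
    by (intro sum.cong refl) (use mem in \<open>auto simp: indicator_def\<close>)
  also have "\<dots> = (if {i\<in>I. x \<in> B i} \<in> {\<alpha>\<in>Pow I. j \<in> \<alpha>} then 1 else 0)"
    using assms by (subst sum.delta) auto
  finally show ?thesis using assms(2) by (auto simp: indicator_def)
qed

text \<open>With \<open>r\<close> assigning a cell to every slot, the factorial sum is a polynomial
  in counts of disjoint sets. This gives its measurability and, through independence of these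
  counts, its Poisson mean.\<close>

lemma factorial_sum_indicator:
  assumes "finite I" "set_mset \<eta> \<subseteq> \<Omega>"
  shows "factorial_sum \<eta> I (\<lambda>j. indicator (B j) :: 'a \<Rightarrow> 'b::comm_semiring_1) =
    (\<Sum>r\<in>(\<Pi>\<^sub>E j\<in>I. {\<alpha>\<in>Pow I. j \<in> \<alpha>}). \<Prod>\<alpha>\<in>Pow I.
      of_nat ((npoints (atom \<Omega> I B \<alpha>) \<eta> choose card {j\<in>I. r j = \<alpha>}) * fact (card {j\<in>I. r j = \<alpha>})))"
proof -
  have "factorial_sum \<eta> I (\<lambda>j. indicator (B j) :: 'a \<Rightarrow> 'b) =
      factorial_sum \<eta> I (\<lambda>j a. \<Sum>\<alpha>\<in>{\<alpha>\<in>Pow I. j \<in> \<alpha>}. indicator (atom \<Omega> I B \<alpha>) a)"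
    using assms by (intro factorial_sum_cong indicator_eq_sum_atoms) auto
  also have "\<dots> = (\<Sum>r\<in>(\<Pi>\<^sub>E j\<in>I. {\<alpha>\<in>Pow I. j \<in> \<alpha>}).
      factorial_sum \<eta> I (\<lambda>j. indicator (atom \<Omega> I B (r j))))"
    using assms by (intro factorial_sum_sum) auto
  also have "\<dots> = (\<Sum>r\<in>(\<Pi>\<^sub>E j\<in>I. {\<alpha>\<in>Pow I. j \<in> \<alpha>}). \<Prod>\<alpha>\<in>Pow I.
      of_nat ((npoints (atom \<Omega> I B \<alpha>) \<eta> choose card {j\<in>I. r j = \<alpha>}) * fact (card {j\<in>I. r j = \<alpha>})))"
    using assms by (intro sum.cong refl factorial_sum_disjoint disjoint_family_atom)
      (auto simp: PiE_iff)
  finally show ?thesis .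
qed

section \<open>Subsets of slots, permutations and binomial coefficients\<close>

lemma bij_betw_sorted_list_of_set:
  assumes "finite K"
  shows "bij_betw (\<lambda>j. sorted_list_of_set K ! (j - 1)) {1..card K} K"
proof -
  \<comment> \<open>Slots are numbered from \<open>1\<close>, list positions from
    \<open>0\<close>.\<close>
  have "bij_betw (\<lambda>j. j - 1) {1..card K} {..<card K}"
    by (rule bij_betw_byWitness[where f' = Suc]) auto
  moreover have "bij_betw ((!) (sorted_list_of_set K)) {..<card K} K"
    using assms by (intro bij_betw_nth) auto
  ultimately show ?thesis by (rule bij_betw_trans[unfolded comp_def])
qed

text \<open>Brings an arbitrary set of reservoir slots to the first \<open>card K\<close> places,
  the shape that \<open>join_measure\<close> expects.\<close>

lemma ex_permutation_onto_subset:
  assumes "K \<subseteq> {1..n}"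
  obtains \<pi> where "\<pi> permutes {1..n}" "bij_betw \<pi> {1..card K} K"
    "bij_betw \<pi> {card K + 1..n} ({1..n} - K)"
proof -
  have fin: "finite K" using assms finite_subset by auto
  have le: "card K \<le> n" using card_mono[OF _ assms] by simp
  have "card {card K + 1..n} = card ({1..n} - K)"
    using assms fin by (simp add: card_Diff_subset)
  then obtain h where h: "bij_betw h {card K + 1..n} ({1..n} - K)"
    using finite_same_card_bij by (metis finite_Diff finite_atLeastAtMost)
  obtain g where g: "bij_betw g {1..card K} K"
    using bij_betw_sorted_list_of_set[OF fin] by blast
  let ?\<pi> = "\<lambda>i. if i \<in> {1..card K} then g i else if i \<in> {card K + 1..n} then h i else i"
  have 1: "bij_betw ?\<pi> {1..card K} K"
    using g by (rule bij_betw_cong[THEN iffD1, rotated]) simp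
  have 2: "bij_betw ?\<pi> {card K + 1..n} ({1..n} - K)"
    using h by (rule bij_betw_cong[THEN iffD1, rotated]) simp
  have "bij_betw ?\<pi> ({1..card K} \<union> {card K + 1..n}) (K \<union> ({1..n} - K))"
    using 1 2 by (rule bij_betw_combine) auto
  moreover have "{1..card K} \<union> {card K + 1..n} = {1..n}" "K \<union> ({1..n} - K) = {1..n}"
    using le assms by auto
  ultimately have "?\<pi> permutes {1..n}"
    using le by (intro bij_imp_permutes) auto
  then show thesis using 1 2 that by blast
qed

lemma prod_if_split:
  assumes "finite A" "K \<subseteq> A"
  shows "(\<Prod>j\<in>A. if j \<in> K then f j else g j) = (\<Prod>j\<in>K. f j) * (\<Prod>j\<in>A - K. g j)"
  using assms by (simp add: prod.If_cases Int_absorb1 Diff_eq)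

text \<open>The source of the binomial coefficients in (a): subsets are grouped by
  cardinality.\<close>

lemma sum_Pow_card:
  fixes h :: "nat \<Rightarrow> real"
  assumes "finite A"
  shows "(\<Sum>K\<in>Pow A. h (card K)) = (\<Sum>k=0..card A. real (card A choose k) * h k)"
proof -
  have "(\<Sum>k=0..card A. real (card A choose k) * h k) = (\<Sum>k=0..card A. \<Sum>K\<in>{K\<in>Pow A. card K = k}. h (card K))"
    by (intro sum.cong refl) (simp add: n_subsets[OF assms])
  also have "\<dots> = (\<Sum>K\<in>Pow A. h (card K))"
    using assms by (intro sum.group) (auto intro: card_mono)
  finally show ?thesis ..
qed

section \<open>Mixtures of finite kernels\<close>

text \<open>Mass is required to be finite at each \<open>\<omega>\<close> only: the mass of a
  factorial measure grows with the number of points, so no uniform bound holds.\<close>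

definition finite_kernel :: "'c measure \<Rightarrow> 'b measure \<Rightarrow> ('c \<Rightarrow> 'b measure) \<Rightarrow> bool" where
  "finite_kernel N K \<kappa> \<longleftrightarrow>
     (\<forall>\<omega>\<in>space N. sets (\<kappa> \<omega>) = sets K \<and> finite_measure (\<kappa> \<omega>)) \<and>
     (\<forall>A\<in>sets K. (\<lambda>\<omega>. emeasure (\<kappa> \<omega>) A) \<in> borel_measurable N)"

lemma finite_kernel_sets: "finite_kernel N K \<kappa> \<Longrightarrow> \<omega> \<in> space N \<Longrightarrow> sets (\<kappa> \<omega>) = sets K"
  by (simp add: finite_kernel_def)

lemma finite_kernel_space: "finite_kernel N K \<kappa> \<Longrightarrow> \<omega> \<in> space N \<Longrightarrow> space (\<kappa> \<omega>) = space K"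
  by (rule sets_eq_imp_space_eq) (rule finite_kernel_sets)

lemma finite_kernel_measurable:
  "finite_kernel N K \<kappa> \<Longrightarrow> \<omega> \<in> space N \<Longrightarrow> f \<in> K \<rightarrow>\<^sub>M L \<Longrightarrow> f \<in> \<kappa> \<omega> \<rightarrow>\<^sub>M L"
  by (simp add: measurable_cong_sets[OF finite_kernel_sets refl])

text \<open>A Dynkin class argument. Boxes are stable under intersection, and complements become
  differences because each \<open>\<kappa> \<omega>\<close> is finite.\<close>

lemma finite_kernel_PiM:
  assumes "finite I"
    and sets: "\<And>\<omega>. \<omega> \<in> space N \<Longrightarrow> sets (\<kappa> \<omega>) = sets (PiM I S)"
    and fin: "\<And>\<omega>. \<omega> \<in> space N \<Longrightarrow> finite_measure (\<kappa> \<omega>)"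
    and box: "\<And>B. (\<And>i. i \<in> I \<Longrightarrow> B i \<in> sets (S i)) \<Longrightarrow>
      (\<lambda>\<omega>. emeasure (\<kappa> \<omega>) (PiE I B)) \<in> borel_measurable N"
  shows "finite_kernel N (PiM I S) \<kappa>"
proof -
  have space: "space (\<kappa> \<omega>) = space (PiM I S)" if "\<omega> \<in> space N" for \<omega>
    using sets[OF that] by (rule sets_eq_imp_space_eq)
  have "(\<lambda>\<omega>. emeasure (\<kappa> \<omega>) A) \<in> borel_measurable N" if A: "A \<in> sets (PiM I S)" for A
  proof -
    have "A \<in> sigma_sets (\<Pi>\<^sub>E i\<in>I. space (S i)) (prod_algebra I S)"
      using A by (simp add: sets_PiM)
    then show ?thesis
    proof (induction rule: sigma_sets_induct_disjoint[OF Int_stable_prod_algebra prod_algebra_sets_into_space,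
          consumes 1, case_names basic empty compl union])
      case (basic A)
      then obtain B where "A = PiE I B" "\<And>i. i \<in> I \<Longrightarrow> B i \<in> sets (S i)"
        using prod_algebraE_all by (metis PiE_iff Pi_iff)
      then show ?case using box by simp
    next
      case (compl A)
      then have A: "A \<in> sets (PiM I S)" by (simp add: sets_PiM)
      have "(\<lambda>\<omega>. emeasure (\<kappa> \<omega>) (PiE I (\<lambda>i. space (S i))) - emeasure (\<kappa> \<omega>) A) \<in> borel_measurable N"
        using compl box by simp
      moreover have "emeasure (\<kappa> \<omega>) ((\<Pi>\<^sub>E i\<in>I. space (S i)) - A) =
          emeasure (\<kappa> \<omega>) (PiE I (\<lambda>i. space (S i))) - emeasure (\<kappa> \<omega>) A" if "\<omega> \<in> space N" for \<omega>
        using A sets[OF that] sets.sets_into_space[OF A] fin[OF that]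
          finite_measure.emeasure_finite[OF fin[OF that], of A] assms(1)
        by (intro emeasure_Diff) (auto simp: space_PiM)
      ultimately show ?case by (simp cong: measurable_cong)
    next
      case (union A)
      have "range A \<subseteq> sets (PiM I S)"
        using union(2) by (auto simp: sets_PiM)
      then have "emeasure (\<kappa> \<omega>) (\<Union>i. A i) = (\<Sum>i. emeasure (\<kappa> \<omega>) (A i))" if "\<omega> \<in> space N" for \<omega>
        using union(1) sets[OF that] by (intro suminf_emeasure[symmetric]) auto
      then show ?case using union(3) by (simp cong: measurable_cong)
    qed simp
  qed
  then show ?thesis using sets fin by (auto simp: finite_kernel_def)
qed

lemma sets_mixture [simp]: "sets (mixture K N \<kappa>) = sets K"
  unfolding mixture_def by (simp add: sets.space_closed sets.sigma_sets_eq)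

lemma space_mixture [simp]: "space (mixture K N \<kappa>) = space K"
  by (rule sets_eq_imp_space_eq) (rule sets_mixture)

lemma measurable_mixture [simp]: "f \<in> measurable (mixture K N \<kappa>) L \<longleftrightarrow> f \<in> measurable K L"
  by (simp add: measurable_cong_sets[OF sets_mixture refl])

text \<open>Since \<open>mixture\<close> is built by \<open>measure_of\<close>, its defining formula
  holds only once countable additivity is known; that is the exchange of a series with the integral
  over \<open>N\<close>.\<close>

lemma emeasure_mixture:
  assumes \<kappa>: "finite_kernel N K \<kappa>" and A: "A \<in> sets K"
  shows "emeasure (mixture K N \<kappa>) A = (\<integral>\<^sup>+\<omega>. emeasure (\<kappa> \<omega>) A \<partial>N)"
proof (rule emeasure_measure_of[OF mixture_def])
  show "sets K \<subseteq> Pow (space K)" by (rule sets.space_closed)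
  show "A \<in> sets (mixture K N \<kappa>)" using A by simp
  show "positive (sets (mixture K N \<kappa>)) (\<lambda>A. \<integral>\<^sup>+\<omega>. emeasure (\<kappa> \<omega>) A \<partial>N)"
    by (simp add: positive_def)
  show "countably_additive (sets (mixture K N \<kappa>)) (\<lambda>A. \<integral>\<^sup>+\<omega>. emeasure (\<kappa> \<omega>) A \<partial>N)"
  proof (rule countably_additiveI)
    fix A :: "nat \<Rightarrow> _" assume A: "range A \<subseteq> sets (mixture K N \<kappa>)" "disjoint_family A"
    then have "(\<Sum>i. \<integral>\<^sup>+\<omega>. emeasure (\<kappa> \<omega>) (A i) \<partial>N) = (\<integral>\<^sup>+\<omega>. (\<Sum>i. emeasure (\<kappa> \<omega>) (A i)) \<partial>N)"
      using \<kappa> by (intro nn_integral_suminf[symmetric]) (auto simp: finite_kernel_def)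
    also have "\<dots> = (\<integral>\<^sup>+\<omega>. emeasure (\<kappa> \<omega>) (\<Union>i. A i) \<partial>N)"
      using A by (intro nn_integral_cong suminf_emeasure) (auto simp: finite_kernel_sets[OF \<kappa>])
    finally show "(\<Sum>i. \<integral>\<^sup>+\<omega>. emeasure (\<kappa> \<omega>) (A i) \<partial>N) = (\<integral>\<^sup>+\<omega>. emeasure (\<kappa> \<omega>) (\<Union>i. A i) \<partial>N)" .
  qed
qed

text \<open>Measurability of the inner integral and the value of the integral are proved in one
  induction, because each step for the value needs the measurability.\<close>

lemma nn_integral_mixture:
  assumes \<kappa>: "finite_kernel N K \<kappa>" and f: "f \<in> borel_measurable K"
  shows "(\<lambda>\<omega>. \<integral>\<^sup>+z. f z \<partial>\<kappa> \<omega>) \<in> borel_measurable N \<and>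
    (\<integral>\<^sup>+z. f z \<partial>mixture K N \<kappa>) = (\<integral>\<^sup>+\<omega>. \<integral>\<^sup>+z. f z \<partial>\<kappa> \<omega> \<partial>N)"
  using f
proof (induction rule: borel_measurable_induct)
  case (cong f g)
  have "(\<integral>\<^sup>+z. f z \<partial>\<kappa> \<omega>) = (\<integral>\<^sup>+z. g z \<partial>\<kappa> \<omega>)" if "\<omega> \<in> space N" for \<omega>
    using cong(3) finite_kernel_space[OF \<kappa> that] by (intro nn_integral_cong) simp
  moreover have "(\<integral>\<^sup>+z. f z \<partial>mixture K N \<kappa>) = (\<integral>\<^sup>+z. g z \<partial>mixture K N \<kappa>)"
    using cong(3) by (intro nn_integral_cong) simp
  ultimately show ?case
    using cong(4) by (simp cong: measurable_cong nn_integral_cong)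
next
  case (set A)
  have "(\<integral>\<^sup>+z. indicator A z \<partial>\<kappa> \<omega>) = emeasure (\<kappa> \<omega>) A" if "\<omega> \<in> space N" for \<omega>
    using set finite_kernel_sets[OF \<kappa> that] by simp
  moreover have "(\<integral>\<^sup>+z. indicator A z \<partial>mixture K N \<kappa>) = emeasure (mixture K N \<kappa>) A"
    using set by simp
  ultimately show ?case
    using set \<kappa> by (simp add: emeasure_mixture finite_kernel_def cong: measurable_cong nn_integral_cong)
next
  case (mult u c)
  have "(\<integral>\<^sup>+z. c * u z \<partial>\<kappa> \<omega>) = c * (\<integral>\<^sup>+z. u z \<partial>\<kappa> \<omega>)" if "\<omega> \<in> space N" for \<omega>
    using mult finite_kernel_measurable[OF \<kappa> that] by (intro nn_integral_cmult)
  moreover have "(\<lambda>\<omega>. c * (\<integral>\<^sup>+z. u z \<partial>\<kappa> \<omega>)) \<in> borel_measurable N"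
    using mult by (intro borel_measurable_times_ennreal) auto
  ultimately show ?case
    using mult by (simp add: nn_integral_cmult cong: measurable_cong nn_integral_cong)
next
  case (add u v)
  have "(\<integral>\<^sup>+z. v z + u z \<partial>\<kappa> \<omega>) = (\<integral>\<^sup>+z. v z \<partial>\<kappa> \<omega>) + (\<integral>\<^sup>+z. u z \<partial>\<kappa> \<omega>)" if "\<omega> \<in> space N" for \<omega>
    using add finite_kernel_measurable[OF \<kappa> that] by (intro nn_integral_add)
  moreover have "(\<lambda>\<omega>. (\<integral>\<^sup>+z. v z \<partial>\<kappa> \<omega>) + (\<integral>\<^sup>+z. u z \<partial>\<kappa> \<omega>)) \<in> borel_measurable N"
    using add by (intro borel_measurable_add) auto
  ultimately show ?case
    using add by (simp add: nn_integral_add cong: measurable_cong nn_integral_cong)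
next
  case (seq U)
  have "(\<integral>\<^sup>+z. (SUP i. U i) z \<partial>\<kappa> \<omega>) = (SUP i. \<integral>\<^sup>+z. U i z \<partial>\<kappa> \<omega>)" if "\<omega> \<in> space N" for \<omega>
    unfolding SUP_apply
    by (intro nn_integral_monotone_convergence_SUP finite_kernel_measurable[OF \<kappa> that])
      (use seq in auto)
  moreover have "(\<integral>\<^sup>+z. (SUP i. U i) z \<partial>mixture K N \<kappa>) = (SUP i. \<integral>\<^sup>+z. U i z \<partial>mixture K N \<kappa>)"
    unfolding SUP_apply using seq by (intro nn_integral_monotone_convergence_SUP) auto
  moreover have "(\<integral>\<^sup>+\<omega>. (SUP i. \<integral>\<^sup>+z. U i z \<partial>\<kappa> \<omega>) \<partial>N) = (SUP i. \<integral>\<^sup>+\<omega>. \<integral>\<^sup>+z. U i z \<partial>\<kappa> \<omega> \<partial>N)"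
    using seq by (intro nn_integral_monotone_convergence_SUP)
      (auto simp: incseq_def le_fun_def intro!: nn_integral_mono)
  moreover have "(\<lambda>\<omega>. SUP i. \<integral>\<^sup>+z. U i z \<partial>\<kappa> \<omega>) \<in> borel_measurable N"
    using seq by (intro borel_measurable_SUP) auto
  ultimately show ?case
    using seq by (simp cong: measurable_cong nn_integral_cong)
qed

text \<open>A bound on \<open>f\<close> does not bound the inner integrals uniformly, since the mass
  of \<open>\<kappa> \<omega>\<close> varies. Their integrability comes from the finite total mass
  of the mixture.\<close>

lemma integral_mixture:
  fixes f :: "'b \<Rightarrow> real"
  assumes \<kappa>: "finite_kernel N K \<kappa>" and f: "f \<in> borel_measurable K"
    and bound: "\<And>z. z \<in> space K \<Longrightarrow> \<bar>f z\<bar> \<le> C"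
    and fin: "finite_measure (mixture K N \<kappa>)"
  shows "integrable N (\<lambda>\<omega>. \<integral>z. f z \<partial>\<kappa> \<omega>)"
    and "(\<integral>\<omega>. \<integral>z. f z \<partial>\<kappa> \<omega> \<partial>N) = (\<integral>z. f z \<partial>mixture K N \<kappa>)"
proof -
  \<comment> \<open>Applied below with \<open>g\<close> the positive and the negative part of
    \<open>f\<close>.\<close>
  have part: "integrable N (\<lambda>\<omega>. enn2real (\<integral>\<^sup>+z. g z \<partial>\<kappa> \<omega>))"
      "(\<integral>\<omega>. enn2real (\<integral>\<^sup>+z. g z \<partial>\<kappa> \<omega>) \<partial>N) = enn2real (\<integral>\<^sup>+z. g z \<partial>mixture K N \<kappa>)"
    if g: "(\<lambda>z. g z) \<in> borel_measurable K" "\<And>z. z \<in> space K \<Longrightarrow> g z \<le> ennreal C" for g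
  proof -
    have bnd: "(\<integral>\<^sup>+z. g z \<partial>L) < \<infinity>" if "finite_measure L" "space L = space K" for L
    proof -
      have "(\<integral>\<^sup>+z. g z \<partial>L) \<le> (\<integral>\<^sup>+z. ennreal C \<partial>L)"
        using g(2) that by (intro nn_integral_mono) auto
      also have "\<dots> < \<infinity>"
        using finite_measure.emeasure_finite[OF that(1)]
        by (simp add: ennreal_mult_less_top top.not_eq_extremum)
      finally show ?thesis .
    qed
    have fin_inner: "(\<integral>\<^sup>+z. g z \<partial>\<kappa> \<omega>) < \<infinity>" if "\<omega> \<in> space N" for \<omega>
      using bnd[of "\<kappa> \<omega>"] \<kappa> that finite_kernel_space[OF \<kappa> that] by (auto simp: finite_kernel_def)
    have eq: "(\<integral>\<^sup>+\<omega>. ennreal (enn2real (\<integral>\<^sup>+z. g z \<partial>\<kappa> \<omega>)) \<partial>N) = (\<integral>\<^sup>+z. g z \<partial>mixture K N \<kappa>)"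
    proof -
      have "ennreal (enn2real (\<integral>\<^sup>+z. g z \<partial>\<kappa> \<omega>)) = (\<integral>\<^sup>+z. g z \<partial>\<kappa> \<omega>)" if "\<omega> \<in> space N" for \<omega>
        using fin_inner[OF that] by (intro ennreal_enn2real) simp
      then show ?thesis using nn_integral_mixture[OF \<kappa> g(1)] by (simp cong: nn_integral_cong)
    qed
    have meas: "(\<lambda>\<omega>. enn2real (\<integral>\<^sup>+z. g z \<partial>\<kappa> \<omega>)) \<in> borel_measurable N"
      using conjunct1[OF nn_integral_mixture[OF \<kappa> g(1)]] by measurable
    show "integrable N (\<lambda>\<omega>. enn2real (\<integral>\<^sup>+z. g z \<partial>\<kappa> \<omega>))"
      using meas eq bnd[OF fin] by (intro integrableI_nonneg) auto
    show "(\<integral>\<omega>. enn2real (\<integral>\<^sup>+z. g z \<partial>\<kappa> \<omega>) \<partial>N) = enn2real (\<integral>\<^sup>+z. g z \<partial>mixture K N \<kappa>)"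
      using meas eq by (subst integral_eq_nn_integral) auto
  qed
  have int: "(\<integral>z. f z \<partial>L) = enn2real (\<integral>\<^sup>+z. ennreal (f z) \<partial>L) - enn2real (\<integral>\<^sup>+z. ennreal (- f z) \<partial>L)"
    if "finite_measure L" "sets L = sets K" for L
  proof (rule real_lebesgue_integral_def)
    have "f \<in> borel_measurable L" using f measurable_cong_sets[OF that(2) refl] by auto
    then show "integrable L f"
      using bound sets_eq_imp_space_eq[OF that(2)] that
      by (intro finite_measure.integrable_const_bound[where B = C]) auto
  qed
  have pos: "(\<lambda>z. ennreal (f z)) \<in> borel_measurable K" "\<And>z. z \<in> space K \<Longrightarrow> ennreal (f z) \<le> ennreal C"
    and neg: "(\<lambda>z. ennreal (- f z)) \<in> borel_measurable K" "\<And>z. z \<in> space K \<Longrightarrow> ennreal (- f z) \<le> ennreal C"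
    using f bound by (auto intro!: ennreal_leI simp: abs_le_iff)
  have inner: "(\<integral>z. f z \<partial>\<kappa> \<omega>) =
      enn2real (\<integral>\<^sup>+z. ennreal (f z) \<partial>\<kappa> \<omega>) - enn2real (\<integral>\<^sup>+z. ennreal (- f z) \<partial>\<kappa> \<omega>)"
    if "\<omega> \<in> space N" for \<omega>
    using \<kappa> that by (intro int) (auto simp: finite_kernel_def)
  show "integrable N (\<lambda>\<omega>. \<integral>z. f z \<partial>\<kappa> \<omega>)"
    using Bochner_Integration.integrable_diff[OF part(1)[OF pos] part(1)[OF neg]]
    by (rule Bochner_Integration.integrable_cong[OF refl inner, THEN iffD2, rotated])
  show "(\<integral>\<omega>. \<integral>z. f z \<partial>\<kappa> \<omega> \<partial>N) = (\<integral>z. f z \<partial>mixture K N \<kappa>)"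
    using Bochner_Integration.integral_diff[OF part(1)[OF pos] part(1)[OF neg]]
    unfolding int[OF fin sets_mixture]
    by (simp add: part(2)[OF pos] part(2)[OF neg] inner cong: Bochner_Integration.integral_cong)
qed

text \<open>The whole space is itself a box of finite mass, so a constant sequence serves as the
  exhaustion.\<close>

lemma measure_eqI_boxes:
  assumes "finite I" "sets P = sets (PiM I S)" "sets Q = sets (PiM I S)" "finite_measure P"
    and "\<And>B. (\<And>i. i \<in> I \<Longrightarrow> B i \<in> sets (S i)) \<Longrightarrow> emeasure P (PiE I B) = emeasure Q (PiE I B)"
  shows "P = Q"
proof (rule measure_eqI_PiM_finite[where A = "\<lambda>_. PiE I (\<lambda>i. space (S i))", OF assms(1-3,5)])
  show "range (\<lambda>_. \<Pi>\<^sub>E i\<in>I. space (S i)) \<subseteq> prod_algebra I S"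
    using prod_algebraI_finite[OF assms(1), of "\<lambda>i. space (S i)" S] by auto
qed (use finite_measure.emeasure_finite[OF assms(4)] in \<open>auto simp: space_PiM\<close>)

lemma finite_kernel_cong_sets:
  assumes "sets N = sets N'"
  shows "finite_kernel N K \<kappa> \<longleftrightarrow> finite_kernel N' K \<kappa>"
  unfolding finite_kernel_def measurable_cong_sets[OF assms refl] sets_eq_imp_space_eq[OF assms] ..

lemma finite_kernel_count_space:
  assumes "\<And>j. j \<in> J \<Longrightarrow> sets (\<kappa> j) = sets K" "\<And>j. j \<in> J \<Longrightarrow> finite_measure (\<kappa> j)"
  shows "finite_kernel (count_space J) K \<kappa>"
  using assms by (simp add: finite_kernel_def)

lemma finite_measure_mixture_count_space:
  assumes "finite J" "\<And>j. j \<in> J \<Longrightarrow> sets (\<kappa> j) = sets K" "\<And>j. j \<in> J \<Longrightarrow> finite_measure (\<kappa> j)"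
  shows "finite_measure (mixture K (count_space J) \<kappa>)"
proof (rule finite_measureI)
  have "emeasure (mixture K (count_space J) \<kappa>) (space K) = (\<Sum>j\<in>J. emeasure (\<kappa> j) (space K))"
    using assms(1) by (subst emeasure_mixture[OF finite_kernel_count_space[OF assms(2,3)]])
      (simp_all add: nn_integral_count_space_finite)
  then show "emeasure (mixture K (count_space J) \<kappa>) (space (mixture K (count_space J) \<kappa>)) \<noteq> \<infinity>"
    using assms by (simp add: finite_measure.emeasure_finite)
qed

section \<open>Factorial measures\<close>

lemma sets_factorial_measure [simp]: "sets (factorial_measure S n \<eta>) = sets (PiM {1..n} (\<lambda>_. S))"
  by (simp add: factorial_measure_def Let_def)

lemma measurable_factorial_tuple:
  assumes "set_mset \<eta> \<subseteq> space S"
  shows "(\<lambda>i. \<lambda>j\<in>{1..n}. (SOME xs. mset xs = \<eta>) ! i j)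
    \<in> count_space (injections {1..n} {..<size \<eta>}) \<rightarrow>\<^sub>M PiM {1..n} (\<lambda>_. S)"
proof -
  let ?xs = "SOME xs. mset xs = \<eta>"
  have m: "mset ?xs = \<eta>" by (rule mset_some_list)
  then have "size \<eta> = length ?xs" "set ?xs \<subseteq> space S"
    using assms by (metis size_mset, metis set_mset_mset)
  moreover have "i j < size \<eta>" if "i \<in> injections {1..n} {..<size \<eta>}" "j \<in> {1..n}" for i j
    using that by (auto simp: injections_def PiE_iff)
  ultimately have "?xs ! i j \<in> space S" if "i \<in> injections {1..n} {..<size \<eta>}" "j \<in> {1..n}" for i j
    using that nth_mem[of "i j" ?xs] by (metis subsetD)
  then show ?thesis by (auto simp: space_PiM)
qed

lemma factorial_measure_eq_distr:
  "factorial_measure S n \<eta> = distr (count_space (injections {1..n} {..<size \<eta>}))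
     (PiM {1..n} (\<lambda>_. S)) (\<lambda>i. \<lambda>j\<in>{1..n}. (SOME xs. mset xs = \<eta>) ! i j)"
  by (simp add: factorial_measure_def Let_def injections_def)

text \<open>The measure and \<open>factorial_sum\<close> use the same \<open>SOME\<close>
  enumeration, so this is a change of variables to a finite sum.\<close>

lemma nn_integral_factorial_measure_prod:
  assumes "set_mset \<eta> \<subseteq> space S" "\<And>j. j \<in> {1..n} \<Longrightarrow> g j \<in> borel_measurable S"
  shows "(\<integral>\<^sup>+z. (\<Prod>j\<in>{1..n}. g j (z j)) \<partial>factorial_measure S n \<eta>) = factorial_sum \<eta> {1..n} g"
proof -
  have "(\<lambda>z. \<Prod>j\<in>{1..n}. g j (z j)) \<in> borel_measurable (PiM {1..n} (\<lambda>_. S))"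
    using assms(2) by (intro borel_measurable_prod_ennreal) (auto intro: measurable_compose[OF measurable_component_singleton])
  then show ?thesis
    unfolding factorial_measure_eq_distr
    by (subst nn_integral_distr[OF measurable_factorial_tuple[OF assms(1)]])
      (auto simp: nn_integral_count_space_finite finite_injections factorial_sum_def tuple_sum_def)
qed

lemma integral_factorial_measure_prod:
  fixes g :: "nat \<Rightarrow> 'a \<Rightarrow> real"
  assumes "set_mset \<eta> \<subseteq> space S" "\<And>j. j \<in> {1..n} \<Longrightarrow> g j \<in> borel_measurable S"
  shows "(\<integral>z. (\<Prod>j\<in>{1..n}. g j (z j)) \<partial>factorial_measure S n \<eta>) = factorial_sum \<eta> {1..n} g"
proof -
  have "(\<lambda>z. \<Prod>j\<in>{1..n}. g j (z j)) \<in> borel_measurable (PiM {1..n} (\<lambda>_. S))"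
    using assms(2) by (intro borel_measurable_prod) (auto intro: measurable_compose[OF measurable_component_singleton])
  then show ?thesis
    unfolding factorial_measure_eq_distr
    by (subst integral_distr[OF measurable_factorial_tuple[OF assms(1)]])
      (auto simp: lebesgue_integral_count_space_finite finite_injections factorial_sum_def tuple_sum_def)
qed

lemma prod_indicator_PiE:
  assumes "finite I" "z \<in> extensional I"
  shows "(\<Prod>j\<in>I. indicator (B j) (z j)) = (indicator (PiE I B) z :: 'b::comm_semiring_1)"
  using assms by (auto simp: indicator_def PiE_iff intro!: prod.neutral prod_zero)

lemma emeasure_factorial_measure_box:
  assumes "set_mset \<eta> \<subseteq> space S" "\<And>j. j \<in> {1..n} \<Longrightarrow> B j \<in> sets S"
  shows "emeasure (factorial_measure S n \<eta>) (PiE {1..n} B) = factorial_sum \<eta> {1..n} (\<lambda>j. indicator (B j))"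
proof -
  have "emeasure (factorial_measure S n \<eta>) (PiE {1..n} B) =
      (\<integral>\<^sup>+z. indicator (PiE {1..n} B) z \<partial>factorial_measure S n \<eta>)"
    using assms(2) by (intro nn_integral_indicator[symmetric]) auto
  also have "\<dots> = (\<integral>\<^sup>+z. (\<Prod>j\<in>{1..n}. indicator (B j) (z j)) \<partial>factorial_measure S n \<eta>)"
    using sets_eq_imp_space_eq[OF sets_factorial_measure, of S n \<eta>]
    by (intro nn_integral_cong) (subst prod_indicator_PiE, auto simp: space_PiM PiE_iff)
  also have "\<dots> = factorial_sum \<eta> {1..n} (\<lambda>j. indicator (B j))"
    using assms by (intro nn_integral_factorial_measure_prod) auto
  finally show ?thesis .
qed

lemma finite_measure_factorial_measure:
  assumes "set_mset \<eta> \<subseteq> space S"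
  shows "finite_measure (factorial_measure S n \<eta>)"
  unfolding factorial_measure_eq_distr
  by (intro finite_measure.finite_measure_distr measurable_factorial_tuple assms)
    (auto simp: finite_injections intro!: finite_measure_count_space)

section \<open>Configuration space and measurability of the factorial kernel\<close>

lemma space_config_space: "space (config_space S) = {\<eta>. set_mset \<eta> \<subseteq> space S}"
  unfolding config_space_def by (rule space_measure_of) auto

lemma measurable_npoints [measurable]:
  assumes "B \<in> sets S"
  shows "npoints B \<in> config_space S \<rightarrow>\<^sub>M count_space UNIV"
proof (subst measurable_count_space_eq2_countable, intro conjI ballI)
  fix j
  have "{\<eta>. set_mset \<eta> \<subseteq> space S \<and> npoints B \<eta> = j} \<in> sets (config_space S)"
    unfolding config_space_def using assms by (intro sigma_sets.Basic in_measure_of) auto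
  moreover have "npoints B -` {j} \<inter> space (config_space S) = {\<eta>. set_mset \<eta> \<subseteq> space S \<and> npoints B \<eta> = j}"
    by (auto simp: space_config_space)
  ultimately show "npoints B -` {j} \<inter> space (config_space S) \<in> sets (config_space S)" by simp
qed auto

lemma measurable_config_spaceI:
  assumes "\<And>\<omega>. \<omega> \<in> space N \<Longrightarrow> set_mset (f \<omega>) \<subseteq> space S"
    and "\<And>B. B \<in> sets S \<Longrightarrow> (\<lambda>\<omega>. npoints B (f \<omega>)) \<in> N \<rightarrow>\<^sub>M count_space UNIV"
  shows "f \<in> N \<rightarrow>\<^sub>M config_space S"
  unfolding config_space_def
proof (rule measurable_measure_of)
  fix A assume "A \<in> {{\<eta>. set_mset \<eta> \<subseteq> space S \<and> npoints B \<eta> = j} | B j. B \<in> sets S}"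
  then obtain B j where A: "A = {\<eta>. set_mset \<eta> \<subseteq> space S \<and> npoints B \<eta> = j}" "B \<in> sets S" by auto
  have "f -` A \<inter> space N = (\<lambda>\<omega>. npoints B (f \<omega>)) -` {j} \<inter> space N"
    using assms(1) A by auto
  then show "f -` A \<inter> space N \<in> sets N"
    using measurable_sets[OF assms(2)[OF A(2)], of "{j}"] by simp
qed (use assms(1) in auto)

lemma sets_atom:
  assumes "finite I" "\<And>j. j \<in> I \<Longrightarrow> B j \<in> sets S"
  shows "atom (space S) I B \<alpha> \<in> sets S"
proof -
  have "atom (space S) I B \<alpha> = {x\<in>space S. \<forall>j\<in>I. x \<in> B j \<longleftrightarrow> j \<in> \<alpha>}" by (simp add: atom_def)
  also have "\<dots> \<in> sets S"
  proof (rule sets.sets_Collect_finite_All[OF _ assms(1)])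
    fix j assume j: "j \<in> I"
    have "{x\<in>space S. x \<in> B j \<longleftrightarrow> j \<in> \<alpha>} = (if j \<in> \<alpha> then B j else space S - B j)"
      using sets.sets_into_space[OF assms(2)[OF j]] by auto
    then show "{x\<in>space S. x \<in> B j \<longleftrightarrow> j \<in> \<alpha>} \<in> sets S" using assms(2)[OF j] by simp
  qed
  finally show ?thesis .
qed

text \<open>The expansion into cells removes the chosen enumeration and leaves only counts
  \<open>npoints\<close>, which are measurable by construction of
  \<open>config_space\<close>.\<close>

lemma measurable_factorial_sum:
  assumes "finite I" "\<And>j. j \<in> I \<Longrightarrow> B j \<in> sets S"
  shows "(\<lambda>\<eta>. factorial_sum \<eta> I (\<lambda>j. indicator (B j)) :: ennreal) \<in> borel_measurable (config_space S)"
proof -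
  have [measurable]: "atom (space S) I B \<alpha> \<in> sets S" for \<alpha> using assms by (rule sets_atom)
  have "(\<lambda>\<eta>. \<Sum>r\<in>(\<Pi>\<^sub>E j\<in>I. {\<alpha>\<in>Pow I. j \<in> \<alpha>}). \<Prod>\<alpha>\<in>Pow I.
      of_nat ((npoints (atom (space S) I B \<alpha>) \<eta> choose card {j\<in>I. r j = \<alpha>}) * fact (card {j\<in>I. r j = \<alpha>})) :: ennreal)
      \<in> borel_measurable (config_space S)"
    by (intro borel_measurable_sum borel_measurable_prod_ennreal)
      (rule measurable_compose[OF measurable_npoints], auto)
  moreover have "factorial_sum \<eta> I (\<lambda>j. indicator (B j) :: _ \<Rightarrow> ennreal) =
      (\<Sum>r\<in>(\<Pi>\<^sub>E j\<in>I. {\<alpha>\<in>Pow I. j \<in> \<alpha>}). \<Prod>\<alpha>\<in>Pow I.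
        of_nat ((npoints (atom (space S) I B \<alpha>) \<eta> choose card {j\<in>I. r j = \<alpha>}) * fact (card {j\<in>I. r j = \<alpha>})))"
    if "\<eta> \<in> space (config_space S)" for \<eta>
    using that assms by (intro factorial_sum_indicator) (auto simp: space_config_space)
  ultimately show ?thesis by (simp cong: measurable_cong)
qed

lemma finite_kernel_factorial_measure:
  assumes "G \<in> N \<rightarrow>\<^sub>M config_space S"
  shows "finite_kernel N (PiM {1..n} (\<lambda>_. S)) (\<lambda>\<omega>. factorial_measure S n (G \<omega>))"
proof (rule finite_kernel_PiM)
  have G: "set_mset (G \<omega>) \<subseteq> space S" if "\<omega> \<in> space N" for \<omega>
    using measurable_space[OF assms that] by (simp add: space_config_space)
  fix B assume B: "\<And>i. i \<in> {1..n} \<Longrightarrow> B i \<in> sets S"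
  have "(\<lambda>\<omega>. factorial_sum (G \<omega>) {1..n} (\<lambda>j. indicator (B j)) :: ennreal) \<in> borel_measurable N"
    using B by (intro measurable_compose[OF assms] measurable_factorial_sum) auto
  moreover have "emeasure (factorial_measure S n (G \<omega>)) (PiE {1..n} B) =
      factorial_sum (G \<omega>) {1..n} (\<lambda>j. indicator (B j))" if "\<omega> \<in> space N" for \<omega>
    using G[OF that] B by (rule emeasure_factorial_measure_box)
  ultimately show "(\<lambda>\<omega>. emeasure (factorial_measure S n (G \<omega>)) (PiE {1..n} B)) \<in> borel_measurable N"
    by (simp cong: measurable_cong)
next
  fix \<omega> assume "\<omega> \<in> space N"
  then show "finite_measure (factorial_measure S n (G \<omega>))"
    using measurable_space[OF assms] by (intro finite_measure_factorial_measure) (auto simp: space_config_space)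
qed auto

section \<open>Poisson processes\<close>

text \<open>Terms below \<open>m\<close> vanish; shifting by \<open>m\<close> leaves
  \<open>l ^ m * exp (- l)\<close> times the exponential series.\<close>

lemma sums_poisson_falling_factorial:
  fixes l :: real
  shows "(\<lambda>j. real ((j choose m) * fact m) * (l ^ j / fact j * exp (- l))) sums l ^ m"
proof -
  let ?f = "\<lambda>j. real ((j choose m) * fact m) * (l ^ j / fact j * exp (- l))"
  have "(\<lambda>j. l ^ m * exp (- l) * (l ^ j / fact j)) sums (l ^ m * exp (- l) * exp l)"
    using exp_converges[of l] by (intro sums_mult) (simp add: scaleR_conv_of_real divide_inverse mult.commute)
  moreover have "?f (j + m) = l ^ m * exp (- l) * (l ^ j / fact j)" for j
  proof -
    have "real ((j + m) choose m) = fact (j + m) / (fact m * fact j)"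
      by (simp add: binomial_fact)
    then show ?thesis by (simp add: power_add field_simps)
  qed
  moreover have "l ^ m * exp (- l) * exp l = l ^ m"
    by (simp add: mult.assoc flip: exp_add)
  ultimately have "(\<lambda>j. ?f (j + m)) sums l ^ m" by (simp only:)
  moreover have "(\<Sum>j<m. ?f j) = 0" by (intro sum.neutral) (simp add: binomial_eq_0)
  ultimately show ?thesis using sums_iff_shift[of ?f m "l ^ m"] by simp
qed

lemma nn_integral_poisson_falling_factorial:
  assumes "finite_measure N" "0 \<le> l" and Z: "Z \<in> N \<rightarrow>\<^sub>M count_space UNIV"
    and pois: "\<And>j. measure N {\<omega>\<in>space N. Z \<omega> = j} = l ^ j / fact j * exp (- l)"
  shows "(\<integral>\<^sup>+\<omega>. of_nat ((Z \<omega> choose m) * fact m) \<partial>N) = ennreal (l ^ m)"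
proof -
  let ?E = "\<lambda>j. {\<omega>\<in>space N. Z \<omega> = j}"
  have E: "?E j \<in> sets N" for j using Z by measurable
  have "(\<integral>\<^sup>+\<omega>. of_nat ((Z \<omega> choose m) * fact m) \<partial>N) =
      (\<integral>\<^sup>+\<omega>. (\<Sum>j. of_nat ((j choose m) * fact m) * indicator (?E j) \<omega>) \<partial>N)"
  proof (rule nn_integral_cong)
    fix \<omega> assume "\<omega> \<in> space N"
    then have "(\<lambda>j. of_nat ((j choose m) * fact m) * indicator (?E j) \<omega> :: ennreal) =
        (\<lambda>j. if j = Z \<omega> then of_nat ((j choose m) * fact m) else 0)"
      by (auto simp: indicator_def)
    then show "of_nat ((Z \<omega> choose m) * fact m) =
        (\<Sum>j. of_nat ((j choose m) * fact m) * indicator (?E j) \<omega> :: ennreal)"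
      using sums_unique[OF sums_single[of "Z \<omega>" "\<lambda>j. of_nat ((j choose m) * fact m) :: ennreal"]] by simp
  qed
  also have "\<dots> = (\<Sum>j. of_nat ((j choose m) * fact m) * emeasure N (?E j))"
    using E by (subst nn_integral_suminf) (auto simp: nn_integral_cmult_indicator)
  also have "\<dots> = (\<Sum>j. ennreal (real ((j choose m) * fact m) * (l ^ j / fact j * exp (- l))))"
    using assms(2)
    by (intro suminf_cong)
      (simp only: finite_measure.emeasure_eq_measure[OF assms(1)] pois ennreal_of_nat_eq_real_of_nat, subst ennreal_mult, auto)
  also have "\<dots> = ennreal (l ^ m)"
    using assms(2) sums_poisson_falling_factorial[of m l] by (intro suminf_ennreal_eq) auto
  finally show ?thesis .
qed

text \<open>Independence is available only for counts of disjoint sets, so it is applied to the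
  cells. The resulting sum over assignments \<open>r\<close> factorizes over slots, and the cells
  inside \<open>B j\<close> add up to \<open>B j\<close>.\<close>

lemma nn_integral_factorial_sum_poisson:
  assumes "prob_space N" "poisson_point_process N S \<nu> \<Theta>" "finite_measure \<nu>" "sets \<nu> = sets S"
    and I: "finite I" and B: "\<And>j. j \<in> I \<Longrightarrow> B j \<in> sets S"
  shows "(\<integral>\<^sup>+\<omega>. factorial_sum (\<Theta> \<omega>) I (\<lambda>j. indicator (B j)) \<partial>N) = (\<Prod>j\<in>I. emeasure \<nu> (B j))"
proof -
  interpret prob_space N by fact
  interpret \<nu>: finite_measure \<nu> by fact
  let ?C = "atom (space S) I B"
  let ?m = "\<lambda>r \<alpha>. card {j\<in>I. r j = \<alpha>}"
  let ?R = "\<Pi>\<^sub>E j\<in>I. {\<alpha>\<in>Pow I. j \<in> \<alpha>}"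
  let ?p = "\<lambda>\<alpha> m \<omega>. of_nat ((npoints (?C \<alpha>) (\<Theta> \<omega>) choose m) * fact m) :: ennreal"
  have C: "?C \<alpha> \<in> sets S" for \<alpha> using I B by (rule sets_atom)
  have \<Theta>: "\<Theta> \<in> N \<rightarrow>\<^sub>M config_space S" using assms(2) by (simp add: poisson_point_process_def)
  have np: "(\<lambda>\<omega>. npoints (?C \<alpha>) (\<Theta> \<omega>)) \<in> N \<rightarrow>\<^sub>M count_space UNIV" for \<alpha>
    using C by (intro measurable_compose[OF \<Theta> measurable_npoints])
  have p_meas: "?p \<alpha> m \<in> borel_measurable N" for \<alpha> m
    by (rule measurable_compose[OF np]) simp
  \<comment> \<open>\<open>poisson_point_process\<close> states independence for families indexed by
    naturals, while cells are indexed by subsets of \<open>I\<close>; \<open>e\<close> encodes the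
    latter.\<close>
  obtain e :: "'c set \<Rightarrow> nat" where e: "inj_on e (Pow I)"
    using finite_imp_inj_to_nat_seg[of "Pow I"] I by auto
  have indep: "(\<integral>\<^sup>+\<omega>. (\<Prod>\<alpha>\<in>Pow I. ?p \<alpha> (m \<alpha>) \<omega>) \<partial>N) = (\<Prod>\<alpha>\<in>Pow I. \<integral>\<^sup>+\<omega>. ?p \<alpha> (m \<alpha>) \<omega> \<partial>N)" for m
  proof -
    let ?d = "the_inv_into (Pow I) e"
    have d: "?d i \<in> Pow I" if "i \<in> e ` Pow I" for i using the_inv_into_into[OF e that] by auto
    have "disjoint_family_on (\<lambda>i. ?C (?d i)) (e ` Pow I)"
      unfolding disjoint_family_on_def
    proof (intro ballI impI)
      fix i k assume ik: "i \<in> e ` Pow I" "k \<in> e ` Pow I" "i \<noteq> k"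
      then have "?d i \<noteq> ?d k" using f_the_inv_into_f[OF e] by metis
      then show "?C (?d i) \<inter> ?C (?d k) = {}"
        using disjoint_family_onD[OF disjoint_family_atom] d ik by metis
    qed
    then have "indep_vars (\<lambda>_. count_space UNIV) (\<lambda>i \<omega>. npoints (?C (?d i)) (\<Theta> \<omega>)) (e ` Pow I)"
      using assms(2) I C by (auto simp: poisson_point_process_def image_subset_iff)
    then have "indep_vars (\<lambda>_. borel) (\<lambda>i \<omega>. ?p (?d i) (m (?d i)) \<omega>) (e ` Pow I)"
      by (rule indep_vars_compose2) auto
    then have "(\<integral>\<^sup>+\<omega>. (\<Prod>i\<in>e ` Pow I. ?p (?d i) (m (?d i)) \<omega>) \<partial>N) =
        (\<Prod>i\<in>e ` Pow I. \<integral>\<^sup>+\<omega>. ?p (?d i) (m (?d i)) \<omega> \<partial>N)"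
      using I by (intro indep_vars_nn_integral) auto
    then show ?thesis by (simp add: prod.reindex[OF e] the_inv_into_f_f[OF e] cong: prod.cong_simp)
  qed
  have p_int: "(\<integral>\<^sup>+\<omega>. ?p \<alpha> m \<omega> \<partial>N) = emeasure \<nu> (?C \<alpha>) ^ m" for \<alpha> m
    using assms(2) C
    by (subst nn_integral_poisson_falling_factorial[where l = "measure \<nu> (?C \<alpha>)", OF finite_measure_axioms _ np])
      (auto simp: poisson_point_process_def \<nu>.emeasure_eq_measure ennreal_power)
  have "(\<integral>\<^sup>+\<omega>. factorial_sum (\<Theta> \<omega>) I (\<lambda>j. indicator (B j)) \<partial>N) =
      (\<integral>\<^sup>+\<omega>. (\<Sum>r\<in>?R. \<Prod>\<alpha>\<in>Pow I. ?p \<alpha> (?m r \<alpha>) \<omega>) \<partial>N)"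
    using I measurable_space[OF \<Theta>]
    by (intro nn_integral_cong factorial_sum_indicator) (auto simp: space_config_space)
  also have "\<dots> = (\<Sum>r\<in>?R. \<Prod>\<alpha>\<in>Pow I. emeasure \<nu> (?C \<alpha>) ^ ?m r \<alpha>)"
    using p_meas by (subst nn_integral_sum) (auto simp only: indep p_int intro!: borel_measurable_prod_ennreal)
  \<comment> \<open>The exponent of a cell is the number of slots assigned to it, so the powers
    regroup into one factor per slot.\<close>
  also have "\<dots> = (\<Sum>r\<in>?R. \<Prod>j\<in>I. emeasure \<nu> (?C (r j)))"
  proof (intro sum.cong refl)
    fix r assume "r \<in> ?R"
    then have "r ` I \<subseteq> Pow I" by (auto simp: PiE_iff)
    then have "(\<Prod>j\<in>I. emeasure \<nu> (?C (r j))) = (\<Prod>\<alpha>\<in>Pow I. \<Prod>j\<in>{j\<in>I. r j = \<alpha>}. emeasure \<nu> (?C (r j)))"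
      using I by (intro prod.group[symmetric]) auto
    also have "\<dots> = (\<Prod>\<alpha>\<in>Pow I. emeasure \<nu> (?C \<alpha>) ^ ?m r \<alpha>)"
      by (intro prod.cong refl) simp
    finally show "(\<Prod>\<alpha>\<in>Pow I. emeasure \<nu> (?C \<alpha>) ^ ?m r \<alpha>) = (\<Prod>j\<in>I. emeasure \<nu> (?C (r j)))" ..
  qed
  also have "\<dots> = (\<Prod>j\<in>I. \<Sum>\<alpha>\<in>{\<alpha>\<in>Pow I. j \<in> \<alpha>}. emeasure \<nu> (?C \<alpha>))"
    using I by (subst prod_sum_PiE) auto
  also have "\<dots> = (\<Prod>j\<in>I. emeasure \<nu> (B j))"
  proof (intro prod.cong refl)
    fix j assume j: "j \<in> I"
    have "(\<Sum>\<alpha>\<in>{\<alpha>\<in>Pow I. j \<in> \<alpha>}. emeasure \<nu> (?C \<alpha>)) =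
        (\<integral>\<^sup>+x. (\<Sum>\<alpha>\<in>{\<alpha>\<in>Pow I. j \<in> \<alpha>}. indicator (?C \<alpha>) x) \<partial>\<nu>)"
      using C assms(4) by (subst nn_integral_sum) auto
    also have "\<dots> = (\<integral>\<^sup>+x. indicator (B j) x \<partial>\<nu>)"
      using I j sets_eq_imp_space_eq[OF assms(4)]
      by (intro nn_integral_cong indicator_eq_sum_atoms[symmetric]) auto
    finally show "(\<Sum>\<alpha>\<in>{\<alpha>\<in>Pow I. j \<in> \<alpha>}. emeasure \<nu> (?C \<alpha>)) = emeasure \<nu> (B j)"
      using B[OF j] assms(4) by simp
  qed
  finally show ?thesis .
qed

section \<open>The absorbed process\<close>

context absorbed_process
begin

lemma open_D: "open D"
  using regular by (simp add: regular_domain_def)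

lemma D_borel [measurable, simp]: "D \<in> sets borel"
  using open_D by simp

lemma sets_domain_borel: "B \<in> sets (domain_borel D) \<longleftrightarrow> B \<in> sets borel \<and> B \<subseteq> D"
  by (auto simp: sets_restrict_space_iff)

lemma space_domain_borel [simp]: "space (domain_borel D) = D"
  by (simp add: space_restrict_space)

lemma space_P: "space (P x) = space M"
  by (rule sets_eq_imp_space_eq) (rule sets_P)

section \<open>Hitting times and absorption\<close>

lemma Y_in_D:
  assumes "0 \<le> t" "ennreal t < hit_time Y (- D) \<omega>"
  shows "Y t \<omega> \<in> D"
  using assms unfolding hit_time_def
  by (metis (mono_tags, lifting) ComplI INF_lower leD mem_Collect_eq)

text \<open>Were the path in the open set \<open>D\<close> at the hitting time, right continuity
  would keep it there for a while longer, and the infimum of the exit times would be larger.\<close>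

lemma Y_hit_notin_D:
  assumes \<omega>: "\<omega> \<in> space M" and fin: "hit_time Y (- D) \<omega> < \<infinity>"
  shows "Y (enn2real (hit_time Y (- D) \<omega>)) \<omega> \<notin> D"
proof
  let ?\<tau> = "hit_time Y (- D) \<omega>" and ?s = "enn2real (hit_time Y (- D) \<omega>)"
  have \<tau>: "?\<tau> = ennreal ?s" using fin by simp
  assume "Y ?s \<omega> \<in> D"
  moreover have "((\<lambda>s. Y s \<omega>) \<longlongrightarrow> Y ?s \<omega>) (at_right ?s)"
    using right_continuous[OF \<omega>, of ?s] by (simp add: continuous_within)
  ultimately have "eventually (\<lambda>s. Y s \<omega> \<in> D) (at_right ?s)"
    using open_D by (rule topological_tendstoD[rotated -1])
  then obtain b where b: "b > ?s" "\<And>s. ?s < s \<Longrightarrow> s < b \<Longrightarrow> Y s \<omega> \<in> D"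
    by (auto simp: eventually_at_right_field)
  \<comment> \<open>The path stays in \<open>D\<close> up to \<open>b\<close>, so \<open>b\<close>
    is a lower bound of the exit times that exceeds their infimum.\<close>
  have "ennreal b \<le> ?\<tau>"
    unfolding hit_time_def
  proof (rule INF_greatest)
    fix s assume s: "s \<in> {t. 0 \<le> t \<and> Y t \<omega> \<in> - D}"
    then have "?\<tau> \<le> ennreal s" unfolding hit_time_def by (rule INF_lower)
    then have "?s \<le> s" using s \<tau> by (metis enn2real_nonneg ennreal_le_iff mem_Collect_eq)
    then have "?s < s" using s \<open>Y ?s \<omega> \<in> D\<close> by (cases "s = ?s") auto
    then have "b \<le> s" using s b(2)[of s] by (cases "s < b") auto
    then show "ennreal b \<le> ennreal s" by (rule ennreal_leI)
  qed
  then show False using \<tau> b(1) by (metis enn2real_nonneg ennreal_less_iff leD)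
qed

lemma X_before_hit: "ennreal t < hit_time Y (- D) \<omega> \<Longrightarrow> 0 \<le> t \<Longrightarrow> X t \<omega> = Y t \<omega>"
  by (simp add: X_eq absorbed_def min_absorb1 less_imp_le)

lemma X_after_hit: "hit_time Y (- D) \<omega> \<le> ennreal t \<Longrightarrow> X t \<omega> = Y (enn2real (hit_time Y (- D) \<omega>)) \<omega>"
  by (simp add: X_eq absorbed_def min_absorb2)

text \<open>Turns the event of absorption by time \<open>t\<close> into an event about
  \<open>X t\<close> alone.\<close>

lemma X_notin_D_iff:
  assumes "\<omega> \<in> space M" "0 \<le> t"
  shows "X t \<omega> \<notin> D \<longleftrightarrow> hit_time Y (- D) \<omega> \<le> ennreal t"
proof (cases "hit_time Y (- D) \<omega> \<le> ennreal t")
  case True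
  then have "hit_time Y (- D) \<omega> < \<infinity>" using le_less_trans ennreal_less_top by (metis infinity_ennreal_def)
  then show ?thesis using True Y_hit_notin_D[OF assms(1)] by (simp add: X_after_hit)
next
  case False
  then show ?thesis using assms Y_in_D by (simp add: X_before_hit not_le)
qed

lemma hit_time_X_eq:
  assumes "\<omega> \<in> space M"
  shows "hit_time X (- D) \<omega> = hit_time Y (- D) \<omega>"
proof (rule antisym)
  let ?\<tau> = "hit_time Y (- D) \<omega>"
  \<comment> \<open>The exit times of \<open>X\<close> are all times from \<open>?\<tau>\<close> on,
    so their infimum is \<open>?\<tau>\<close>.\<close>
  have set: "{t. 0 \<le> t \<and> X t \<omega> \<in> - D} = {t. 0 \<le> t \<and> ?\<tau> \<le> ennreal t}"
    using X_notin_D_iff[OF assms] by auto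
  show "?\<tau> \<le> hit_time X (- D) \<omega>"
    unfolding hit_time_def[of X] set by (rule INF_greatest) simp
  show "hit_time X (- D) \<omega> \<le> ?\<tau>"
  proof (cases "?\<tau> < \<infinity>")
    case True
    then have "ennreal (enn2real ?\<tau>) = ?\<tau>" by simp
    moreover have "hit_time X (- D) \<omega> \<le> ennreal (enn2real ?\<tau>)"
      unfolding hit_time_def[of X] set using True by (intro INF_lower) simp
    ultimately show ?thesis by simp
  qed (simp add: not_less top_unique)
qed

lemma X_hit_eq:
  assumes "\<omega> \<in> space M" "hit_time X (- D) \<omega> \<le> ennreal t"
  shows "X (enn2real (hit_time X (- D) \<omega>)) \<omega> = X t \<omega>"
proof -
  have le: "hit_time Y (- D) \<omega> \<le> ennreal t" using assms hit_time_X_eq by simp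
  then have "hit_time Y (- D) \<omega> < \<infinity>" using le_less_trans ennreal_less_top by (metis infinity_ennreal_def)
  then show ?thesis using le assms by (simp add: hit_time_X_eq X_after_hit)
qed

text \<open>For a nonmeasurable map, \<^const>\<open>distr\<close> yields either the zero measure or a measure vanishing
  on some set and on its complement, so it is no probability measure.\<close>

lemma measurable_X:
  assumes "0 \<le> t"
  shows "X t \<in> M \<rightarrow>\<^sub>M borel"
proof (rule measurableI)
  fix x :: 'a and A :: "'a set" assume A: "A \<in> sets borel"
  let ?Q = "distr (P x) borel (X t)"
  let ?m = "\<lambda>A. emeasure (P x) (X t -` A \<inter> space (P x))"
  interpret Q: prob_space ?Q
    using measurable_space[OF absorbed_kernel[OF assms], of x] by (simp add: space_prob_algebra)
  have conv: "emeasure ?Q B =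
      (if measure_space UNIV (sets borel) ?m then ?m B else 0)" if "B \<in> sets borel" for B
    using that unfolding distr_def by (simp add: emeasure_measure_of_conv sets.sigma_sets_eq[of borel, simplified])
  have one: "emeasure ?Q UNIV = 1" using Q.emeasure_space_1 by simp
  then have Q: "emeasure ?Q B = ?m B" if "B \<in> sets borel" for B
    using conv[of UNIV] conv[OF that] by (auto split: if_splits)
  show "X t -` A \<inter> space M \<in> sets M"
  proof (rule ccontr)
    assume no: "X t -` A \<inter> space M \<notin> sets M"
    moreover have "X t -` A \<inter> space M = space M - (X t -` (- A) \<inter> space M)" by auto
    ultimately have "X t -` (- A) \<inter> space M \<notin> sets M" by (metis sets.compl_sets)
    then have "emeasure ?Q A = 0" "emeasure ?Q (- A) = 0"
      using no A by (auto simp: Q space_P sets_P emeasure_notin_sets)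
    moreover have "emeasure ?Q A + emeasure ?Q (- A) = emeasure ?Q (A \<union> - A)"
      using A by (intro plus_emeasure) auto
    ultimately show False using one by simp
  qed
qed simp

lemma measurable_P_iff: "f \<in> P x \<rightarrow>\<^sub>M L \<longleftrightarrow> f \<in> M \<rightarrow>\<^sub>M L"
  by (simp add: measurable_cong_sets[OF sets_P refl])

section \<open>Transition probabilities and the density of the reservoir intensity\<close>

lemma sets_transition [simp]: "sets (transition P X t x) = sets borel"
  by (simp add: transition_def)

lemma space_transition [simp]: "space (transition P X t x) = UNIV"
  by (simp add: transition_def)

lemma prob_space_transition: "0 \<le> t \<Longrightarrow> prob_space (transition P X t x)"
  unfolding transition_def by (intro prob_space.prob_space_distr prob_space_P) (simp add: measurable_P_iff measurable_X)

lemma measurable_transition: "0 \<le> t \<Longrightarrow> transition P X t \<in> borel \<rightarrow>\<^sub>M subprob_algebra borel"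
  using absorbed_kernel[of t] unfolding transition_def by (rule measurable_prob_algebraD)

lemma borel_measurable_transition:
  "0 \<le> t \<Longrightarrow> B \<in> sets borel \<Longrightarrow> (\<lambda>y. emeasure (transition P X t y) B) \<in> borel_measurable borel"
  by (intro measurable_compose[OF measurable_transition] measurable_emeasure_subprob_algebra)

text \<open>The indicator extends \<open>lam\<close> by zero: measurability and sign are given only
  outside \<open>D\<close>.\<close>

definition absorption_density :: "('a \<Rightarrow> real) \<Rightarrow> real \<Rightarrow> 'a \<Rightarrow> real" where
  "absorption_density lam t x = (\<integral>\<omega>. indicator (- D) (X t \<omega>) * lam (X t \<omega>) \<partial>P x)"

context
  fixes lam :: "'a \<Rightarrow> real" and C :: real
  assumes lam_measurable: "lam \<in> borel_measurable (restrict_space borel (- D))"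
    and lam_nonneg: "\<And>y. y \<in> - D \<Longrightarrow> 0 \<le> lam y"
    and lam_le: "\<And>y. y \<in> - D \<Longrightarrow> lam y \<le> C"
begin

lemma measurable_lam_ext [measurable]: "(\<lambda>y. indicator (- D) y * lam y) \<in> borel_measurable borel"
  using lam_measurable borel_measurable_restrict_space_iff[of "- D" borel lam] by simp

lemma lam_ext_nonneg: "0 \<le> indicator (- D) y * lam y"
  using lam_nonneg by (auto simp: indicator_def)

text \<open>The maximum covers the points of \<open>D\<close>, where the extension is
  \<open>0\<close>.\<close>

lemma lam_ext_le: "indicator (- D) y * lam y \<le> max 0 C"
  using lam_le[of y] by (auto simp: indicator_def max_def)

lemma integrable_lam_ext:
  assumes "0 \<le> t"
  shows "integrable (P x) (\<lambda>\<omega>. indicator (- D) (X t \<omega>) * lam (X t \<omega>))"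
proof -
  interpret prob_space "P x" by (rule prob_space_P)
  have "(\<lambda>\<omega>. indicator (- D) (X t \<omega>) * lam (X t \<omega>)) \<in> borel_measurable (P x)"
    unfolding measurable_P_iff by (rule measurable_compose[OF measurable_X[OF assms] measurable_lam_ext])
  then show ?thesis
    by (intro integrable_const_bound[where B = "max 0 C"] AE_I2)
      (use lam_ext_nonneg lam_ext_le in auto)
qed

lemma absorption_density_nonneg: "0 \<le> absorption_density lam t x"
  unfolding absorption_density_def by (intro integral_nonneg_AE AE_I2 lam_ext_nonneg)

lemma absorption_density_le:
  assumes "0 \<le> t"
  shows "absorption_density lam t x \<le> max 0 C"
proof -
  interpret prob_space "P x" by (rule prob_space_P)
  show ?thesis unfolding absorption_density_def
    by (rule integral_le_const[OF integrable_lam_ext[OF assms] AE_I2[OF lam_ext_le]])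
qed

text \<open>Rewriting the path integral through the transition probability is what gives
  measurability in the starting point.\<close>

lemma ennreal_absorption_density:
  assumes "0 \<le> t"
  shows "ennreal (absorption_density lam t x) =
    (\<integral>\<^sup>+y. ennreal (indicator (- D) y * lam y) \<partial>transition P X t x)"
proof -
  have "ennreal (absorption_density lam t x) =
      (\<integral>\<^sup>+\<omega>. ennreal (indicator (- D) (X t \<omega>) * lam (X t \<omega>)) \<partial>P x)"
    unfolding absorption_density_def
    by (intro nn_integral_eq_integral[symmetric] integrable_lam_ext assms AE_I2 lam_ext_nonneg)
  also have "\<dots> = (\<integral>\<^sup>+y. ennreal (indicator (- D) y * lam y) \<partial>transition P X t x)"
    unfolding transition_def
    by (subst nn_integral_distr) (use measurable_X[OF assms] in \<open>auto simp: measurable_P_iff\<close>)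
  finally show ?thesis .
qed

lemma measurable_absorption_density:
  assumes "0 \<le> t"
  shows "absorption_density lam t \<in> borel_measurable borel"
proof -
  have "(\<lambda>x. \<integral>\<^sup>+y. ennreal (indicator (- D) y * lam y) \<partial>transition P X t x) \<in> borel_measurable borel"
    by (rule measurable_compose[OF measurable_transition[OF assms] nn_integral_measurable_subprob_algebra]) measurable
  then have "(\<lambda>x. enn2real (ennreal (absorption_density lam t x))) \<in> borel_measurable borel"
    unfolding ennreal_absorption_density[OF assms] by measurable
  then show ?thesis by (simp add: absorption_density_nonneg)
qed

lemma reservoir_measure_eq_density:
  assumes t: "0 \<le> t"
  shows "reservoir_measure P X D lam \<mu> t = density \<mu> (\<lambda>x. ennreal (absorption_density lam t x))"
  unfolding reservoir_measure_def
proof (rule arg_cong[where f = "density \<mu>"], rule ext)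
  fix x
  let ?A = "{\<omega>\<in>space (P x). hit_time X (- D) \<omega> \<le> ennreal t}"
  \<comment> \<open>Absorption by time \<open>t\<close> becomes a condition on the position at
    \<open>t\<close>, which is measurable.\<close>
  have A_eq: "?A = {\<omega>\<in>space (P x). X t \<omega> \<in> - D}"
    by (intro Collect_cong conj_cong refl)
      (simp add: space_P hit_time_X_eq X_notin_D_iff[OF _ t, symmetric])
  have Xt: "X t \<in> P x \<rightarrow>\<^sub>M borel" using measurable_X[OF t] by (simp add: measurable_P_iff)
  have "- D \<in> sets borel" by simp
  then have A: "?A \<in> sets (P x)"
    unfolding A_eq using measurable_sets[OF Xt, of "- D"] by (simp add: vimage_def Int_def conj_commute)
  \<comment> \<open>On this event the path stands still from its hitting time to
    \<open>t\<close>.\<close>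
  have at_t: "distr (restrict_space (P x) ?A) borel (\<lambda>\<omega>. X (enn2real (hit_time X (- D) \<omega>)) \<omega>) =
      distr (restrict_space (P x) ?A) borel (X t)"
    by (rule distr_cong) (auto simp: space_restrict_space space_P X_hit_eq)
  have "(\<integral>\<^sup>+y\<in>- D. ennreal (lam y) \<partial>distr (restrict_space (P x) ?A) borel (X t)) =
      (\<integral>\<^sup>+y. ennreal (indicator (- D) y * lam y) \<partial>distr (restrict_space (P x) ?A) borel (X t))"
    by (intro nn_integral_cong) (auto simp: indicator_def)
  also have "\<dots> = (\<integral>\<^sup>+\<omega>. ennreal (indicator (- D) (X t \<omega>) * lam (X t \<omega>)) \<partial>restrict_space (P x) ?A)"
    using Xt by (intro nn_integral_distr) (auto intro: measurable_restrict_space1)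
  also have "\<dots> = (\<integral>\<^sup>+\<omega>. ennreal (indicator (- D) (X t \<omega>) * lam (X t \<omega>)) * indicator ?A \<omega> \<partial>P x)"
    using A by (intro nn_integral_restrict_space) (auto simp: sets.Int)
  also have "\<dots> = (\<integral>\<^sup>+\<omega>. ennreal (indicator (- D) (X t \<omega>) * lam (X t \<omega>)) \<partial>P x)"
    unfolding A_eq by (intro nn_integral_cong) (auto simp: indicator_def)
  also have "\<dots> = ennreal (absorption_density lam t x)"
    unfolding absorption_density_def
    by (intro nn_integral_eq_integral integrable_lam_ext t AE_I2 lam_ext_nonneg)
  finally show "(\<integral>\<^sup>+y\<in>- D. ennreal (lam y)
      \<partial>distr (restrict_space (P x) ?A) borel (\<lambda>\<omega>. X (enn2real (hit_time X (- D) \<omega>)) \<omega>)) =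
      ennreal (absorption_density lam t x)" unfolding at_t .
qed

lemma finite_measure_reservoir:
  assumes "0 \<le> t" "finite_measure \<mu>" "sets \<mu> = sets (domain_borel D)"
  shows "finite_measure (reservoir_measure P X D lam \<mu> t)"
proof -
  interpret \<mu>: finite_measure \<mu> by fact
  have meas: "absorption_density lam t \<in> borel_measurable \<mu>"
    using measurable_absorption_density[OF assms(1)]
    by (simp add: measurable_cong_sets[OF assms(3) refl] measurable_restrict_space1)
  have "(\<integral>\<^sup>+x. ennreal (absorption_density lam t x) \<partial>\<mu>) \<le> (\<integral>\<^sup>+x. ennreal (max 0 C) \<partial>\<mu>)"
    using absorption_density_le[OF assms(1)] by (intro nn_integral_mono ennreal_leI)
  moreover have "emeasure \<mu> (space \<mu>) < \<top>"
    by (metis \<mu>.emeasure_finite infinity_ennreal_def top.not_eq_extremum)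
  then have "(\<integral>\<^sup>+x. ennreal (max 0 C) \<partial>\<mu>) < \<infinity>"
    by (simp add: ennreal_mult_less_top)
  ultimately show ?thesis
    unfolding reservoir_measure_eq_density[OF assms(1)]
    using le_less_trans meas by (intro finite_measureI) (auto simp: emeasure_density cong: nn_integral_cong)
qed

text \<open>A configuration of \<open>k\<close> particles contributes to the weight only if all of them have been absorbed,
  so the weight factorizes over the particles.\<close>

lemma absorption_weight_eq:
  assumes t: "0 \<le> t"
  shows "absorption_weight P X D lam t k z = (\<Prod>i\<in>{1..k}. absorption_density lam t (z i))"
proof -
  interpret product_sigma_finite "\<lambda>i. P (z i)"
    by (intro product_sigma_finite.intro prob_space_imp_sigma_finite prob_space_P)
  have "prod_mset (image_mset lam {#y \<in># particles X k t \<omega>. y \<in> - D#}) *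
      (if npoints (- D) (particles X k t \<omega>) = k then 1 else 0) =
      (\<Prod>i\<in>{1..k}. indicator (- D) (X t (\<omega> i)) * lam (X t (\<omega> i)))" for \<omega>
  proof -
    let ?S = "{i\<in>{1..k}. X t (\<omega> i) \<in> - D}"
    have filt: "{#y \<in># particles X k t \<omega>. y \<in> - D#} = image_mset (\<lambda>i. X t (\<omega> i)) (mset_set ?S)"
      by (simp add: particles_def config_def filter_mset_image_mset filter_mset_mset_set)
    then have np: "npoints (- D) (particles X k t \<omega>) = card ?S" by (simp add: npoints_def)
    show ?thesis
    proof (cases "?S = {1..k}")
      case True
      then have "\<forall>i\<in>{1..k}. X t (\<omega> i) \<notin> D" by blast
      then show ?thesis
        unfolding np filt True by (auto simp: prod_unfold_prod_mset[symmetric] multiset.map_comp comp_def intro!: prod.cong)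
    next
      case False
      \<comment> \<open>Some particle survives: the indicator of full absorption is \<open>0\<close>
        on one side, the factor of that particle is \<open>0\<close> on the other.\<close>
      then have "card ?S < card {1..k}" by (intro psubset_card_mono) auto
      moreover obtain i where "i \<in> {1..k}" "X t (\<omega> i) \<in> D" using False by blast
      then have "(\<Prod>i\<in>{1..k}. indicator (- D) (X t (\<omega> i)) * lam (X t (\<omega> i))) = 0"
        by (intro prod_zero bexI[of _ i]) auto
      ultimately show ?thesis unfolding np by auto
    qed
  qed
  then have "absorption_weight P X D lam t k z =
      (\<integral>\<omega>. (\<Prod>i\<in>{1..k}. indicator (- D) (X t (\<omega> i)) * lam (X t (\<omega> i))) \<partial>PiM {1..k} (\<lambda>i. P (z i)))"
    unfolding absorption_weight_def copies_def by simp
  also have "\<dots> = (\<Prod>i\<in>{1..k}. absorption_density lam t (z i))"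
    unfolding absorption_density_def
    by (rule product_integral_prod) (auto intro: integrable_lam_ext t)
  finally show ?thesis .
qed

end

section \<open>Expected factorial measure of the gas\<close>

lemma npoints_config: "npoints B (config k a) = card {i\<in>{1..k}. a i \<in> B}"
  by (simp add: npoints_def config_def filter_mset_image_mset filter_mset_mset_set)

lemma measurable_X_component:
  assumes "0 \<le> t" "i \<in> {1..k}"
  shows "(\<lambda>\<omega>. X t (\<omega> i)) \<in> copies P k x \<rightarrow>\<^sub>M borel"
proof -
  have "(\<lambda>\<omega>. \<omega> i) \<in> copies P k x \<rightarrow>\<^sub>M P (x i)"
    unfolding copies_def using assms(2) by (rule measurable_component_singleton)
  moreover have "X t \<in> P (x i) \<rightarrow>\<^sub>M borel" using measurable_X[OF assms(1)] by (simp add: measurable_P_iff)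
  ultimately show ?thesis by (rule measurable_compose)
qed

lemma measurable_particles:
  assumes "0 \<le> t"
  shows "particles X k t \<in> copies P k x \<rightarrow>\<^sub>M config_space borel"
proof (rule measurable_config_spaceI)
  fix B :: "'a set" assume B [measurable]: "B \<in> sets borel"
  have "{\<omega> \<in> space (copies P k x). i \<in> {i\<in>{1..k}. X t (\<omega> i) \<in> B}} \<in> sets (copies P k x)" for i
  proof (cases "i \<in> {1..k}")
    case True
    note [measurable] = measurable_X_component[OF assms True, of x]
    show ?thesis using True by simp
  next
    case False
    then have "{\<omega> \<in> space (copies P k x). i \<in> {i\<in>{1..k}. X t (\<omega> i) \<in> B}} = {}" by auto
    then show ?thesis by (simp only: sets.empty_sets)
  qed
  then show "(\<lambda>\<omega>. npoints B (particles X k t \<omega>)) \<in> copies P k x \<rightarrow>\<^sub>M count_space UNIV"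
    unfolding particles_def npoints_config by (rule measurable_card)
qed simp

text \<open>Each injection sends distinct slots to distinct, hence independent, particles, so the
  mean of the product over slots is a product of transition probabilities.\<close>

lemma nn_integral_factorial_sum_particles:
  assumes t: "0 \<le> t" and I: "finite I" and B: "\<And>j. j \<in> I \<Longrightarrow> B j \<in> sets borel"
  shows "(\<integral>\<^sup>+\<omega>. factorial_sum (particles X k t \<omega>) I (\<lambda>j. indicator (B j)) \<partial>copies P k x) =
    factorial_sum (config k x) I (\<lambda>j y. emeasure (transition P X t y) (B j))"
proof -
  interpret product_sigma_finite "\<lambda>i. P (x i)"
    by (intro product_sigma_finite.intro prob_space_imp_sigma_finite prob_space_P)
  let ?I = "\<lambda>c \<omega>. \<Prod>j\<in>I. indicator (B j) (X t (\<omega> (c j))) :: ennreal"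
  have one: "(\<integral>\<^sup>+\<omega>. ?I c \<omega> \<partial>copies P k x) = (\<Prod>j\<in>I. emeasure (transition P X t (x (c j))) (B j))"
    if c: "c \<in> injections I {1..k}" for c
  proof -
    have inj: "inj_on c I" and ck: "c ` I \<subseteq> {1..k}" using c by (auto simp: injections_def PiE_iff)
    let ?d = "the_inv_into I c"
    let ?f = "\<lambda>i v. if i \<in> c ` I then indicator (B (?d i)) (X t v) else 1 :: ennreal"
    \<comment> \<open>A product over slots becomes one over all particles, with factor
      \<open>1\<close> for those that fill no slot; the product measure is indexed by
      particles.\<close>
    have prod: "(\<Prod>j\<in>I. g j (c j)) = (\<Prod>i\<in>{1..k}. if i \<in> c ` I then g (?d i) i else 1)"
      for g :: "_ \<Rightarrow> _ \<Rightarrow> ennreal"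
    proof -
      have "(\<Prod>i\<in>{1..k}. if i \<in> c ` I then g (?d i) i else 1) = (\<Prod>i\<in>c ` I. g (?d i) i)"
        using ck by (subst prod.inter_restrict[symmetric]) (auto simp: Int_absorb1)
      then show ?thesis by (simp add: prod.reindex[OF inj] the_inv_into_f_f[OF inj])
    qed
    have meas: "?f i \<in> borel_measurable (P (x i))" if "i \<in> {1..k}" for i
    proof (cases "i \<in> c ` I")
      case True
      then have "B (?d i) \<in> sets borel" using B the_inv_into_into[OF inj] by blast
      then have "(\<lambda>v. indicator (B (?d i)) (X t v) :: ennreal) \<in> borel_measurable (P (x i))"
        using measurable_X[OF t] unfolding measurable_P_iff
        by (intro measurable_compose[OF _ borel_measurable_indicator])
      then show ?thesis using True by simp
    qed simp
    have "(\<integral>\<^sup>+\<omega>. ?I c \<omega> \<partial>copies P k x) = (\<integral>\<^sup>+\<omega>. (\<Prod>i\<in>{1..k}. ?f i (\<omega> i)) \<partial>PiM {1..k} (\<lambda>i. P (x i)))"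
      unfolding copies_def by (intro nn_integral_cong) (rule prod[of "\<lambda>j i. indicator (B j) (X t (_ i))"])
    also have "\<dots> = (\<Prod>i\<in>{1..k}. \<integral>\<^sup>+v. ?f i v \<partial>P (x i))"
      using meas by (intro product_nn_integral_prod) auto
    also have "\<dots> = (\<Prod>i\<in>{1..k}. if i \<in> c ` I then emeasure (transition P X t (x i)) (B (?d i)) else 1)"
    proof (intro prod.cong refl)
      fix i assume "i \<in> {1..k}"
      interpret prob_space "P (x i)" by (rule prob_space_P)
      show "(\<integral>\<^sup>+v. ?f i v \<partial>P (x i)) = (if i \<in> c ` I then emeasure (transition P X t (x i)) (B (?d i)) else 1)"
      proof (cases "i \<in> c ` I")
        case True
        then have Bi: "B (?d i) \<in> sets borel" using B the_inv_into_into[OF inj] by blast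
        have Xt: "X t \<in> P (x i) \<rightarrow>\<^sub>M borel" using measurable_X[OF t] by (simp add: measurable_P_iff)
        have "(\<integral>\<^sup>+v. indicator (B (?d i)) (X t v) \<partial>P (x i)) =
            (\<integral>\<^sup>+y. indicator (B (?d i)) y \<partial>transition P X t (x i))"
          unfolding transition_def using Xt Bi by (subst nn_integral_distr) auto
        then show ?thesis using True Bi by simp
      qed (simp add: emeasure_space_1)
    qed
    also have "\<dots> = (\<Prod>j\<in>I. emeasure (transition P X t (x (c j))) (B j))"
      by (rule prod[symmetric])
    finally show ?thesis .
  qed
  have meas: "?I c \<in> borel_measurable (copies P k x)" if "c \<in> injections I {1..k}" for c
    using that B t by (intro borel_measurable_prod_ennreal measurable_compose[OF measurable_X_component])
      (auto simp: injections_def PiE_iff)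
  have "(\<integral>\<^sup>+\<omega>. factorial_sum (particles X k t \<omega>) I (\<lambda>j. indicator (B j)) \<partial>copies P k x) =
      (\<integral>\<^sup>+\<omega>. (\<Sum>c\<in>injections I {1..k}. ?I c \<omega>) \<partial>copies P k x)"
    by (simp add: particles_def factorial_sum_config tuple_sum_def)
  also have "\<dots> = (\<Sum>c\<in>injections I {1..k}. \<integral>\<^sup>+\<omega>. ?I c \<omega> \<partial>copies P k x)"
    by (rule nn_integral_sum) (rule meas)
  also have "\<dots> = factorial_sum (config k x) I (\<lambda>j y. emeasure (transition P X t y) (B j))"
    by (simp add: one factorial_sum_config tuple_sum_def)
  finally show ?thesis .
qed

context
  fixes lam :: "'a \<Rightarrow> real" and \<mu> :: "'a measure" and q :: nat and x :: "nat \<Rightarrow> 'a"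
    and N :: "'v measure" and \<xi> \<Theta> :: "real \<Rightarrow> 'v \<Rightarrow> 'a multiset" and t :: real
  assumes gas: "boundary_driven_gas P X D lam \<mu> q x N \<xi> \<Theta>" and t: "0 \<le> t"
begin

section \<open>The gas at a fixed time\<close>

lemma prob_space_N: "prob_space N"
  using gas by (simp add: boundary_driven_gas_def Let_def)

lemma poisson_input:
  "poisson_point_process N (domain_borel D) (reservoir_measure P X D lam \<mu> t) (\<Theta> t)"
  using gas t by (simp add: boundary_driven_gas_def Let_def)

lemma indep_input:
  "prob_space.indep_var N (config_space borel) (\<xi> t) (config_space (domain_borel D)) (\<Theta> t)"
  using gas t by (simp add: boundary_driven_gas_def Let_def)

lemma measurable_input: "\<Theta> t \<in> N \<rightarrow>\<^sub>M config_space (domain_borel D)"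
  using poisson_input by (simp add: poisson_point_process_def)

text \<open>The law is prescribed for the whole path; evaluation at \<open>t\<close> is a coordinate
  map and yields the marginal.\<close>

lemma distr_absorbed_particles:
  shows "\<xi> t \<in> N \<rightarrow>\<^sub>M config_space borel"
    and "distr N (config_space borel) (\<xi> t) = distr (copies P q x) (config_space borel) (particles X q t)"
proof -
  let ?paths = "PiM {0..} (\<lambda>_::real. config_space (borel :: 'a measure))"
  have meas: "(\<lambda>\<omega>. \<lambda>t\<in>{0..}. \<xi> t \<omega>) \<in> N \<rightarrow>\<^sub>M ?paths"
    and law: "distr N ?paths (\<lambda>\<omega>. \<lambda>t\<in>{0..}. \<xi> t \<omega>) =
      distr (copies P q x) ?paths (\<lambda>\<omega>. \<lambda>t\<in>{0..}. particles X q t \<omega>)"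
    using gas by (simp_all add: boundary_driven_gas_def Let_def)
  have proj: "(\<lambda>p. p t) \<in> ?paths \<rightarrow>\<^sub>M config_space borel"
    using t by (intro measurable_component_singleton) simp
  have meas': "(\<lambda>\<omega>. \<lambda>t\<in>{0..}. particles X q t \<omega>) \<in> copies P q x \<rightarrow>\<^sub>M ?paths"
    by (intro measurable_restrict measurable_particles) simp
  show "\<xi> t \<in> N \<rightarrow>\<^sub>M config_space borel"
    using measurable_compose[OF meas proj] t by simp
  show "distr N (config_space borel) (\<xi> t) = distr (copies P q x) (config_space borel) (particles X q t)"
    using arg_cong[OF law, of "\<lambda>L. distr L (config_space borel) (\<lambda>p. p t)"] t
    by (simp add: distr_distr[OF proj meas] distr_distr[OF proj meas'] comp_def)
qed

lemma npoints_gas_config: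
  "B \<subseteq> D \<Longrightarrow> npoints B (gas_config D \<xi> \<Theta> t \<omega>) = npoints B (\<xi> t \<omega>) + npoints B (\<Theta> t \<omega>)"
  by (auto simp: npoints_def gas_config_def filter_filter_mset intro!: arg_cong[where f = size] filter_mset_cong)

lemma measurable_gas_config: "gas_config D \<xi> \<Theta> t \<in> N \<rightarrow>\<^sub>M config_space (domain_borel D)"
proof (rule measurable_config_spaceI)
  fix \<omega> assume "\<omega> \<in> space N"
  then show "set_mset (gas_config D \<xi> \<Theta> t \<omega>) \<subseteq> space (domain_borel D)"
    using measurable_space[OF measurable_input] by (auto simp: gas_config_def space_config_space)
next
  fix B assume B: "B \<in> sets (domain_borel D)"
  then have [measurable]: "(\<lambda>\<omega>. npoints B (\<xi> t \<omega>)) \<in> N \<rightarrow>\<^sub>M count_space UNIV"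
      "(\<lambda>\<omega>. npoints B (\<Theta> t \<omega>)) \<in> N \<rightarrow>\<^sub>M count_space UNIV"
    by (auto simp: sets_domain_borel intro: measurable_compose[OF distr_absorbed_particles(1) measurable_npoints]
        measurable_compose[OF measurable_input measurable_npoints[of B "domain_borel D"]])
  show "(\<lambda>\<omega>. npoints B (gas_config D \<xi> \<Theta> t \<omega>)) \<in> N \<rightarrow>\<^sub>M count_space UNIV"
    using B by (simp add: npoints_gas_config sets_domain_borel)
qed

lemma finite_kernel_gas:
  "finite_kernel N (PiM {1..n} (\<lambda>_. domain_borel D))
    (\<lambda>\<omega>. factorial_measure (domain_borel D) n (gas_config D \<xi> \<Theta> t \<omega>))"
  by (intro finite_kernel_factorial_measure measurable_gas_config)

lemma emeasure_gas_box:
  assumes \<nu>: "finite_measure (reservoir_measure P X D lam \<mu> t)"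
    and \<mu>: "sets \<mu> = sets (domain_borel D)"
    and B: "\<And>j. j \<in> {1..n} \<Longrightarrow> B j \<in> sets (domain_borel D)"
  shows "emeasure (mixture (PiM {1..n} (\<lambda>_. domain_borel D)) N
      (\<lambda>\<omega>. factorial_measure (domain_borel D) n (gas_config D \<xi> \<Theta> t \<omega>))) (PiE {1..n} B) =
    (\<Sum>K\<in>Pow {1..n}. (\<Prod>j\<in>K. emeasure (reservoir_measure P X D lam \<mu> t) (B j)) *
      factorial_sum (config q x) ({1..n} - K) (\<lambda>j y. emeasure (transition P X t y) (B j)))"
proof -
  interpret prob_space N by (rule prob_space_N)
  let ?\<nu> = "reservoir_measure P X D lam \<mu> t"
  let ?F = "\<lambda>\<eta> K. factorial_sum \<eta> K (\<lambda>j. indicator (B j)) :: ennreal"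
  have B': "B j \<in> sets borel" "B j \<subseteq> D" if "j \<in> {1..n}" for j
    using B[OF that] by (auto simp: sets_domain_borel)
  have fin: "finite K" if "K \<subseteq> {1..n}" for K using that finite_subset by auto
  have sets_\<nu>: "sets ?\<nu> = sets (domain_borel D)" by (simp add: reservoir_measure_def \<mu>)
  have F_borel: "(\<lambda>\<eta>. ?F \<eta> K) \<in> borel_measurable (config_space borel)"
    and F_dom: "(\<lambda>\<eta>. ?F \<eta> K) \<in> borel_measurable (config_space (domain_borel D))" if "K \<subseteq> {1..n}" for K
    using fin[OF that] that B B' by (auto intro!: measurable_factorial_sum)
  note F_\<xi> = measurable_compose[OF distr_absorbed_particles(1) F_borel]
  note F_\<Theta> = measurable_compose[OF measurable_input F_dom]
  have \<Theta>_int: "(\<integral>\<^sup>+\<omega>. ?F (\<Theta> t \<omega>) K \<partial>N) = (\<Prod>j\<in>K. emeasure ?\<nu> (B j))" if "K \<subseteq> {1..n}" for K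
    using that B
    by (intro nn_integral_factorial_sum_poisson[OF prob_space_N poisson_input \<nu> sets_\<nu> fin]) auto
  have \<xi>_int: "(\<integral>\<^sup>+\<omega>. ?F (\<xi> t \<omega>) K \<partial>N) =
      factorial_sum (config q x) K (\<lambda>j y. emeasure (transition P X t y) (B j))" if K: "K \<subseteq> {1..n}" for K
  proof -
    have "(\<integral>\<^sup>+\<omega>. ?F (\<xi> t \<omega>) K \<partial>N) = (\<integral>\<^sup>+\<eta>. ?F \<eta> K \<partial>distr N (config_space borel) (\<xi> t))"
      by (rule nn_integral_distr[OF distr_absorbed_particles(1), symmetric]) (simp add: F_borel[OF K])
    also have "\<dots> = (\<integral>\<^sup>+\<omega>. ?F (particles X q t \<omega>) K \<partial>copies P q x)"
      unfolding distr_absorbed_particles(2)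
      by (rule nn_integral_distr[OF measurable_particles[OF t]]) (simp add: F_borel[OF K])
    also have "\<dots> = factorial_sum (config q x) K (\<lambda>j y. emeasure (transition P X t y) (B j))"
      using K B' by (intro nn_integral_factorial_sum_particles t fin) auto
    finally show ?thesis .
  qed
  have prod_int: "(\<integral>\<^sup>+\<omega>. ?F (\<Theta> t \<omega>) K * ?F (\<xi> t \<omega>) L \<partial>N) =
      (\<integral>\<^sup>+\<omega>. ?F (\<Theta> t \<omega>) K \<partial>N) * (\<integral>\<^sup>+\<omega>. ?F (\<xi> t \<omega>) L \<partial>N)"
    if "K \<subseteq> {1..n}" "L \<subseteq> {1..n}" for K L
  proof -
    have "indep_var borel ((\<lambda>\<eta>. ?F \<eta> L) \<circ> \<xi> t) borel ((\<lambda>\<eta>. ?F \<eta> K) \<circ> \<Theta> t)"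
      using F_borel[OF that(2)] F_dom[OF that(1)] by (rule indep_var_compose[OF indep_input])
    \<comment> \<open>Independence of a pair is recast as a family over \<open>bool\<close>, for
      which the mean of a product factorizes.\<close>
    then have "indep_vars (\<lambda>_. borel) (case_bool ((\<lambda>\<eta>. ?F \<eta> L) \<circ> \<xi> t) ((\<lambda>\<eta>. ?F \<eta> K) \<circ> \<Theta> t)) UNIV"
      unfolding indep_var_def by (rule indep_vars_cong[THEN iffD1, rotated -1]) (auto split: bool.split)
    from indep_vars_nn_integral[OF _ this] show ?thesis
      by (simp add: UNIV_bool mult.commute comp_def)
  qed
  have "emeasure (factorial_measure (domain_borel D) n (gas_config D \<xi> \<Theta> t \<omega>)) (PiE {1..n} B) =
      (\<Sum>K\<in>Pow {1..n}. ?F (\<Theta> t \<omega>) K * ?F (\<xi> t \<omega>) ({1..n} - K))" if "\<omega> \<in> space N" for \<omega>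
  proof -
    have "set_mset (gas_config D \<xi> \<Theta> t \<omega>) \<subseteq> space (domain_borel D)"
      using measurable_space[OF measurable_gas_config that] by (simp add: space_config_space)
    then have "emeasure (factorial_measure (domain_borel D) n (gas_config D \<xi> \<Theta> t \<omega>)) (PiE {1..n} B) =
        ?F (gas_config D \<xi> \<Theta> t \<omega>) {1..n}"
      using B by (rule emeasure_factorial_measure_box)
    also have "\<dots> = (\<Sum>K\<in>Pow {1..n}. ?F (\<Theta> t \<omega>) K * ?F {#a \<in># \<xi> t \<omega>. a \<in> D#} ({1..n} - K))"
      unfolding gas_config_def by (rule factorial_sum_plus) simp
    also have "\<dots> = (\<Sum>K\<in>Pow {1..n}. ?F (\<Theta> t \<omega>) K * ?F (\<xi> t \<omega>) ({1..n} - K))"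
      using B' by (intro sum.cong refl arg_cong2[where f = "(*)"] factorial_sum_filter)
        (auto simp: indicator_def)
    finally show ?thesis .
  qed
  then have "emeasure (mixture (PiM {1..n} (\<lambda>_. domain_borel D)) N
      (\<lambda>\<omega>. factorial_measure (domain_borel D) n (gas_config D \<xi> \<Theta> t \<omega>))) (PiE {1..n} B) =
      (\<integral>\<^sup>+\<omega>. (\<Sum>K\<in>Pow {1..n}. ?F (\<Theta> t \<omega>) K * ?F (\<xi> t \<omega>) ({1..n} - K)) \<partial>N)"
    using B by (subst emeasure_mixture[OF finite_kernel_gas]) (auto intro!: sets_PiM_I_finite cong: nn_integral_cong)
  also have "\<dots> = (\<Sum>K\<in>Pow {1..n}. \<integral>\<^sup>+\<omega>. ?F (\<Theta> t \<omega>) K * ?F (\<xi> t \<omega>) ({1..n} - K) \<partial>N)"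
    using F_\<xi> F_\<Theta> by (intro nn_integral_sum borel_measurable_times_ennreal) auto
  also have "\<dots> = (\<Sum>K\<in>Pow {1..n}. (\<Prod>j\<in>K. emeasure ?\<nu> (B j)) *
      factorial_sum (config q x) ({1..n} - K) (\<lambda>j y. emeasure (transition P X t y) (B j)))"
    by (intro sum.cong refl) (simp add: prod_int \<Theta>_int \<xi>_int)
  finally show ?thesis .
qed

end

end

section \<open>Symmetric functions and densities\<close>

context absorbed_process
begin

context
  fixes lam :: "'a \<Rightarrow> real" and \<mu> :: "'a measure" and q :: nat and x :: "nat \<Rightarrow> 'a"
    and t :: real
  assumes t: "0 \<le> t" and x_in: "\<And>i. i \<in> {1..q} \<Longrightarrow> x i \<in> D"
    and \<mu>: "sets \<mu> = sets (domain_borel D)"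
    and \<nu>: "finite_measure (reservoir_measure P X D lam \<mu> t)"
begin

abbreviation "tr \<equiv> transition P X t"
abbreviation "\<nu> \<equiv> reservoir_measure P X D lam \<mu> t"
text \<open>\<open>moved\<close> lives on tuples in the whole space because absorbed particles stay
  outside \<open>D\<close>. Its restriction in \<open>joined\<close> keeps the tuples of surviving
  particles only.\<close>

abbreviation "moved m \<equiv> semigroup_dual P X t m (factorial_measure (domain_borel D) m (config q x))"
abbreviation "joined n k \<equiv> join_measure (domain_borel D) n k (PiM {1..k} (\<lambda>_. \<nu>))
  (restrict_space (moved (n - k)) ({1..n - k} \<rightarrow>\<^sub>E D))"

section \<open>The semigroup acting on factorial measures\<close>

lemma sets_reservoir: "sets \<nu> = sets (domain_borel D)"
  by (simp add: reservoir_measure_def \<mu>)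

lemma set_config_subset: "set_mset (config q x) \<subseteq> space (domain_borel D)"
  using x_in by (auto simp: config_def)

lemma measurable_transition_domain:
  "B \<in> sets borel \<Longrightarrow> (\<lambda>y. emeasure (tr y) B) \<in> borel_measurable (domain_borel D)"
  by (intro measurable_restrict_space1 borel_measurable_transition t)

lemma product_sigma_finite_transition: "product_sigma_finite (\<lambda>i. tr (z i))"
  by (intro product_sigma_finite.intro prob_space_imp_sigma_finite prob_space_transition t)

text \<open>Box masses are products of transition probabilities, hence measurable in the starting
  tuple; boxes suffice by \<open>finite_kernel_PiM\<close>.\<close>

lemma finite_kernel_transition:
  "finite_kernel (factorial_measure (domain_borel D) m \<eta>) (PiM {1..m} (\<lambda>_. borel)) (\<lambda>z. PiM {1..m} (\<lambda>i. tr (z i)))"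
  unfolding finite_kernel_cong_sets[OF sets_factorial_measure]
proof (rule finite_kernel_PiM)
  show "sets (PiM {1..m} (\<lambda>i. tr (z i))) = sets (PiM {1..m} (\<lambda>_. borel))" for z
    by (intro sets_PiM_cong) auto
  show "finite_measure (PiM {1..m} (\<lambda>i. tr (z i)))" for z
    by (intro prob_space.finite_measure prob_space_PiM prob_space_transition t)
  fix B :: "nat \<Rightarrow> 'a set" assume B: "\<And>i. i \<in> {1..m} \<Longrightarrow> B i \<in> sets borel"
  have "(\<lambda>z. \<Prod>i\<in>{1..m}. emeasure (tr (z i)) (B i)) \<in> borel_measurable (PiM {1..m} (\<lambda>_. domain_borel D))"
  proof (rule borel_measurable_prod_ennreal)
    fix i assume i: "i \<in> {1..m}"
    then have "(\<lambda>z. z i) \<in> PiM {1..m} (\<lambda>_. domain_borel D) \<rightarrow>\<^sub>M domain_borel D"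
      by (rule measurable_component_singleton)
    then show "(\<lambda>z. emeasure (tr (z i)) (B i)) \<in> borel_measurable (PiM {1..m} (\<lambda>_. domain_borel D))"
      by (rule measurable_compose[OF _ measurable_transition_domain[OF B[OF i]]])
  qed
  moreover have "emeasure (PiM {1..m} (\<lambda>i. tr (z i))) (PiE {1..m} B) = (\<Prod>i\<in>{1..m}. emeasure (tr (z i)) (B i))" for z
      using B by (intro product_sigma_finite.emeasure_PiM[OF product_sigma_finite_transition]) auto
  ultimately show "(\<lambda>z. emeasure (PiM {1..m} (\<lambda>i. tr (z i))) (PiE {1..m} B))
      \<in> borel_measurable (PiM {1..m} (\<lambda>_. domain_borel D))"
    by (simp only:)
qed simp

lemma sets_moved [simp]: "sets (moved m) = sets (PiM {1..m} (\<lambda>_. borel))"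
  by (simp add: semigroup_dual_def)

lemma emeasure_moved_box:
  assumes B: "\<And>i. i \<in> {1..m} \<Longrightarrow> B i \<in> sets borel"
  shows "emeasure (moved m) (PiE {1..m} B) = factorial_sum (config q x) {1..m} (\<lambda>i y. emeasure (tr y) (B i))"
proof -
  have "emeasure (moved m) (PiE {1..m} B) =
      (\<integral>\<^sup>+z. emeasure (PiM {1..m} (\<lambda>i. tr (z i))) (PiE {1..m} B) \<partial>factorial_measure (domain_borel D) m (config q x))"
    unfolding semigroup_dual_def
    using B by (intro emeasure_mixture finite_kernel_transition sets_PiM_I_finite) auto
  also have "\<dots> = (\<integral>\<^sup>+z. (\<Prod>i\<in>{1..m}. emeasure (tr (z i)) (B i)) \<partial>factorial_measure (domain_borel D) m (config q x))"
    using B by (intro nn_integral_cong product_sigma_finite.emeasure_PiM[OF product_sigma_finite_transition]) auto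
  also have "\<dots> = factorial_sum (config q x) {1..m} (\<lambda>i y. emeasure (tr y) (B i))"
    using B by (intro nn_integral_factorial_measure_prod set_config_subset measurable_transition_domain)
  finally show ?thesis .
qed

lemma domain_box_in_sets: "({1..m} \<rightarrow>\<^sub>E D) \<in> sets (moved m)"
  by (auto intro: sets_PiM_I_finite)

lemma emeasure_restrict_moved_box:
  assumes B: "\<And>i. i \<in> {1..m} \<Longrightarrow> B i \<in> sets (domain_borel D)"
  shows "emeasure (restrict_space (moved m) ({1..m} \<rightarrow>\<^sub>E D)) (PiE {1..m} B) =
    factorial_sum (config q x) {1..m} (\<lambda>i y. emeasure (tr y) (B i))"
proof -
  have "PiE {1..m} B \<subseteq> {1..m} \<rightarrow>\<^sub>E D"
    using B unfolding sets_domain_borel by (intro PiE_mono) auto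
  then have "emeasure (restrict_space (moved m) ({1..m} \<rightarrow>\<^sub>E D)) (PiE {1..m} B) = emeasure (moved m) (PiE {1..m} B)"
    using domain_box_in_sets[of m] by (intro emeasure_restrict_space) auto
  also have "\<dots> = factorial_sum (config q x) {1..m} (\<lambda>i y. emeasure (tr y) (B i))"
    using B unfolding sets_domain_borel by (intro emeasure_moved_box) auto
  finally show ?thesis .
qed

lemma finite_measure_restrict_moved: "finite_measure (restrict_space (moved m) ({1..m} \<rightarrow>\<^sub>E D))"
proof (rule finite_measureI)
  have sp: "space (restrict_space (moved m) ({1..m} \<rightarrow>\<^sub>E D)) = {1..m} \<rightarrow>\<^sub>E D"
    using sets.sets_into_space[OF domain_box_in_sets[of m]] by (auto simp: space_restrict_space)
  have "emeasure (tr y) D \<noteq> \<top>" for y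
    using prob_space.emeasure_le_1[OF prob_space_transition[OF t], of y D]
    by (metis ennreal_one_less_top leD)
  then show "emeasure (restrict_space (moved m) ({1..m} \<rightarrow>\<^sub>E D))
      (space (restrict_space (moved m) ({1..m} \<rightarrow>\<^sub>E D))) \<noteq> \<infinity>"
    unfolding sp using emeasure_restrict_moved_box[of m "\<lambda>_. D"]
    by (simp add: sets_domain_borel factorial_sum_config tuple_sum_def ennreal_prod_eq_top finite_injections)
qed

section \<open>Joining reservoir slots and particle slots\<close>

lemma measurable_join:
  assumes "k \<le> n"
  shows "(\<lambda>(u, v). \<lambda>i\<in>{1..n}. if i \<le> k then u i else v (i - k))
    \<in> PiM {1..k} (\<lambda>_. \<nu>) \<Otimes>\<^sub>M restrict_space (moved (n - k)) ({1..n - k} \<rightarrow>\<^sub>E D)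
    \<rightarrow>\<^sub>M PiM {1..n} (\<lambda>_. domain_borel D)"
  unfolding case_prod_beta
proof (rule measurable_restrict)
  let ?\<alpha> = "PiM {1..k} (\<lambda>_. \<nu>)" and ?\<beta> = "restrict_space (moved (n - k)) ({1..n - k} \<rightarrow>\<^sub>E D)"
  fix i assume i: "i \<in> {1..n}"
  show "(\<lambda>p. if i \<le> k then fst p i else snd p (i - k)) \<in> ?\<alpha> \<Otimes>\<^sub>M ?\<beta> \<rightarrow>\<^sub>M domain_borel D"
  proof (cases "i \<le> k")
    case True
    then have "(\<lambda>u. u i) \<in> ?\<alpha> \<rightarrow>\<^sub>M \<nu>" using i by (intro measurable_component_singleton) auto
    then have "(\<lambda>u. u i) \<in> ?\<alpha> \<rightarrow>\<^sub>M domain_borel D"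
      using measurable_cong_sets[OF refl sets_reservoir] by blast
    then show ?thesis using True by (simp add: measurable_compose[OF measurable_fst])
  next
    case False
    then have ik: "i - k \<in> {1..n - k}" using i by auto
    have "(\<lambda>v. v (i - k)) \<in> PiM {1..n - k} (\<lambda>_. borel) \<rightarrow>\<^sub>M (borel :: 'a measure)"
      using ik by (intro measurable_component_singleton)
    then have "(\<lambda>v. v (i - k)) \<in> moved (n - k) \<rightarrow>\<^sub>M (borel :: 'a measure)"
      using measurable_cong_sets[OF sets_moved refl] by blast
    then have "(\<lambda>v. v (i - k)) \<in> ?\<beta> \<rightarrow>\<^sub>M domain_borel D"
      using ik by (intro measurable_restrict_space2 measurable_restrict_space1)
        (auto simp: space_restrict_space PiE_iff)
    then show ?thesis using False by (simp add: measurable_compose[OF measurable_snd])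
  qed
qed

lemma sets_joined [simp]: "sets (joined n k) = sets (PiM {1..n} (\<lambda>_. domain_borel D))"
  by (simp add: join_measure_def)

lemma finite_measure_joined:
  assumes "k \<le> n"
  shows "finite_measure (joined n k)"
proof -
  interpret product_sigma_finite "\<lambda>_::nat. \<nu>"
    using finite_measure.sigma_finite_measure[OF \<nu>] by (intro product_sigma_finite.intro)
  have "finite_measure (PiM {1..k} (\<lambda>_. \<nu>))"
    using finite_measure.emeasure_finite[OF \<nu>]
    by (intro finite_measureI) (simp add: space_PiM emeasure_PiM ennreal_prod_eq_top del: prod_constant)
  then show ?thesis
    unfolding join_measure_def using finite_measure_restrict_moved assms
    by (intro finite_measure.finite_measure_distr finite_measure_pair_measure measurable_join)
qed

lemma emeasure_joined_box:
  assumes k: "k \<le> n" and B: "\<And>j. j \<in> {1..n} \<Longrightarrow> B j \<in> sets (domain_borel D)"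
  shows "emeasure (joined n k) (PiE {1..n} B) =
    (\<Prod>j\<in>{1..k}. emeasure \<nu> (B j)) *
      factorial_sum (config q x) {1..n - k} (\<lambda>i y. emeasure (tr y) (B (i + k)))"
proof -
  interpret product_sigma_finite "\<lambda>_::nat. \<nu>"
    using finite_measure.sigma_finite_measure[OF \<nu>] by (intro product_sigma_finite.intro)
  let ?\<alpha> = "PiM {1..k} (\<lambda>_. \<nu>)" and ?\<beta> = "restrict_space (moved (n - k)) ({1..n - k} \<rightarrow>\<^sub>E D)"
  let ?f = "\<lambda>(u, v). \<lambda>i\<in>{1..n}. if i \<le> k then u i else v (i - k)"
  let ?U = "PiE {1..k} B" and ?V = "PiE {1..n - k} (\<lambda>i. B (i + k))"
  interpret \<beta>: finite_measure ?\<beta> by (rule finite_measure_restrict_moved)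
  have BD: "B j \<subseteq> D" if "j \<in> {1..n}" for j using B[OF that] by (simp add: sets_domain_borel)
  have U: "?U \<in> sets ?\<alpha>"
    using B k by (intro sets_PiM_I_finite) (auto simp: sets_reservoir)
  have V_sub: "?V \<subseteq> {1..n - k} \<rightarrow>\<^sub>E D"
  proof (rule PiE_mono)
    show "B (i + k) \<subseteq> D" if "i \<in> {1..n - k}" for i
    proof -
      have "i + k \<in> {1..n}" using that k by auto
      then show ?thesis by (rule BD)
    qed
  qed
  have "?V \<in> sets (moved (n - k))"
    using B k by (auto simp: sets_domain_borel intro!: sets_PiM_I_finite)
  then have V: "?V \<in> sets ?\<beta>"
    using V_sub by (auto simp: sets_restrict_space)
  have space: "space ?\<beta> \<subseteq> extensional {1..n - k}" "space ?\<alpha> \<subseteq> extensional {1..k}"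
    by (auto simp: space_restrict_space space_PiM PiE_iff)
  \<comment> \<open>Coordinate \<open>i > k\<close> of the joined tuple is coordinate
    \<open>i - k\<close> of the second factor, so the sides of its box are shifted by
    \<open>k\<close>.\<close>
  have "?f -` PiE {1..n} B \<inter> space (?\<alpha> \<Otimes>\<^sub>M ?\<beta>) = ?U \<times> ?V"
  proof (intro equalityI subsetI)
    fix p assume "p \<in> ?f -` PiE {1..n} B \<inter> space (?\<alpha> \<Otimes>\<^sub>M ?\<beta>)"
    moreover obtain u v where uv: "p = (u, v)" by (cases p)
    ultimately have "u \<in> space ?\<alpha>" "v \<in> space ?\<beta>" and box: "?f (u, v) \<in> PiE {1..n} B"
      by (simp_all only: vimage_eq Int_iff space_pair_measure mem_Sigma_iff)
    then have p: "p = (u, v)" "u \<in> extensional {1..k}" "v \<in> extensional {1..n - k}"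
      using space uv by blast+
    have val: "(if i \<le> k then u i else v (i - k)) \<in> B i" if "i \<in> {1..n}" for i
      using PiE_mem[OF box that] that by simp
    have "u i \<in> B i" if "i \<in> {1..k}" for i using val[of i] that k by auto
    moreover have "v i \<in> B (i + k)" if "i \<in> {1..n - k}" for i using val[of "i + k"] that k by auto
    ultimately show "p \<in> ?U \<times> ?V" using p by (auto simp: PiE_iff)
  next
    fix p assume "p \<in> ?U \<times> ?V"
    then obtain u v where p: "p = (u, v)" "u \<in> ?U" "v \<in> ?V" by blast
    have "(if i \<le> k then u i else v (i - k)) \<in> B i" if i: "i \<in> {1..n}" for i
    proof (cases "i \<le> k")
      case False
      then have "i - k \<in> {1..n - k}" using i by auto
      from PiE_mem[OF p(3) this] show ?thesis using False by simp
    qed (use p i in auto)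
    then have "?f (u, v) \<in> PiE {1..n} B" by auto
    moreover have "u \<in> space ?\<alpha>" "v \<in> space ?\<beta>"
      using p sets.sets_into_space[OF U] sets.sets_into_space[OF V] by auto
    ultimately show "p \<in> ?f -` PiE {1..n} B \<inter> space (?\<alpha> \<Otimes>\<^sub>M ?\<beta>)"
      using p by (simp add: space_pair_measure)
  qed
  then have "emeasure (joined n k) (PiE {1..n} B) = emeasure (?\<alpha> \<Otimes>\<^sub>M ?\<beta>) (?U \<times> ?V)"
    unfolding join_measure_def using B
    by (subst emeasure_distr[OF measurable_join[OF k]]) (auto intro: sets_PiM_I_finite)
  also have "\<dots> = emeasure ?\<alpha> ?U * emeasure ?\<beta> ?V"
    using U V by (rule \<beta>.emeasure_pair_measure_Times)
  also have "emeasure ?\<alpha> ?U = (\<Prod>j\<in>{1..k}. emeasure \<nu> (B j))"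
    using B k by (intro emeasure_PiM) (auto simp: sets_reservoir)
  also have "emeasure ?\<beta> ?V = factorial_sum (config q x) {1..n - k} (\<lambda>i y. emeasure (tr y) (B (i + k)))"
    using B k by (intro emeasure_restrict_moved_box) auto
  finally show ?thesis .
qed

lemma measurable_permute_joined:
  assumes "\<pi> permutes {1..n}"
  shows "(\<lambda>z. \<lambda>i\<in>{1..n}. z (inv \<pi> i)) \<in> joined n k \<rightarrow>\<^sub>M PiM {1..n} (\<lambda>_. domain_borel D)"
proof -
  have "(\<lambda>z. \<lambda>i\<in>{1..n}. z (inv \<pi> i)) \<in> PiM {1..n} (\<lambda>_. domain_borel D) \<rightarrow>\<^sub>M PiM {1..n} (\<lambda>_. domain_borel D)"
    using permutes_in_image[OF permutes_inv[OF assms]]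
    by (intro measurable_restrict measurable_component_singleton) blast
  then show ?thesis using measurable_cong_sets[OF sets_joined refl] by blast
qed

text \<open>The term of the box formula indexed by \<open>K\<close> is obtained from the one for the first \<open>card K\<close>
  slots by permuting the coordinates.\<close>

lemma ex_permuted_join:
  assumes K: "K \<subseteq> {1..n}"
  shows "\<exists>\<pi>. \<pi> permutes {1..n} \<and>
    (\<forall>B. (\<forall>j\<in>{1..n}. B j \<in> sets (domain_borel D)) \<longrightarrow>
      emeasure (joined n (card K)) (\<Pi>\<^sub>E j\<in>{1..n}. B (\<pi> j)) =
      (\<Prod>j\<in>K. emeasure \<nu> (B j)) *
        factorial_sum (config q x) ({1..n} - K) (\<lambda>j y. emeasure (tr y) (B j)))"
proof -
  let ?k = "card K"
  have k: "?k \<le> n" using card_mono[OF _ K] by simp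
  obtain \<pi> where \<pi>: "\<pi> permutes {1..n}" "bij_betw \<pi> {1..?k} K" "bij_betw \<pi> {?k + 1..n} ({1..n} - K)"
    using ex_permutation_onto_subset[OF K] .
  \<comment> \<open>Particle slots are numbered from \<open>1\<close> in \<open>joined\<close>; the
    shift by \<open>?k\<close> precedes the permutation.\<close>
  have "bij_betw (\<lambda>i. i + ?k) {1..n - ?k} {?k + 1..n}"
    using k by (intro bij_betw_byWitness[where f' = "\<lambda>i. i - ?k"]) auto
  from bij_betw_trans[OF this \<pi>(3)]
  have shift: "bij_betw (\<lambda>i. \<pi> (i + ?k)) {1..n - ?k} ({1..n} - K)" by (simp add: comp_def)
  have "emeasure (joined n ?k) (\<Pi>\<^sub>E j\<in>{1..n}. B (\<pi> j)) =
      (\<Prod>j\<in>K. emeasure \<nu> (B j)) *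
        factorial_sum (config q x) ({1..n} - K) (\<lambda>j y. emeasure (tr y) (B j))"
    if B: "\<forall>j\<in>{1..n}. B j \<in> sets (domain_borel D)" for B
  proof -
    have "B (\<pi> j) \<in> sets (domain_borel D)" if "j \<in> {1..n}" for j
      using B permutes_in_image[OF \<pi>(1)] that by blast
    then show ?thesis
      by (simp only: emeasure_joined_box[OF k] factorial_sum_bij_indices[OF shift]
          prod.reindex_bij_betw[OF \<pi>(2), of "\<lambda>j. emeasure \<nu> (B j)"])
  qed
  then show ?thesis using \<pi>(1) by blast
qed

section \<open>The expected factorial measure, its symmetric integrals and its density\<close>

context
  fixes N :: "'v measure" and \<xi> \<Theta> :: "real \<Rightarrow> 'v \<Rightarrow> 'a multiset"
  assumes gas: "boundary_driven_gas P X D lam \<mu> q x N \<xi> \<Theta>"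
begin

abbreviation "gas_measure n \<equiv> mixture (PiM {1..n} (\<lambda>_. domain_borel D)) N
  (\<lambda>\<omega>. factorial_measure (domain_borel D) n (gas_config D \<xi> \<Theta> t \<omega>))"

text \<open>The two measures agree on boxes. The finite sum over \<open>K\<close> is written as a
  mixture over counting measure, so that \<open>integral_mixture\<close> also integrates against
  it.\<close>

lemma gas_measure_decomposition:
  obtains \<pi> where "\<And>K. K \<subseteq> {1..n} \<Longrightarrow> \<pi> K permutes {1..n}"
    "gas_measure n = mixture (PiM {1..n} (\<lambda>_. domain_borel D)) (count_space (Pow {1..n}))
      (\<lambda>K. distr (joined n (card K)) (PiM {1..n} (\<lambda>_. domain_borel D)) (\<lambda>z. \<lambda>i\<in>{1..n}. z (inv (\<pi> K) i)))"
proof -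
  obtain \<pi> where \<pi>: "\<And>K. K \<subseteq> {1..n} \<Longrightarrow> \<pi> K permutes {1..n}"
    and box: "\<And>K B. K \<subseteq> {1..n} \<Longrightarrow> (\<forall>j\<in>{1..n}. B j \<in> sets (domain_borel D)) \<Longrightarrow>
      emeasure (joined n (card K)) (\<Pi>\<^sub>E j\<in>{1..n}. B (\<pi> K j)) =
      (\<Prod>j\<in>K. emeasure \<nu> (B j)) *
        factorial_sum (config q x) ({1..n} - K) (\<lambda>j y. emeasure (tr y) (B j))"
    using ex_permuted_join[of _ n] by metis
  let ?K = "PiM {1..n} (\<lambda>_. domain_borel D)"
  let ?\<phi> = "\<lambda>K z. \<lambda>i\<in>{1..n}. z (inv (\<pi> K) i)"
  let ?R = "\<lambda>K. distr (joined n (card K)) ?K (?\<phi> K)"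
  have card: "card K \<le> n" if "K \<subseteq> {1..n}" for K using card_mono[OF _ that] by simp
  have \<phi>: "?\<phi> K \<in> joined n (card K) \<rightarrow>\<^sub>M ?K" if "K \<subseteq> {1..n}" for K
    by (rule measurable_permute_joined[OF \<pi>[OF that]])
  have fin: "finite_measure (?R K)" if "K \<in> Pow {1..n}" for K
    using that by (intro finite_measure.finite_measure_distr finite_measure_joined card \<phi>) auto
  have R_box: "emeasure (?R K) (PiE {1..n} B) = (\<Prod>j\<in>K. emeasure \<nu> (B j)) *
        factorial_sum (config q x) ({1..n} - K) (\<lambda>j y. emeasure (tr y) (B j))"
    if K: "K \<subseteq> {1..n}" and B: "\<And>j. j \<in> {1..n} \<Longrightarrow> B j \<in> sets (domain_borel D)" for K B
  proof -
    note p = permutes_inverses[OF \<pi>[OF K]] permutes_in_image[OF \<pi>[OF K]] permutes_in_image[OF permutes_inv[OF \<pi>[OF K]]]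
    have sub: "B j \<subseteq> D" if "j \<in> {1..n}" for j using B[OF that] by (simp add: sets_domain_borel)
    \<comment> \<open>The map reads coordinate \<open>inv (\<pi> K) i\<close> at place
      \<open>i\<close>, so coordinate \<open>j\<close> of the original tuple must lie in
      \<open>B (\<pi> K j)\<close>.\<close>
    have "?\<phi> K -` PiE {1..n} B \<inter> space (joined n (card K)) = (\<Pi>\<^sub>E j\<in>{1..n}. B (\<pi> K j))"
    proof (intro equalityI subsetI)
      fix z assume z: "z \<in> ?\<phi> K -` PiE {1..n} B \<inter> space (joined n (card K))"
      have "z j \<in> B (\<pi> K j)" if "j \<in> {1..n}" for j
      proof -
        have \<pi>j: "\<pi> K j \<in> {1..n}" using that p(3) by blast
        have "?\<phi> K z \<in> PiE {1..n} B" using z by blast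
        from PiE_mem[OF this \<pi>j] show ?thesis by (simp only: restrict_apply' [OF \<pi>j] p(2))
      qed
      moreover have "z \<in> extensional {1..n}"
        using z sets_eq_imp_space_eq[OF sets_joined, of n "card K"] by (auto simp: space_PiM PiE_iff)
      ultimately show "z \<in> (\<Pi>\<^sub>E j\<in>{1..n}. B (\<pi> K j))" by (auto simp: PiE_iff)
    next
      fix z assume z: "z \<in> (\<Pi>\<^sub>E j\<in>{1..n}. B (\<pi> K j))"
      have "z (inv (\<pi> K) i) \<in> B i" if "i \<in> {1..n}" for i
        using PiE_mem[OF z, of "inv (\<pi> K) i"] that p(4)[of i] by (simp add: p(1))
      moreover have "(\<Pi>\<^sub>E j\<in>{1..n}. B (\<pi> K j)) \<subseteq> {1..n} \<rightarrow>\<^sub>E D"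
        by (intro PiE_mono sub) (simp only: p(3))
      then have "z \<in> space (joined n (card K))"
        unfolding sets_eq_imp_space_eq[OF sets_joined] using z by (auto simp only: space_PiM space_domain_borel)
      ultimately show "z \<in> ?\<phi> K -` PiE {1..n} B \<inter> space (joined n (card K))" by auto
    qed
    then have "emeasure (?R K) (PiE {1..n} B) = emeasure (joined n (card K)) (\<Pi>\<^sub>E j\<in>{1..n}. B (\<pi> K j))"
      using B by (subst emeasure_distr[OF \<phi>[OF K]]) (auto intro: sets_PiM_I_finite)
    then show ?thesis using box[OF K] B by simp
  qed
  have kern: "finite_kernel (count_space (Pow {1..n})) ?K ?R"
    using fin by (intro finite_kernel_count_space) auto
  have "mixture ?K (count_space (Pow {1..n})) ?R = gas_measure n"
  proof (rule measure_eqI_boxes[where I = "{1..n}" and S = "\<lambda>_. domain_borel D"])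
    show "finite_measure (mixture ?K (count_space (Pow {1..n})) ?R)"
      using fin by (intro finite_measure_mixture_count_space) auto
    fix B assume B: "\<And>i. i \<in> {1..n} \<Longrightarrow> B i \<in> sets (domain_borel D)"
    have "emeasure (mixture ?K (count_space (Pow {1..n})) ?R) (PiE {1..n} B) = (\<Sum>K\<in>Pow {1..n}. emeasure (?R K) (PiE {1..n} B))"
      using B by (subst emeasure_mixture[OF kern]) (auto simp: nn_integral_count_space_finite intro: sets_PiM_I_finite)
    also have "\<dots> = emeasure (gas_measure n) (PiE {1..n} B)"
    proof -
      have "emeasure (gas_measure n) (PiE {1..n} B) = (\<Sum>K\<in>Pow {1..n}. (\<Prod>j\<in>K. emeasure \<nu> (B j)) *
          factorial_sum (config q x) ({1..n} - K) (\<lambda>j y. emeasure (tr y) (B j)))"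
        using B by (rule emeasure_gas_box[OF gas t \<nu> \<mu>])
      also have "\<dots> = (\<Sum>K\<in>Pow {1..n}. emeasure (?R K) (PiE {1..n} B))"
        by (intro sum.cong refl R_box[symmetric] B) auto
      finally show ?thesis ..
    qed
    finally show "emeasure (mixture ?K (count_space (Pow {1..n})) ?R) (PiE {1..n} B) = emeasure (gas_measure n) (PiE {1..n} B)" .
  qed auto
  from that[OF \<pi> this[symmetric]] show thesis .
qed

text \<open>The whole space is the box with all sides \<open>D\<close>; there the box formula is a
  finite sum of finite terms.\<close>

lemma finite_measure_gas: "finite_measure (gas_measure n)"
proof (rule finite_measureI)
  have box: "PiE {1..n} (\<lambda>_. D) = space (gas_measure n)" by (simp add: space_PiM)
  have "emeasure (tr y) D \<noteq> \<top>" for y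
    using prob_space.emeasure_le_1[OF prob_space_transition[OF t], of y D]
    by (metis ennreal_one_less_top leD)
  then have "factorial_sum (config q x) ({1..n} - K) (\<lambda>j y. emeasure (tr y) D) \<noteq> \<top>" for K
    by (simp add: factorial_sum_config tuple_sum_def ennreal_prod_eq_top finite_injections)
  moreover have "(\<Prod>j\<in>K. emeasure \<nu> D) \<noteq> \<top>" if "K \<subseteq> {1..n}" for K
    using finite_measure.emeasure_finite[OF \<nu>] by (simp add: ennreal_prod_eq_top del: prod_constant)
  ultimately show "emeasure (gas_measure n) (space (gas_measure n)) \<noteq> \<infinity>"
    unfolding box[symmetric]
    by (subst emeasure_gas_box[OF gas t \<nu> \<mu>]) (auto simp: sets_domain_borel ennreal_mult_eq_top_iff)
qed

text \<open>Part (a): a symmetric function does not see the permutations of the coordinates, so only the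
  cardinality of the set of slots filled from the reservoir matters.\<close>

lemma integral_gas_symmetric:
  fixes f :: "(nat \<Rightarrow> 'a) \<Rightarrow> real"
  assumes f: "f \<in> borel_measurable (PiM {1..n} (\<lambda>_. domain_borel D))"
    and bounded: "bounded (f ` ({1..n} \<rightarrow>\<^sub>E D))"
    and sym: "\<And>\<pi> z. \<pi> permutes {1..n} \<Longrightarrow> z \<in> {1..n} \<rightarrow>\<^sub>E D \<Longrightarrow> f (z \<circ> \<pi>) = f z"
  shows "integrable N (\<lambda>\<omega>. \<integral>z. f z \<partial>factorial_measure (domain_borel D) n (gas_config D \<xi> \<Theta> t \<omega>))"
    and "(\<integral>\<omega>. (\<integral>z. f z \<partial>factorial_measure (domain_borel D) n (gas_config D \<xi> \<Theta> t \<omega>)) \<partial>N) =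
      (\<Sum>k=0..n. real (n choose k) * (\<integral>z. f z \<partial>joined n k))"
proof -
  let ?K = "PiM {1..n} (\<lambda>_. domain_borel D)"
  have space: "space ?K = {1..n} \<rightarrow>\<^sub>E D" by (simp add: space_PiM)
  obtain C where C: "\<And>z. z \<in> space ?K \<Longrightarrow> \<bar>f z\<bar> \<le> C"
    using bounded unfolding bounded_iff space by auto
  note gas_int = integral_mixture[OF finite_kernel_gas[OF gas t] f C finite_measure_gas]
  show "integrable N (\<lambda>\<omega>. \<integral>z. f z \<partial>factorial_measure (domain_borel D) n (gas_config D \<xi> \<Theta> t \<omega>))"
    by (rule gas_int(1))
  obtain \<pi> where \<pi>: "\<And>K. K \<subseteq> {1..n} \<Longrightarrow> \<pi> K permutes {1..n}"
    and dec: "gas_measure n = mixture ?K (count_space (Pow {1..n}))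
      (\<lambda>K. distr (joined n (card K)) ?K (\<lambda>z. \<lambda>i\<in>{1..n}. z (inv (\<pi> K) i)))"
    using gas_measure_decomposition[of n thesis] by blast
  let ?\<phi> = "\<lambda>K z. \<lambda>i\<in>{1..n}. z (inv (\<pi> K) i)"
  let ?R = "\<lambda>K. distr (joined n (card K)) ?K (?\<phi> K)"
  have card: "card K \<le> n" if "K \<subseteq> {1..n}" for K using card_mono[OF _ that] by simp
  have \<phi>: "?\<phi> K \<in> joined n (card K) \<rightarrow>\<^sub>M ?K" if "K \<subseteq> {1..n}" for K
    by (rule measurable_permute_joined[OF \<pi>[OF that]])
  have kern: "finite_kernel (count_space (Pow {1..n})) ?K ?R"
    by (intro finite_kernel_count_space finite_measure.finite_measure_distr finite_measure_joined card \<phi>) auto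
  have "(\<integral>z. f z \<partial>?R K) = (\<integral>z. f z \<partial>joined n (card K))" if K: "K \<subseteq> {1..n}" for K
  proof -
    have "f (?\<phi> K z) = f z" if z: "z \<in> space (joined n (card K))" for z
    proof -
      have z': "z \<in> {1..n} \<rightarrow>\<^sub>E D"
        using z unfolding sets_eq_imp_space_eq[OF sets_joined] space .
      have inv: "inv (\<pi> K) permutes {1..n}" by (rule permutes_inv[OF \<pi>[OF K]])
      \<comment> \<open>Outside \<open>{1..n}\<close> the permutation is the identity and
        \<open>z\<close> is \<open>undefined\<close>, so restricting the composition changes
        nothing.\<close>
      have "?\<phi> K z = z \<circ> inv (\<pi> K)"
        using z' permutes_not_in[OF inv] by (auto simp: fun_eq_iff restrict_def PiE_iff extensional_def)
      then show ?thesis using sym[OF inv z'] by simp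
    qed
    then show ?thesis
      unfolding integral_distr[OF \<phi>[OF K] f] by (rule Bochner_Integration.integral_cong[OF refl])
  qed
  then have "(\<integral>z. f z \<partial>gas_measure n) = (\<Sum>K\<in>Pow {1..n}. \<integral>z. f z \<partial>joined n (card K))"
    unfolding dec
    by (subst integral_mixture(2)[OF kern f C finite_measure_gas[of n, unfolded dec], symmetric])
      (simp_all add: lebesgue_integral_count_space_finite)
  also have "\<dots> = (\<Sum>k=0..n. real (n choose k) * (\<integral>z. f z \<partial>joined n k))"
    using sum_Pow_card[of "{1..n}" "\<lambda>k. \<integral>z. f z \<partial>joined n k"] by simp
  finally show "(\<integral>\<omega>. (\<integral>z. f z \<partial>factorial_measure (domain_borel D) n (gas_config D \<xi> \<Theta> t \<omega>)) \<partial>N) =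
      (\<Sum>k=0..n. real (n choose k) * (\<integral>z. f z \<partial>joined n k))"
    using gas_int(2) by simp
qed

text \<open>Part (b): by symmetry of \<open>pd\<close>, the candidate density is a sum of products of functions of one
  variable each.\<close>

lemma gas_density:
  fixes pd :: "'a \<Rightarrow> 'a \<Rightarrow> real" and C :: real
  assumes lam: "lam \<in> borel_measurable (restrict_space borel (- D))"
      "\<And>y. y \<in> - D \<Longrightarrow> 0 \<le> lam y" "\<And>y. y \<in> - D \<Longrightarrow> lam y \<le> C"
    and \<mu>_fin: "finite_measure \<mu>"
    and pd: "\<And>u v. u \<in> D \<Longrightarrow> v \<in> D \<Longrightarrow> 0 \<le> pd u v \<and> pd u v = pd v u"
    and pd_meas: "\<And>u. u \<in> D \<Longrightarrow> pd u \<in> borel_measurable (domain_borel D)"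
    and pd_density: "\<And>u A. u \<in> D \<Longrightarrow> A \<in> sets (domain_borel D) \<Longrightarrow>
      emeasure (tr u) A = (\<integral>\<^sup>+v\<in>A. ennreal (pd u v) \<partial>\<mu>)"
    and rhs: "rhs = (\<lambda>z. \<Sum>I\<in>Pow {1..n}.
      absorption_weight P X D lam t (card I) (subtuple z I) *
      (\<integral>y. (\<Prod>i=1..n - card I. pd (subtuple z ({1..n} - I) i) (y i))
        \<partial>factorial_measure (domain_borel D) (n - card I) (config q x)))"
  shows "rhs \<in> borel_measurable (PiM {1..n} (\<lambda>_. \<mu>))"
    and "gas_measure n = density (PiM {1..n} (\<lambda>_. \<mu>)) (\<lambda>z. ennreal (rhs z))"
proof -
  let ?h = "absorption_density lam t"
  \<comment> \<open>The one-coordinate density of slot \<open>j\<close>: the reservoir density if it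
    is filled from the Poisson input, otherwise the transition density out of the starting point of
    particle \<open>c j\<close>.\<close>
  let ?\<rho> = "\<lambda>K c j v. if j \<in> K then ?h v else pd (x (c j)) v"
  let ?Inj = "\<lambda>K. injections ({1..n} - K) {1..q}"
  have space_\<mu>: "space \<mu> = D" using sets_eq_imp_space_eq[OF \<mu>] by simp
  interpret \<mu>: finite_measure \<mu> by fact
  interpret product_sigma_finite "\<lambda>_::nat. \<mu>"
    using \<mu>.sigma_finite_measure_axioms by (intro product_sigma_finite.intro)
  have c_in: "x (c j) \<in> D" if "c \<in> ?Inj K" "j \<in> {1..n} - K" for c j K
    using that x_in by (auto simp: injections_def PiE_iff)
  have fin: "finite K" if "K \<subseteq> {1..n}" for K using that finite_subset by auto
  have \<rho>_meas: "?\<rho> K c j \<in> borel_measurable \<mu>" if "c \<in> ?Inj K" "j \<in> {1..n}" for K c j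
  proof -
    have "?h \<in> borel_measurable (domain_borel D)"
      using measurable_absorption_density[OF lam t] by (rule measurable_restrict_space1)
    then have "?\<rho> K c j \<in> borel_measurable (domain_borel D)"
      using c_in[OF that(1), of j] that(2) pd_meas by (cases "j \<in> K") auto
    then show ?thesis using measurable_cong_sets[OF \<mu> refl] by blast
  qed
  have \<rho>_nonneg: "0 \<le> ?\<rho> K c j v" if "c \<in> ?Inj K" "j \<in> {1..n}" "v \<in> D" for K c j v
    using absorption_density_nonneg[OF lam] c_in[OF that(1), of j] that pd by auto
  have rhs_eq: "rhs z = (\<Sum>K\<in>Pow {1..n}. \<Sum>c\<in>?Inj K. \<Prod>j\<in>{1..n}. ?\<rho> K c j (z j))"
    if z: "z \<in> {1..n} \<rightarrow>\<^sub>E D" for z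
    unfolding rhs
  proof (rule sum.cong[OF refl])
    fix K assume "K \<in> Pow {1..n}"
    then have K: "K \<subseteq> {1..n}" by simp
    have zD: "z j \<in> D" if "j \<in> {1..n}" for j using z that by (rule PiE_mem)
    have sub: "subtuple z L i = z (sorted_list_of_set L ! (i - 1))" if "i \<in> {1..card L}" for L i
      using that by (simp add: subtuple_def)
    note bij = bij_betw_sorted_list_of_set
    have "absorption_weight P X D lam t (card K) (subtuple z K) = (\<Prod>i\<in>{1..card K}. ?h (subtuple z K i))"
      by (rule absorption_weight_eq[OF lam t])
    also have "\<dots> = (\<Prod>i\<in>{1..card K}. ?h (z (sorted_list_of_set K ! (i - 1))))"
      by (intro prod.cong refl) (simp add: sub)
    also have "\<dots> = (\<Prod>j\<in>K. ?h (z j))"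
      by (rule prod.reindex_bij_betw[OF bij[OF fin[OF K]]])
    finally have w: "absorption_weight P X D lam t (card K) (subtuple z K) = (\<Prod>j\<in>K. ?h (z j))" .
    let ?L = "{1..n} - K"
    have card_L: "card ?L = n - card K" using K fin[OF K] by (simp add: card_Diff_subset)
    have L_in: "sorted_list_of_set ?L ! (i - 1) \<in> ?L" if "i \<in> {1..n - card K}" for i
      by (rule bspec[OF bij_betwE[OF bij[OF finite_Diff[OF finite_atLeastAtMost]]]])
        (use that in \<open>simp only: card_L\<close>)
    have sub_L: "subtuple z ?L i = z (sorted_list_of_set ?L ! (i - 1))" if "i \<in> {1..n - card K}" for i
      using sub[of i ?L] that by (simp only: card_L)
    have "(\<integral>y. (\<Prod>i=1..n - card K. pd (subtuple z ?L i) (y i))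
          \<partial>factorial_measure (domain_borel D) (n - card K) (config q x)) =
        factorial_sum (config q x) {1..n - card K} (\<lambda>i. pd (subtuple z ?L i))"
    proof (rule integral_factorial_measure_prod[OF set_config_subset])
      fix i assume i: "i \<in> {1..n - card K}"
      show "pd (subtuple z ?L i) \<in> borel_measurable (domain_borel D)"
        unfolding sub_L[OF i] using L_in[OF i] by (intro pd_meas zD) simp
    qed
    also have "\<dots> = factorial_sum (config q x) {1..n - card K} (\<lambda>i. pd (z (sorted_list_of_set ?L ! (i - 1))))"
      by (rule factorial_sum_cong) (simp only: sub_L)
    \<comment> \<open>The subtuple lists the coordinates of \<open>?L\<close> in increasing order;
      relabelling the slots returns to the original coordinates.\<close>
    also have "\<dots> = factorial_sum (config q x) ?L (\<lambda>j. pd (z j))"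
      by (rule factorial_sum_bij_indices[symmetric]) (use bij[of ?L] in \<open>simp only: card_L finite_Diff finite_atLeastAtMost\<close>)
    also have "\<dots> = (\<Sum>c\<in>?Inj K. \<Prod>j\<in>?L. pd (z j) (x (c j)))"
      by (simp only: factorial_sum_config tuple_sum_def)
    \<comment> \<open>Symmetry of \<open>pd\<close> enters here: the stated density starts at
      \<open>z j\<close>, the particle starts at \<open>x (c j)\<close>.\<close>
    also have "\<dots> = (\<Sum>c\<in>?Inj K. \<Prod>j\<in>?L. pd (x (c j)) (z j))"
      using pd c_in zD by (intro sum.cong prod.cong refl) blast
    finally have "absorption_weight P X D lam t (card K) (subtuple z K) *
        (\<integral>y. (\<Prod>i=1..n - card K. pd (subtuple z ?L i) (y i))
          \<partial>factorial_measure (domain_borel D) (n - card K) (config q x)) =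
        (\<Sum>c\<in>?Inj K. (\<Prod>j\<in>K. ?h (z j)) * (\<Prod>j\<in>?L. pd (x (c j)) (z j)))"
      by (simp only: w sum_distrib_left)
    also have "\<dots> = (\<Sum>c\<in>?Inj K. \<Prod>j\<in>{1..n}. ?\<rho> K c j (z j))"
      by (intro sum.cong refl) (simp only: prod_if_split[OF finite_atLeastAtMost K])
    finally show "absorption_weight P X D lam t (card K) (subtuple z K) *
        (\<integral>y. (\<Prod>i=1..n - card K. pd (subtuple z ?L i) (y i))
          \<partial>factorial_measure (domain_borel D) (n - card K) (config q x)) =
        (\<Sum>c\<in>?Inj K. \<Prod>j\<in>{1..n}. ?\<rho> K c j (z j))" .
  qed
  have space_PiM: "space (PiM {1..n} (\<lambda>_. \<mu>)) = {1..n} \<rightarrow>\<^sub>E D"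
    by (simp add: space_PiM space_\<mu>)
  have comp_meas: "(\<lambda>z. ?\<rho> K c j (z j)) \<in> borel_measurable (PiM {1..n} (\<lambda>_. \<mu>))"
    if "c \<in> ?Inj K" "j \<in> {1..n}" for K c j
    by (rule measurable_compose[OF measurable_component_singleton[OF that(2)] \<rho>_meas[OF that]])
  have "(\<lambda>z. \<Sum>K\<in>Pow {1..n}. \<Sum>c\<in>?Inj K. \<Prod>j\<in>{1..n}. ?\<rho> K c j (z j))
      \<in> borel_measurable (PiM {1..n} (\<lambda>_. \<mu>))"
    by (intro borel_measurable_sum borel_measurable_prod comp_meas)
  then show rhs_meas: "rhs \<in> borel_measurable (PiM {1..n} (\<lambda>_. \<mu>))"
    by (rule measurable_cong[THEN iffD1, rotated]) (simp only: space_PiM rhs_eq)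
  have \<nu>_eq: "\<nu> = density \<mu> (\<lambda>v. ennreal (?h v))"
    by (rule reservoir_measure_eq_density[OF lam t])
  have \<rho>_int: "(\<integral>\<^sup>+v. ennreal (?\<rho> K c j v) * indicator A v \<partial>\<mu>) =
      (if j \<in> K then emeasure \<nu> A else emeasure (tr (x (c j))) A)"
    if "c \<in> ?Inj K" "j \<in> {1..n}" "A \<in> sets (domain_borel D)" for K c j A
  proof (cases "j \<in> K")
    case True
    have "(\<lambda>v. ennreal (?h v)) \<in> borel_measurable \<mu>" using \<rho>_meas[OF that(1,2)] True by simp
    then have "emeasure \<nu> A = (\<integral>\<^sup>+v. ennreal (?h v) * indicator A v \<partial>\<mu>)"
      using that(3) unfolding \<nu>_eq by (intro emeasure_density) (simp_all add: \<mu>)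
    then show ?thesis using True by simp
  next
    case False
    then show ?thesis using c_in[OF that(1), of j] that pd_density by simp
  qed
  show "gas_measure n = density (PiM {1..n} (\<lambda>_. \<mu>)) (\<lambda>z. ennreal (rhs z))"
  proof (rule measure_eqI_boxes[where I = "{1..n}" and S = "\<lambda>_. domain_borel D", OF _ _ _ finite_measure_gas])
    show "sets (density (PiM {1..n} (\<lambda>_. \<mu>)) (\<lambda>z. ennreal (rhs z))) = sets (PiM {1..n} (\<lambda>_. domain_borel D))"
      using sets_PiM_cong[of "{1..n}" "{1..n}" "\<lambda>_. \<mu>" "\<lambda>_. domain_borel D"] \<mu> by simp
    fix B assume B: "\<And>i. i \<in> {1..n} \<Longrightarrow> B i \<in> sets (domain_borel D)"
    then have B': "B i \<in> sets \<mu>" if "i \<in> {1..n}" for i using that \<mu> by simp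
    let ?g = "\<lambda>K c j v. ennreal (?\<rho> K c j v) * indicator (B j) v"
    have g_meas: "?g K c j \<in> borel_measurable \<mu>" if "c \<in> ?Inj K" "j \<in> {1..n}" for K c j
      using \<rho>_meas[OF that] B'[OF that(2)] by measurable
    have "emeasure (density (PiM {1..n} (\<lambda>_. \<mu>)) (\<lambda>z. ennreal (rhs z))) (PiE {1..n} B) =
        (\<integral>\<^sup>+z. ennreal (rhs z) * indicator (PiE {1..n} B) z \<partial>PiM {1..n} (\<lambda>_. \<mu>))"
      using rhs_meas B' by (intro emeasure_density sets_PiM_I_finite) auto
    also have "\<dots> = (\<integral>\<^sup>+z. (\<Sum>K\<in>Pow {1..n}. \<Sum>c\<in>?Inj K. \<Prod>j\<in>{1..n}. ?g K c j (z j)) \<partial>PiM {1..n} (\<lambda>_. \<mu>))"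
    proof (rule nn_integral_cong)
      fix z assume "z \<in> space (PiM {1..n} (\<lambda>_. \<mu>))"
      then have z: "z \<in> {1..n} \<rightarrow>\<^sub>E D" unfolding space_PiM .
      have nn: "0 \<le> ?\<rho> K c j (z j)" if "c \<in> ?Inj K" "j \<in> {1..n}" for K c j
        using that PiE_mem[OF z that(2)] by (rule \<rho>_nonneg)
      have "ennreal (rhs z) = (\<Sum>K\<in>Pow {1..n}. \<Sum>c\<in>?Inj K. \<Prod>j\<in>{1..n}. ennreal (?\<rho> K c j (z j)))"
      proof -
        have "ennreal (rhs z) = (\<Sum>K\<in>Pow {1..n}. \<Sum>c\<in>?Inj K. ennreal (\<Prod>j\<in>{1..n}. ?\<rho> K c j (z j)))"
          unfolding rhs_eq[OF z] using nn by (simp only: sum_ennreal[symmetric] sum_nonneg prod_nonneg)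
        also have "\<dots> = (\<Sum>K\<in>Pow {1..n}. \<Sum>c\<in>?Inj K. \<Prod>j\<in>{1..n}. ennreal (?\<rho> K c j (z j)))"
          using nn by (intro sum.cong refl prod_ennreal[symmetric])
        finally show ?thesis .
      qed
      moreover have "indicator (PiE {1..n} B) z = (\<Prod>j\<in>{1..n}. indicator (B j) (z j) :: ennreal)"
        using z by (intro prod_indicator_PiE[symmetric]) (auto simp: PiE_iff)
      ultimately show "ennreal (rhs z) * indicator (PiE {1..n} B) z =
          (\<Sum>K\<in>Pow {1..n}. \<Sum>c\<in>?Inj K. \<Prod>j\<in>{1..n}. ?g K c j (z j))"
        by (simp only: sum_distrib_right prod.distrib)
    qed
    also have "\<dots> = (\<Sum>K\<in>Pow {1..n}. \<Sum>c\<in>?Inj K. \<integral>\<^sup>+z. (\<Prod>j\<in>{1..n}. ?g K c j (z j)) \<partial>PiM {1..n} (\<lambda>_. \<mu>))"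
    proof -
      have "(\<lambda>z. \<Prod>j\<in>{1..n}. ?g K c j (z j)) \<in> borel_measurable (PiM {1..n} (\<lambda>_. \<mu>))" if "c \<in> ?Inj K" for K c
      proof (rule borel_measurable_prod_ennreal)
        fix j assume j: "j \<in> {1..n}"
        show "(\<lambda>z. ?g K c j (z j)) \<in> borel_measurable (PiM {1..n} (\<lambda>_. \<mu>))"
          by (rule measurable_compose[OF measurable_component_singleton[OF j] g_meas[OF that j]])
      qed
      then show ?thesis by (simp only: nn_integral_sum borel_measurable_sum)
    qed
    also have "\<dots> = (\<Sum>K\<in>Pow {1..n}. \<Sum>c\<in>?Inj K. \<Prod>j\<in>{1..n}. if j \<in> K then emeasure \<nu> (B j) else emeasure (tr (x (c j))) (B j))"
      by (intro sum.cong refl, subst product_nn_integral_prod) (auto simp only: finite_atLeastAtMost g_meas \<rho>_int B cong: prod.cong)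
    also have "\<dots> = (\<Sum>K\<in>Pow {1..n}. (\<Prod>j\<in>K. emeasure \<nu> (B j)) *
        factorial_sum (config q x) ({1..n} - K) (\<lambda>j y. emeasure (tr y) (B j)))"
      by (intro sum.cong refl)
        (simp only: factorial_sum_config tuple_sum_def sum_distrib_left prod_if_split[OF finite_atLeastAtMost] Pow_iff)
    also have "\<dots> = emeasure (gas_measure n) (PiE {1..n} B)"
      using B by (rule emeasure_gas_box[OF gas t \<nu> \<mu>, symmetric])
    finally show "emeasure (gas_measure n) (PiE {1..n} B) =
        emeasure (density (PiM {1..n} (\<lambda>_. \<mu>)) (\<lambda>z. ennreal (rhs z))) (PiE {1..n} B)" ..
  qed simp_all
qed

end
end
end

theorem theorem4p4:
  fixes M :: "'w measure" and F :: "ennreal \<Rightarrow> 'w measure"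
    and P :: "'a::euclidean_space \<Rightarrow> 'w measure" and Y X :: "real \<Rightarrow> 'w \<Rightarrow> 'a"
    and D :: "'a set" and lam :: "'a \<Rightarrow> real" and \<mu> :: "'a measure"
    and N :: "'v measure" and \<xi> \<Theta> :: "real \<Rightarrow> 'v \<Rightarrow> 'a multiset"
    and q :: nat and x :: "nat \<Rightarrow> 'a" and n :: nat
  assumes process: "absorbed_process M F P Y D X"
    and lam_measurable: "lam \<in> borel_measurable (restrict_space borel (- D))"
    and lam_nonneg: "\<And>y. y \<in> - D \<Longrightarrow> 0 \<le> lam y"
    and lam_bounded: "bounded (lam ` (- D))"
    and mu_finite: "finite_measure \<mu>"
    and mu_sets: "sets \<mu> = sets (domain_borel D)"
    and x_in: "\<And>i. i \<in> {1..q} \<Longrightarrow> x i \<in> D"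
    and gas: "boundary_driven_gas P X D lam \<mu> q x N \<xi> \<Theta>"
  shows
    "(\<forall>t\<ge>0. \<forall>f :: (nat \<Rightarrow> 'a) \<Rightarrow> real.
        f \<in> borel_measurable (PiM {1..n} (\<lambda>_. domain_borel D)) \<longrightarrow>
        bounded (f ` ({1..n} \<rightarrow>\<^sub>E D)) \<longrightarrow>
        (\<forall>\<pi> z. \<pi> permutes {1..n} \<longrightarrow> z \<in> {1..n} \<rightarrow>\<^sub>E D \<longrightarrow> f (z \<circ> \<pi>) = f z) \<longrightarrow>
        integrable N (\<lambda>\<omega>. \<integral>z. f z \<partial>factorial_measure (domain_borel D) n (gas_config D \<xi> \<Theta> t \<omega>)) \<and>
        (\<integral>\<omega>. (\<integral>z. f z \<partial>factorial_measure (domain_borel D) n (gas_config D \<xi> \<Theta> t \<omega>)) \<partial>N) =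
        (\<Sum>k=0..n. real (n choose k) *
           (\<integral>z. f z \<partial>join_measure (domain_borel D) n k
              (PiM {1..k} (\<lambda>_. reservoir_measure P X D lam \<mu> t))
              (restrict_space
                 (semigroup_dual P X t (n - k) (factorial_measure (domain_borel D) (n - k) (config q x)))
                 ({1..n - k} \<rightarrow>\<^sub>E D)))))
     \<and>
     (\<forall>(m :: 'a measure) (pd :: real \<Rightarrow> 'a \<Rightarrow> 'a \<Rightarrow> real).
        finite_measure m \<longrightarrow> sets m = sets (domain_borel D) \<longrightarrow>
        (\<forall>t>0. \<forall>u\<in>D. \<forall>v\<in>D. 0 \<le> pd t u v \<and> pd t u v = pd t v u) \<longrightarrow>
        (\<forall>t>0. \<forall>u\<in>D. pd t u \<in> borel_measurable (domain_borel D) \<and>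
           (\<forall>A\<in>sets (domain_borel D).
              emeasure (transition P X t u) A = (\<integral>\<^sup>+v\<in>A. ennreal (pd t u v) \<partial>m))) \<longrightarrow>
        \<mu> = m \<longrightarrow>
        (\<forall>t>0.
           let rhs = (\<lambda>z. \<Sum>I\<in>Pow {1..n}.
                 absorption_weight P X D lam t (card I) (subtuple z I) *
                 (\<integral>y. (\<Prod>i=1..n - card I. pd t (subtuple z ({1..n} - I) i) (y i))
                    \<partial>factorial_measure (domain_borel D) (n - card I) (config q x)))
           in rhs \<in> borel_measurable (PiM {1..n} (\<lambda>_. m)) \<and>
              mixture (PiM {1..n} (\<lambda>_. domain_borel D)) N
                (\<lambda>\<omega>. factorial_measure (domain_borel D) n (gas_config D \<xi> \<Theta> t \<omega>)) =
              density (PiM {1..n} (\<lambda>_. m)) (\<lambda>z. ennreal (rhs z))))"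
proof -
  interpret absorbed_process M F P Y D X by (rule process)
  obtain C where C: "\<And>y. y \<in> - D \<Longrightarrow> lam y \<le> C"
    using lam_bounded unfolding bounded_iff by (auto simp: abs_le_iff)
  \<comment> \<open>Finiteness of the Poisson intensity follows from boundedness of
    \<open>lam\<close> and finiteness of \<open>\<mu>\<close>.\<close>
  have \<nu>: "finite_measure (reservoir_measure P X D lam \<mu> t)" if "0 \<le> t" for t
    using lam_measurable lam_nonneg C that mu_finite mu_sets by (rule finite_measure_reservoir)
  show ?thesis
  proof ((rule conjI; intro allI impI), goal_cases)
    case (1 t f)
    have sym: "\<And>\<pi> z. \<pi> permutes {1..n} \<Longrightarrow> z \<in> {1..n} \<rightarrow>\<^sub>E D \<Longrightarrow> f (z \<circ> \<pi>) = f z"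
      using 1(4) by blast
    show ?case
      using integral_gas_symmetric[OF 1(1) x_in mu_sets \<nu>[OF 1(1)] gas 1(2,3) sym] by blast
  next
    case (2 m pd t)
    have t: "0 \<le> t" using 2(6) by simp
    have pd: "\<And>u v. u \<in> D \<Longrightarrow> v \<in> D \<Longrightarrow> 0 \<le> pd t u v \<and> pd t u v = pd t v u"
      and pd_meas: "\<And>u. u \<in> D \<Longrightarrow> pd t u \<in> borel_measurable (domain_borel D)"
      and pd_density: "\<And>u A. u \<in> D \<Longrightarrow> A \<in> sets (domain_borel D) \<Longrightarrow>
        emeasure (transition P X t u) A = (\<integral>\<^sup>+v\<in>A. ennreal (pd t u v) \<partial>\<mu>)"
      using 2(3,4,5,6) by auto
    note dens = gas_density[OF t x_in mu_sets \<nu>[OF t] gas lam_measurable lam_nonneg C mu_finite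
        pd pd_meas pd_density refl]
    show ?case
      unfolding Let_def \<open>\<mu> = m\<close>[symmetric] using dens by blast
  qed
qed

end
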